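(* Let $(\pi^n)_{n\ge0}$ be a sequence of elements of $\Delta(\mathbb{N}^* )$ such that for all $p\in(0,+\infty)$, $\lim_{n\to+\infty}I_p(\pi^n)=0$. Then in any finite zero-sum stochastic game, $(v_{\pi^n})_{n\ge0}$ converges to $v_\infty$ as $n\to+\infty$.
   Context: Notation: $\mathbb{N}^*=\{1,2,\dots\}$; $\Delta(C)$ is the set of probability measures on $C$; $\Delta(\mathbb{N}^* )$ is the set of sequences $\pi=(\pi_m)_{m\ge1}$ of nonnegative reals with $\sum_{m\ge1}\pi_m=1$. For $\pi\in\Delta(\mathbb{N}^* )$ and $p\in(0,+\infty)$, $I_p(\pi)=\sum_{m\ge1}|(\pi_{m+1})^p-(\pi_m)^p|\in(0,+\infty]$. Stochastic game: A finite zero-sum stochastic game $\Gamma$ consists of nonempty finite sets $K$ (states), $I$ (actions of Player 1), $J$ (actions of Player 2), a payoff function $g:K\times I\times J\to[0,1]$ and a transition function $q:K\times I\times J\to\Delta(K)$. Given an initial state $k_1\in K$, at each stage $m\ge1$ the players simultaneously and independently choose $i_m\in I$, $j_m\in J$; the stage payoff (to Player 1) is $g_m=g(k_m,i_m,j_m)$; the next state $k_{m+1}$ is drawn from $q(k_m,i_m,j_m)$, and $(k_{m+1},i_m,j_m)$ is publicly announced. Histories before stage $m$ form $H_m=(K\times I\times J)^{m-1}\times K$. A behavioral strategy of Player 1 (resp. 2) is a map $\sigma:\bigcup_{m\ge1}H_m\to\Delta(I)$ (resp. $\tau:\bigcup_{m\ge1}H_m\to\Delta(J)$); the sets of these are $\Sigma$,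 $\mathcal{T}$. A triple $(k_1,\sigma,\tau)$ induces a probability $\mathbb{P}^{k_1}_{\sigma,\tau}$ on infinite plays, with expectation $\mathbb{E}^{k_1}_{\sigma,\tau}$. Values: For $\pi\in\Delta(\mathbb{N}^* )$, $\gamma^{k_1}_\pi(\sigma,\tau)=\mathbb{E}^{k_1}_{\sigma,\tau}\left(\sum_{m\ge1}\pi_m g_m\right)$ and $v_\pi(k_1)=\max_{\sigma\in\Sigma}\min_{\tau\in\mathcal{T}}\gamma^{k_1}_\pi(\sigma,\tau)=\min_{\tau\in\mathcal{T}}\max_{\sigma\in\Sigma}\gamma^{k_1}_\pi(\sigma,\tau)$. For $\lambda\in(0,1]$, $v_\lambda$ is $v_\pi$ with $\pi_m=\lambda(1-\lambda)^{m-1}$; for $n\in\mathbb{N}^*$, $v_n$ is $v_\pi$ with $\pi_m=\frac1n 1_{m\le n}$. It is known (Bewley–Kohlberg, Mertens–Neyman) that $\Gamma$ has a uniform value $v_\infty:K\to[0,1]$ and $v_\infty=\lim_{\lambda\to0}v_\lambda=\lim_{n\to\infty}v_n$. Here $v_\infty$ is the uniform value means: for all $k_1\in K$ and $\epsilon>0$ there exist $(\sigma^*,\tau^* )\in\Sigma\times\mathcal{T}$ and $\bar n$ such that for all $n\ge\bar n$ and all $(\sigma,\tau)$, the expected $n$-stage average payoffs satisfy $\gamma_n^{k_1}(\sigma^*,\tau)\ge v_\infty(k_1)-\epsilon$ and $\gamma_n^{k_1}(\sigma,\tau^* )\le v_\infty(k_1)+\epsilon$. *)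

theory Defs
  imports "HOL-Probability.Probability"
begin

section \<open>Weight sequences\<close>

text \<open>
  A sequence of weights over the stages \<open>1, 2, \<dots>\<close> is a function on \<^typ>\<open>nat\<close>; its value at \<open>0\<close>
  plays no role.
\<close>

definition stage_weights :: "(nat \<Rightarrow> real) set" where
  "stage_weights = {\<pi>. (\<forall>m\<ge>1. 0 \<le> \<pi> m) \<and> (\<lambda>m. \<pi> (Suc m)) sums 1}"

text \<open>
  The sum runs over the stages \<open>Suc m \<ge> 1\<close> and may be infinite.  Note that \<open>0 powr p = 0\<close>.
\<close>

definition power_variation :: "real \<Rightarrow> (nat \<Rightarrow> real) \<Rightarrow> ennreal" where
  "power_variation p \<pi> = (\<Sum>m. ennreal \<bar>\<pi> (Suc (Suc m)) powr p - \<pi> (Suc m) powr p\<bar>)"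

definition uniform_weights :: "nat \<Rightarrow> nat \<Rightarrow> real" where
  "uniform_weights n m = (if 1 \<le> m \<and> m \<le> n then 1 / real n else 0)"


section \<open>Finite zero-sum stochastic games\<close>

text \<open>
  States and actions are the elements of finite types.  A game is given by its payoff function
  \<open>g :: 'k \<Rightarrow> 'i \<Rightarrow> 'j \<Rightarrow> real\<close> and its transition function \<open>q :: 'k \<Rightarrow> 'i \<Rightarrow> 'j \<Rightarrow> 'k pmf\<close>.

  A history before stage \<open>m\<close> consists of the list of the \<open>m - 1\<close> past triples
  (state, action of Player 1, action of Player 2), oldest first, and the current state.
\<close>

type_synonym ('k, 'i, 'j) history = "('k \<times> 'i \<times> 'j) list \<times> 'k"

type_synonym ('k, 'i, 'j) strategy1 = "('k, 'i, 'j) history \<Rightarrow> 'i pmf"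

type_synonym ('k, 'i, 'j) strategy2 = "('k, 'i, 'j) history \<Rightarrow> 'j pmf"

text \<open>
  A play is a function \<open>\<omega>\<close> on \<^typ>\<open>nat\<close>, where \<open>\<omega> m\<close> is the triple \<open>(k, i, j)\<close> of stage \<open>Suc m\<close>.
\<close>

type_synonym ('k, 'i, 'j) play = "nat \<Rightarrow> 'k \<times> 'i \<times> 'j"

fun state_law ::
  "('k \<Rightarrow> 'i \<Rightarrow> 'j \<Rightarrow> 'k pmf) \<Rightarrow> 'k \<Rightarrow> nat \<Rightarrow> ('k, 'i, 'j) play \<Rightarrow> 'k pmf"
where
  "state_law q k\<^sub>1 0 \<omega> = return_pmf k\<^sub>1"
| "state_law q k\<^sub>1 (Suc m) \<omega> = (case \<omega> m of (k, i, j) \<Rightarrow> q k i j)"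

text \<open>
  The conditional law of \<open>\<omega> m\<close> given the past \<open>\<omega> 0, \<dots>, \<omega> (m - 1)\<close>.  Given the history, the two
  actions are independent.
\<close>

definition stage_law ::
  "('k \<Rightarrow> 'i \<Rightarrow> 'j \<Rightarrow> 'k pmf) \<Rightarrow> 'k \<Rightarrow> ('k, 'i, 'j) strategy1 \<Rightarrow> ('k, 'i, 'j) strategy2 \<Rightarrow>
    nat \<Rightarrow> ('k, 'i, 'j) play \<Rightarrow> ('k \<times> 'i \<times> 'j) pmf"
where
  "stage_law q k\<^sub>1 \<sigma> \<tau> m \<omega> =
    bind_pmf (state_law q k\<^sub>1 m \<omega>) (\<lambda>k.
      let h = (map \<omega> [0..<m], k)
      in map_pmf (\<lambda>(i, j). (k, i, j)) (pair_pmf (\<sigma> h) (\<tau> h)))"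

text \<open>The law of the play is the Ionescu-Tulcea extension of the conditional laws.\<close>

definition play_measure ::
  "('k::finite \<Rightarrow> 'i::finite \<Rightarrow> 'j::finite \<Rightarrow> 'k pmf) \<Rightarrow> 'k \<Rightarrow>
    ('k, 'i, 'j) strategy1 \<Rightarrow> ('k, 'i, 'j) strategy2 \<Rightarrow> ('k, 'i, 'j) play measure"
where
  "play_measure q k\<^sub>1 \<sigma> \<tau> =
    projective_family.lim UNIV
      (Ionescu_Tulcea.CI (\<lambda>m \<omega>. measure_pmf (stage_law q k\<^sub>1 \<sigma> \<tau> m \<omega>)) (\<lambda>_. count_space UNIV))
      (\<lambda>_. count_space UNIV)"

lemma Ionescu_Tulcea_stage_law:
  fixes q :: "'k::finite \<Rightarrow> 'i::finite \<Rightarrow> 'j::finite \<Rightarrow> 'k pmf"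
  shows "Ionescu_Tulcea (\<lambda>m \<omega>. measure_pmf (stage_law q k\<^sub>1 \<sigma> \<tau> m \<omega>)) (\<lambda>_. count_space UNIV)"
proof
  fix n :: nat
  have "Pi\<^sub>M {0..<n} (\<lambda>_. count_space UNIV) =
      count_space (PiE {0..<n} (\<lambda>_. UNIV :: ('k \<times> 'i \<times> 'j) set))"
    by (intro count_space_PiM_finite) auto
  then show "(\<lambda>\<omega>. measure_pmf (stage_law q k\<^sub>1 \<sigma> \<tau> n \<omega>))
      \<in> Pi\<^sub>M {0..<n} (\<lambda>_. count_space UNIV) \<rightarrow>\<^sub>M subprob_algebra (count_space UNIV)"
    by (simp add: measure_subprob)
qed

definition expected_payoff ::
  "('k::finite \<Rightarrow> 'i::finite \<Rightarrow> 'j::finite \<Rightarrow> real) \<Rightarrow> ('k \<Rightarrow> 'i \<Rightarrow> 'j \<Rightarrow> 'k pmf) \<Rightarrow>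
    (nat \<Rightarrow> real) \<Rightarrow> 'k \<Rightarrow> ('k, 'i, 'j) strategy1 \<Rightarrow> ('k, 'i, 'j) strategy2 \<Rightarrow> real"
where
  "expected_payoff g q \<pi> k\<^sub>1 \<sigma> \<tau> =
    (\<integral>\<omega>. (\<Sum>m. \<pi> (Suc m) * (case \<omega> m of (k, i, j) \<Rightarrow> g k i j)) \<partial>play_measure q k\<^sub>1 \<sigma> \<tau>)"

text \<open>
  For payoffs in \<open>[0, 1]\<close> and weights in \<^const>\<open>stage_weights\<close>, the expected payoffs lie in
  \<open>[0, 1]\<close>, so all suprema and infima below are of nonempty bounded sets.  The value of the
  \<open>\<pi>\<close>-weighted game is the common value of \<open>maxmin_value\<close> and \<open>minmax_value\<close>.
\<close>

definition maxmin_value ::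
  "('k::finite \<Rightarrow> 'i::finite \<Rightarrow> 'j::finite \<Rightarrow> real) \<Rightarrow> ('k \<Rightarrow> 'i \<Rightarrow> 'j \<Rightarrow> 'k pmf) \<Rightarrow>
    (nat \<Rightarrow> real) \<Rightarrow> 'k \<Rightarrow> real"
where
  "maxmin_value g q \<pi> k\<^sub>1 = (SUP \<sigma>. INF \<tau>. expected_payoff g q \<pi> k\<^sub>1 \<sigma> \<tau>)"

definition minmax_value ::
  "('k::finite \<Rightarrow> 'i::finite \<Rightarrow> 'j::finite \<Rightarrow> real) \<Rightarrow> ('k \<Rightarrow> 'i \<Rightarrow> 'j \<Rightarrow> 'k pmf) \<Rightarrow>
    (nat \<Rightarrow> real) \<Rightarrow> 'k \<Rightarrow> real"
where
  "minmax_value g q \<pi> k\<^sub>1 = (INF \<tau>. SUP \<sigma>. expected_payoff g q \<pi> k\<^sub>1 \<sigma> \<tau>)"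

definition is_uniform_value ::
  "('k::finite \<Rightarrow> 'i::finite \<Rightarrow> 'j::finite \<Rightarrow> real) \<Rightarrow> ('k \<Rightarrow> 'i \<Rightarrow> 'j \<Rightarrow> 'k pmf) \<Rightarrow>
    ('k \<Rightarrow> real) \<Rightarrow> bool"
where
  "is_uniform_value g q v \<longleftrightarrow>
    (\<forall>k\<^sub>1. \<forall>\<epsilon>>0. \<exists>\<sigma>' \<tau>'. \<exists>N\<ge>1. \<forall>n\<ge>N.
      (\<forall>\<tau>. expected_payoff g q (uniform_weights n) k\<^sub>1 \<sigma>' \<tau> \<ge> v k\<^sub>1 - \<epsilon>) \<and>
      (\<forall>\<sigma>. expected_payoff g q (uniform_weights n) k\<^sub>1 \<sigma> \<tau>' \<le> v k\<^sub>1 + \<epsilon>))"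

end

theory Submission
  imports Defs "HOL-Computational_Algebra.Polynomial"
begin

text \<open>
  Let \<open>v\<^sub>\<lambda>\<close> be the \<open>\<lambda>\<close>-discounted value and \<open>v\<close> the uniform value; Abel summation gives
  \<open>v\<^sub>\<lambda> \<longrightarrow> v\<close>.  The rate of this convergence is polynomial: following Attia and Oliu-Barton,
  \<open>v\<^sub>\<lambda> k\<close> is the unique \<open>z\<close> at which a matrix game over the pure stationary strategies, with entries
  polynomial in \<open>\<lambda>\<close> and \<open>z\<close>, has value \<open>0\<close>.  As the value of a matrix game is attained at a basic
  solution of a linear program, \<open>v\<^sub>\<lambda> k\<close> is a root of one fixed nonzero polynomial in \<open>\<lambda>\<close> and \<open>z\<close>,
  whence \<open>\<bar>v\<^sub>\<lambda> - v\<bar> \<le> C \<lambda>\<^sup>a\<close> for small \<open>\<lambda>\<close> and some \<open>a > 0\<close>.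

  In the \<open>\<pi>\<close>-weighted game, the equivalent discount rate at stage \<open>m\<close> is \<open>\<pi> m\<close> divided by the tail
  \<open>\<pi> m + \<pi> (m + 1) + \<dots>\<close>.  Each player plays optimally in the discounted game whose rate is a
  piecewise constant approximation of this one.  The error of the approximation is controlled by its
  relative precision, and a jump costs at most a multiple of \<open>\<lambda>\<^sup>a\<close>, where \<open>\<lambda>\<close> is the larger of the
  two rates.  Since a jump takes place only after a relative change of the rate that is bounded from
  below, the total cost of the jumps is bounded in terms of the variation of \<open>\<pi>\<^sup>a\<close>.
\<close>

section \<open>The law of a play\<close>

text \<open>The obstacle: optimal play at one rate protects the value of that rate, while the next
  stage is played for the value of another, and these discrepancies add up over a number of stages
  that depends on the weights. They are estimated through \<open>v\<close>, by
  \<open>C (\<lambda>\<^sup>a + \<lambda>'\<^sup>a)\<close>, which does not shrink as the two rates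
  approach each other. A slowly drifting rate would be charged at every stage; holding it constant
  until it is off by a fixed factor avoids this. The exponent \<open>a\<close> is the least
  reciprocal, over the states, of a root multiplicity plus one. It depends on the game, which is
  where the variations of all powers come in. Two corrections keep the equivalent rate usable. The
  comparison stops once the tail falls below a threshold \<open>d\<close>, as division by a
  vanishing tail would not leave the rates small. Weights are raised to a tiny floor
  \<open>t > 0\<close>, so that stages of weight \<open>0\<close> have a positive rate as
  well.\<close>

lemma (in Ionescu_Tulcea) CI_atLeastLessThan: "CI {0..<n} = C 0 n (\<lambda>_. undefined)"
proof -
  have "up_to {0..<n} = n"
    by (rule antisym) (use up_to[of "{0..<n}"] in \<open>auto simp: up_to_iff\<close>)
  moreover have "distr (C 0 n (\<lambda>_. undefined)) (PiM {0..<n} M) (\<lambda>f. restrict f {0..<n})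
      = C 0 n (\<lambda>_. undefined)"
    using distr_C[of n n "\<lambda>_. undefined" 0] by simp
  ultimately show ?thesis
    by (simp add: CI_def)
qed

lemma (in Ionescu_Tulcea) nn_integral_lim_restrict:
  assumes f: "f \<in> borel_measurable (PiM {0..<n} M)"
  shows "(\<integral>\<^sup>+\<omega>. f (restrict \<omega> {0..<n}) \<partial>PF.lim) = (\<integral>\<^sup>+\<omega>. f \<omega> \<partial>C 0 n (\<lambda>_. undefined))"
proof -
  have "(\<integral>\<^sup>+\<omega>. f (restrict \<omega> {0..<n}) \<partial>PF.lim)
      = (\<integral>\<^sup>+\<omega>. f \<omega> \<partial>distr PF.lim (PiM {0..<n} M) (\<lambda>x. restrict x {0..<n}))"
    by (subst nn_integral_distr)
      (use f in \<open>auto simp: measurable_cong_sets[OF PF.sets_lim refl]\<close>)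
  then show ?thesis
    by (simp add: distr_lim CI_atLeastLessThan)
qed

text \<open>Only the first \<open>Suc n\<close> coordinates matter, so the integral lives on a
  finite-horizon law, whose last step is a bind with the kernel \<open>P n\<close>.\<close>

lemma (in Ionescu_Tulcea) nn_integral_lim_coordinate:
  assumes f[measurable]: "f \<in> borel_measurable (M n)"
  shows "(\<integral>\<^sup>+\<omega>. f (\<omega> n) \<partial>PF.lim)
    = (\<integral>\<^sup>+\<omega>. (\<integral>\<^sup>+x. f x \<partial>P n (restrict \<omega> {0..<n})) \<partial>PF.lim)"
proof -
  let ?u = "\<lambda>_::nat. undefined"
  have u: "?u \<in> space (PiM {0..<0} M)"
    by (simp add: space_PiM)
  have "(\<integral>\<^sup>+\<omega>. f (\<omega> n) \<partial>PF.lim) = (\<integral>\<^sup>+\<omega>. f (restrict \<omega> {0..<Suc n} n) \<partial>PF.lim)"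
    by simp
  also have "\<dots> = (\<integral>\<^sup>+\<omega>. f (\<omega> n) \<partial>C 0 (Suc n) ?u)"
    by (rule nn_integral_lim_restrict) measurable
  also have "\<dots> = (\<integral>\<^sup>+\<omega>. (\<integral>\<^sup>+\<omega>'. f (\<omega>' n) \<partial>eP n \<omega>) \<partial>C 0 n ?u)"
    unfolding C.simps add_0
  proof (rule nn_integral_bind[where B="PiM {0..<Suc n} M"])
    show "(\<lambda>\<omega>. f (\<omega> n)) \<in> borel_measurable (PiM {0..<Suc n} M)"
      by measurable
    have "sets (C 0 n ?u) = sets (PiM {0..<n} M)"
      using sets_C[OF u, of n] by simp
    then show "eP n \<in> C 0 n ?u \<rightarrow>\<^sub>M subprob_algebra (PiM {0..<Suc n} M)"
      using measurable_eP measurable_cong_sets by blast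
  qed
  also have "\<dots> = (\<integral>\<^sup>+\<omega>. (\<integral>\<^sup>+x. f x \<partial>P n \<omega>) \<partial>C 0 n ?u)"
    by (intro nn_integral_cong, subst nn_integral_eP) (auto simp: space_C[OF u])
  also have "\<dots> = (\<integral>\<^sup>+\<omega>. (\<integral>\<^sup>+x. f x \<partial>P n (restrict \<omega> {0..<n})) \<partial>PF.lim)"
    by (rule nn_integral_lim_restrict[symmetric])
      (rule measurable_compose[OF P nn_integral_measurable_subprob_algebra[OF f]])
  finally show ?thesis .
qed

lemma stage_law_cong:
  assumes "\<And>l. l < m \<Longrightarrow> \<omega> l = \<omega>' l"
  shows "stage_law q k \<sigma> \<tau> m \<omega> = stage_law q k \<sigma> \<tau> m \<omega>'"
proof -
  have "state_law q k m \<omega> = state_law q k m \<omega>'"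
    using assms by (cases m) auto
  moreover have "map \<omega> [0..<m] = map \<omega>' [0..<m]"
    using assms by auto
  ultimately show ?thesis
    by (simp only: stage_law_def)
qed

lemma prob_space_play_measure: "prob_space (play_measure q k \<sigma> \<tau>)"
proof -
  interpret Ionescu_Tulcea "\<lambda>m \<omega>. measure_pmf (stage_law q k \<sigma> \<tau> m \<omega>)" "\<lambda>_. count_space UNIV"
    by (rule Ionescu_Tulcea_stage_law)
  show ?thesis
    unfolding play_measure_def
  proof (rule prob_space_distrD)
    show "(\<lambda>x. restrict x {}) \<in> PF.lim \<rightarrow>\<^sub>M PiM {} (\<lambda>_. count_space UNIV)"
      by (auto simp: measurable_cong_sets[OF PF.sets_lim refl])
    show "prob_space (distr PF.lim (PiM {} (\<lambda>_. count_space UNIV)) (\<lambda>x. restrict x {}))"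
      using PF.prob_space_P[of "{}"] by (simp add: distr_lim)
  qed
qed

lemma sets_play_measure: "sets (play_measure q k \<sigma> \<tau>) = sets (PiM UNIV (\<lambda>_. count_space UNIV))"
proof -
  interpret Ionescu_Tulcea "\<lambda>m \<omega>. measure_pmf (stage_law q k \<sigma> \<tau> m \<omega>)" "\<lambda>_. count_space UNIV"
    by (rule Ionescu_Tulcea_stage_law)
  show ?thesis
    by (simp add: play_measure_def PF.sets_lim)
qed

lemma measurable_play_coordinate [measurable]:
  "(\<lambda>\<omega>. f (\<omega> m)) \<in> borel_measurable (play_measure q k \<sigma> \<tau>)"
  unfolding measurable_cong_sets[OF sets_play_measure refl]
  by (rule measurable_compose[OF measurable_component_singleton]) auto

text \<open>Finitely many coordinates in a finite type range over a discrete space, on which every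
  function is measurable.\<close>

lemma measurable_play_past:
  assumes "\<And>\<omega> \<omega>'. (\<And>l. l < m \<Longrightarrow> \<omega> l = \<omega>' l) \<Longrightarrow> f \<omega> = f \<omega>'"
  shows "f \<in> borel_measurable (play_measure q k \<sigma> (\<tau> :: ('k::finite,'i::finite,'j::finite) strategy2))"
proof -
  have eq: "Pi\<^sub>M {0..<m} (\<lambda>_. count_space UNIV) =
      count_space (PiE {0..<m} (\<lambda>_. UNIV :: ('k \<times> 'i \<times> 'j) set))"
    by (intro count_space_PiM_finite) auto
  have "(\<lambda>\<omega>. f (restrict \<omega> {0..<m})) \<in> borel_measurable (Pi\<^sub>M UNIV (\<lambda>_. count_space UNIV))"
    by (rule measurable_compose[OF measurable_restrict_subset]) (auto simp: eq)
  moreover have "(\<lambda>\<omega>. f (restrict \<omega> {0..<m})) = f"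
    by (intro ext assms) auto
  ultimately show ?thesis
    by (simp add: measurable_cong_sets[OF sets_play_measure refl])
qed

lemma integrable_play:
  fixes f :: "_ \<Rightarrow> real"
  assumes "f \<in> borel_measurable (play_measure q k \<sigma> \<tau>)" "\<And>\<omega>. \<bar>f \<omega>\<bar> \<le> B"
  shows "integrable (play_measure q k \<sigma> \<tau>) f"
proof -
  interpret prob_space "play_measure q k \<sigma> \<tau>"
    by (rule prob_space_play_measure)
  show ?thesis
    by (rule integrable_const_bound[where B = B]) (use assms in auto)
qed

lemma finite_type_bounded:
  fixes F :: "'a::finite \<Rightarrow> real"
  obtains B where "\<And>t. \<bar>F t\<bar> \<le> B"
  by (rule that[of "Max (range (\<lambda>t. \<bar>F t\<bar>))"]) (auto intro: Max_ge)

lemma integral_pmf_bounded: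
  assumes "\<And>t. \<bar>F t\<bar> \<le> (B::real)"
  shows "\<bar>\<integral>t. F t \<partial>measure_pmf p\<bar> \<le> B"
proof -
  have "integrable (measure_pmf p) F"
    by (rule measure_pmf.integrable_const_bound[where B = B]) (use assms in auto)
  then have "(\<integral>t. \<bar>F t\<bar> \<partial>measure_pmf p) \<le> B"
    by (intro measure_pmf.integral_le_const) (use assms in auto)
  then show ?thesis
    using integral_abs_bound[of "measure_pmf p" F] by linarith
qed

lemma integral_play_coordinate:
  fixes F :: "'k::finite \<times> 'i::finite \<times> 'j::finite \<Rightarrow> real"
  shows "(\<integral>\<omega>. F (\<omega> m) \<partial>play_measure q k \<sigma> \<tau>)
    = (\<integral>\<omega>. (\<integral>t. F t \<partial>stage_law q k \<sigma> \<tau> m \<omega>) \<partial>play_measure q k \<sigma> \<tau>)"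
proof -
  let ?P = "play_measure q k \<sigma> \<tau>"
  let ?S = "stage_law q k \<sigma> \<tau> m"
  interpret Ionescu_Tulcea "\<lambda>m \<omega>. measure_pmf (stage_law q k \<sigma> \<tau> m \<omega>)" "\<lambda>_. count_space UNIV"
    by (rule Ionescu_Tulcea_stage_law)
  interpret prob_space ?P
    by (rule prob_space_play_measure)
  obtain B where B: "\<And>t. \<bar>F t\<bar> \<le> B"
    by (rule finite_type_bounded[of F]) blast
  \<comment> \<open>The disintegration was proved for nonnegative integrals; adding the bound
    \<open>B\<close> reduces to this case.\<close>
  define G where "G t = F t + B" for t
  have G: "0 \<le> G t" "\<bar>G t\<bar> \<le> 2 * B" for t
    using B[of t] by (auto simp: G_def)
  have intF: "integrable (measure_pmf p) F" for p
    by (intro integrable_measure_pmf_finite) auto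
  have intG: "integrable (measure_pmf p) G" for p
    by (intro integrable_measure_pmf_finite) auto
  have meas: "(\<lambda>\<omega>. \<integral>t. G t \<partial>?S \<omega>) \<in> borel_measurable ?P" "(\<lambda>\<omega>. \<integral>t. F t \<partial>?S \<omega>) \<in> borel_measurable ?P"
    by (rule measurable_play_past[of m], metis stage_law_cong)+
  have GP: "integrable ?P (\<lambda>\<omega>. G (\<omega> m))" "integrable ?P (\<lambda>\<omega>. F (\<omega> m))"
    by (rule integrable_play[OF _ G(2)], measurable) (rule integrable_play[OF _ B], measurable)
  have GS: "integrable ?P (\<lambda>\<omega>. \<integral>t. G t \<partial>?S \<omega>)" "integrable ?P (\<lambda>\<omega>. \<integral>t. F t \<partial>?S \<omega>)"
    by (rule integrable_play[OF meas(1) integral_pmf_bounded[OF G(2)]],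
        rule integrable_play[OF meas(2) integral_pmf_bounded[OF B]])
  have "ennreal (\<integral>\<omega>. G (\<omega> m) \<partial>?P) = (\<integral>\<^sup>+\<omega>. G (\<omega> m) \<partial>?P)"
    by (rule nn_integral_eq_integral[symmetric]) (use GP G in auto)
  also have "\<dots> = (\<integral>\<^sup>+\<omega>. (\<integral>\<^sup>+x. G x \<partial>?S (restrict \<omega> {0..<m})) \<partial>?P)"
    unfolding play_measure_def by (rule nn_integral_lim_coordinate) auto
  also have "\<dots> = (\<integral>\<^sup>+\<omega>. (\<integral>\<^sup>+x. G x \<partial>?S \<omega>) \<partial>?P)"
    by (intro nn_integral_cong) (metis (no_types, lifting) stage_law_cong restrict_apply' atLeastLessThan_iff zero_le)
  also have "\<dots> = (\<integral>\<^sup>+\<omega>. ennreal (\<integral>x. G x \<partial>?S \<omega>) \<partial>?P)"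
    by (intro nn_integral_cong nn_integral_eq_integral intG) (use G in auto)
  also have "\<dots> = ennreal (\<integral>\<omega>. (\<integral>x. G x \<partial>?S \<omega>) \<partial>?P)"
    by (rule nn_integral_eq_integral) (use GS G in auto)
  finally have "(\<integral>\<omega>. G (\<omega> m) \<partial>?P) = (\<integral>\<omega>. (\<integral>x. G x \<partial>?S \<omega>) \<partial>?P)"
    by (simp add: G integral_nonneg_AE)
  moreover have "(\<integral>\<omega>. G (\<omega> m) \<partial>?P) = (\<integral>\<omega>. F (\<omega> m) \<partial>?P) + B"
    unfolding G_def using GP prob_space by (subst Bochner_Integration.integral_add) auto
  moreover have "(\<integral>x. G x \<partial>?S \<omega>) = (\<integral>x. F x \<partial>?S \<omega>) + B" for \<omega>
    unfolding G_def using intF by (subst Bochner_Integration.integral_add) auto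
  moreover have "(\<integral>\<omega>. (\<integral>x. F x \<partial>?S \<omega>) + B \<partial>?P) = (\<integral>\<omega>. (\<integral>x. F x \<partial>?S \<omega>) \<partial>?P) + B"
    using GS prob_space by (subst Bochner_Integration.integral_add) auto
  ultimately show ?thesis
    by simp
qed

section \<open>Stage-by-stage expectations and the one-stage game\<close>

definition stage_payoff ::
  "('k::finite \<Rightarrow> 'i::finite \<Rightarrow> 'j::finite \<Rightarrow> real) \<Rightarrow> ('k \<Rightarrow> 'i \<Rightarrow> 'j \<Rightarrow> 'k pmf) \<Rightarrow> 'k \<Rightarrow>
    ('k, 'i, 'j) strategy1 \<Rightarrow> ('k, 'i, 'j) strategy2 \<Rightarrow> nat \<Rightarrow> real"
where
  "stage_payoff g q k\<^sub>1 \<sigma> \<tau> m = (\<integral>\<omega>. (case \<omega> m of (k, i, j) \<Rightarrow> g k i j) \<partial>play_measure q k\<^sub>1 \<sigma> \<tau>)"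

text \<open>The state meant is that of stage \<open>Suc m\<close>. Integrating its conditional law,
  not a coordinate of the play, makes the case \<open>0\<close> explicit and expresses the case
  \<open>Suc m\<close> through the triple \<open>\<omega> m\<close>, on which the payoff depends
  too.\<close>

definition state_expectation ::
  "('k::finite \<Rightarrow> 'i::finite \<Rightarrow> 'j::finite \<Rightarrow> 'k pmf) \<Rightarrow> 'k \<Rightarrow>
    ('k, 'i, 'j) strategy1 \<Rightarrow> ('k, 'i, 'j) strategy2 \<Rightarrow> ('k \<Rightarrow> real) \<Rightarrow> nat \<Rightarrow> real"
where
  "state_expectation q k\<^sub>1 \<sigma> \<tau> f m = (\<integral>\<omega>. (\<integral>k. f k \<partial>state_law q k\<^sub>1 m \<omega>) \<partial>play_measure q k\<^sub>1 \<sigma> \<tau>)"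

text \<open>The payoff of the one-stage game in Shapley's equation, at discount rate
  \<open>\<mu>\<close> and with continuation values \<open>v\<close>.\<close>

definition continuation_payoff ::
  "('k::finite \<Rightarrow> 'i::finite \<Rightarrow> 'j::finite \<Rightarrow> real) \<Rightarrow> ('k \<Rightarrow> 'i \<Rightarrow> 'j \<Rightarrow> 'k pmf) \<Rightarrow> real \<Rightarrow>
    ('k \<Rightarrow> real) \<Rightarrow> 'k \<Rightarrow> 'i \<Rightarrow> 'j \<Rightarrow> real"
where
  "continuation_payoff g q \<mu> v k i j = \<mu> * g k i j + (1 - \<mu>) * (\<Sum>k'\<in>UNIV. pmf (q k i j) k' * v k')"

lemma integral_pmf_finite:
  fixes f :: "'a::finite \<Rightarrow> real"
  shows "(\<integral>t. f t \<partial>measure_pmf p) = (\<Sum>t\<in>UNIV. pmf p t * f t)"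
  by (subst integral_measure_pmf_real[where A = UNIV]) (auto simp: mult.commute)

lemma integral_stage_law:
  fixes F :: "'k::finite \<times> 'i::finite \<times> 'j::finite \<Rightarrow> real"
  shows "(\<integral>t. F t \<partial>stage_law q k\<^sub>1 \<sigma> \<tau> m \<omega>)
    = (\<integral>k. (\<Sum>i\<in>UNIV. \<Sum>j\<in>UNIV. pmf (\<sigma> (map \<omega> [0..<m], k)) i * pmf (\<tau> (map \<omega> [0..<m], k)) j * F (k, i, j))
        \<partial>state_law q k\<^sub>1 m \<omega>)"
proof -
  have "(\<integral>t. F t \<partial>stage_law q k\<^sub>1 \<sigma> \<tau> m \<omega>) =
     (\<integral>k. (\<integral>t. F t \<partial>map_pmf (\<lambda>(i, j). (k, i, j))
        (pair_pmf (\<sigma> (map \<omega> [0..<m], k)) (\<tau> (map \<omega> [0..<m], k)))) \<partial>state_law q k\<^sub>1 m \<omega>)"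
    unfolding stage_law_def Let_def
    by (subst pmf_expectation_bind[where A = UNIV]) (auto simp: integral_pmf_finite)
  also have "\<dots> = (\<integral>k. (\<Sum>i\<in>UNIV. \<Sum>j\<in>UNIV. pmf (\<sigma> (map \<omega> [0..<m], k)) i * pmf (\<tau> (map \<omega> [0..<m], k)) j * F (k, i, j))
        \<partial>state_law q k\<^sub>1 m \<omega>)"
    unfolding integral_map_pmf
    by (intro Bochner_Integration.integral_cong refl)
      (auto simp: integral_pmf_finite pmf_pair sum.cartesian_product simp flip: UNIV_Times_UNIV intro!: sum.cong)
  finally show ?thesis .
qed

context
  fixes g :: "'k::finite \<Rightarrow> 'i::finite \<Rightarrow> 'j::finite \<Rightarrow> real" and q :: "'k \<Rightarrow> 'i \<Rightarrow> 'j \<Rightarrow> 'k pmf"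
    and k\<^sub>1 :: 'k and \<sigma> :: "('k, 'i, 'j) strategy1" and \<tau> :: "('k, 'i, 'j) strategy2"
begin

lemma integrable_state_law:
  "integrable (play_measure q k\<^sub>1 \<sigma> \<tau>) (\<lambda>\<omega>. \<integral>k. (f k :: real) \<partial>state_law q k\<^sub>1 m \<omega>)"
proof -
  obtain B where "\<And>k. \<bar>f k\<bar> \<le> B"
    by (rule finite_type_bounded[of f]) blast
  moreover have "state_law q k\<^sub>1 m \<omega> = state_law q k\<^sub>1 m \<omega>'" if "\<And>l. l < m \<Longrightarrow> \<omega> l = \<omega>' l" for \<omega> \<omega>'
    using that by (cases m) auto
  then have "(\<lambda>\<omega>. \<integral>k. f k \<partial>state_law q k\<^sub>1 m \<omega>) \<in> borel_measurable (play_measure q k\<^sub>1 \<sigma> \<tau>)"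
    by (intro measurable_play_past[of m]) metis
  ultimately show ?thesis
    by (intro integrable_play[where B = B] integral_pmf_bounded)
qed

lemma integrable_coordinate:
  "integrable (play_measure q k\<^sub>1 \<sigma> \<tau>) (\<lambda>\<omega>. (F (\<omega> m) :: real))"
proof -
  obtain B where "\<And>t. \<bar>F t\<bar> \<le> B"
    by (rule finite_type_bounded[of F]) blast
  then show ?thesis
    by (intro integrable_play[where B = B]) auto
qed

lemma state_expectation_0: "state_expectation q k\<^sub>1 \<sigma> \<tau> f 0 = f k\<^sub>1"
proof -
  interpret prob_space "play_measure q k\<^sub>1 \<sigma> \<tau>"
    by (rule prob_space_play_measure)
  show ?thesis
    by (simp add: state_expectation_def prob_space)
qed

lemma state_expectation_Suc:
  "state_expectation q k\<^sub>1 \<sigma> \<tau> f (Suc m) =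
    (\<integral>\<omega>. (case \<omega> m of (k, i, j) \<Rightarrow> \<Sum>k'\<in>UNIV. pmf (q k i j) k' * f k') \<partial>play_measure q k\<^sub>1 \<sigma> \<tau>)"
  unfolding state_expectation_def
  by (intro Bochner_Integration.integral_cong) (auto simp: integral_pmf_finite split: prod.split)

lemma state_expectation_mono:
  assumes "\<And>k. f k \<le> f' k"
  shows "state_expectation q k\<^sub>1 \<sigma> \<tau> f m \<le> state_expectation q k\<^sub>1 \<sigma> \<tau> f' m"
  unfolding state_expectation_def
  by (intro integral_mono integrable_state_law integrable_measure_pmf_finite assms) auto

lemma state_expectation_add_const:
  "state_expectation q k\<^sub>1 \<sigma> \<tau> (\<lambda>k. f k + c) m = state_expectation q k\<^sub>1 \<sigma> \<tau> f m + c"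
proof -
  interpret prob_space "play_measure q k\<^sub>1 \<sigma> \<tau>"
    by (rule prob_space_play_measure)
  have "(\<integral>k. f k + c \<partial>state_law q k\<^sub>1 m \<omega>) = (\<integral>k. f k \<partial>state_law q k\<^sub>1 m \<omega>) + c" for \<omega>
    by (subst Bochner_Integration.integral_add) (auto intro: integrable_measure_pmf_finite)
  then show ?thesis
    unfolding state_expectation_def
    by (simp, subst Bochner_Integration.integral_add) (auto simp: prob_space integrable_state_law)
qed

lemma state_expectation_const: "state_expectation q k\<^sub>1 \<sigma> \<tau> (\<lambda>_. c) m = c"
proof -
  interpret prob_space "play_measure q k\<^sub>1 \<sigma> \<tau>"
    by (rule prob_space_play_measure)
  show ?thesis
    by (simp add: state_expectation_def prob_space)
qed

lemma state_expectation_bounded: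
  assumes "\<And>k. f k \<in> {0..1}"
  shows "state_expectation q k\<^sub>1 \<sigma> \<tau> f m \<in> {0..1}"
  using state_expectation_mono[of "\<lambda>_. 0" f m] state_expectation_mono[of f "\<lambda>_. 1" m] assms
  by (auto simp: state_expectation_const)

lemma state_expectation_dist:
  assumes "\<And>k. \<bar>f k - f' k\<bar> \<le> c"
  shows "\<bar>state_expectation q k\<^sub>1 \<sigma> \<tau> f m - state_expectation q k\<^sub>1 \<sigma> \<tau> f' m\<bar> \<le> c"
proof -
  have "f k \<le> f' k + c" "f' k \<le> f k + c" for k
    using assms[of k] by linarith+
  then have "state_expectation q k\<^sub>1 \<sigma> \<tau> f m \<le> state_expectation q k\<^sub>1 \<sigma> \<tau> (\<lambda>k. f' k + c) m"
    "state_expectation q k\<^sub>1 \<sigma> \<tau> f' m \<le> state_expectation q k\<^sub>1 \<sigma> \<tau> (\<lambda>k. f k + c) m"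
    by (auto intro!: state_expectation_mono)
  then show ?thesis
    by (simp add: state_expectation_add_const abs_le_iff)
qed

text \<open>The triple \<open>\<omega> m\<close> determines the current payoff and the law of the
  next state; conditioning on the past turns it into independent mixed actions in the one-stage
  game.\<close>

lemma continuation_payoff_expectation:
  "\<mu> * stage_payoff g q k\<^sub>1 \<sigma> \<tau> m + (1 - \<mu>) * state_expectation q k\<^sub>1 \<sigma> \<tau> v (Suc m) =
    (\<integral>\<omega>. (\<integral>k. (\<Sum>i\<in>UNIV. \<Sum>j\<in>UNIV. pmf (\<sigma> (map \<omega> [0..<m], k)) i * pmf (\<tau> (map \<omega> [0..<m], k)) j *
        continuation_payoff g q \<mu> v k i j) \<partial>state_law q k\<^sub>1 m \<omega>) \<partial>play_measure q k\<^sub>1 \<sigma> \<tau>)"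
proof -
  let ?P = "play_measure q k\<^sub>1 \<sigma> \<tau>"
  let ?F = "\<lambda>(k, i, j). continuation_payoff g q \<mu> v k i j"
  have "\<mu> * stage_payoff g q k\<^sub>1 \<sigma> \<tau> m + (1 - \<mu>) * state_expectation q k\<^sub>1 \<sigma> \<tau> v (Suc m) =
    (\<integral>\<omega>. \<mu> * (case \<omega> m of (k, i, j) \<Rightarrow> g k i j) +
      (1 - \<mu>) * (case \<omega> m of (k, i, j) \<Rightarrow> \<Sum>k'\<in>UNIV. pmf (q k i j) k' * v k') \<partial>?P)"
    unfolding stage_payoff_def state_expectation_Suc
    by (subst Bochner_Integration.integral_add)
      (auto intro: integrable_coordinate[where F = "\<lambda>(k, i, j). g k i j"]
         integrable_coordinate[where F = "\<lambda>(k, i, j). \<Sum>k'\<in>UNIV. pmf (q k i j) k' * v k'"])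
  also have "\<dots> = (\<integral>\<omega>. ?F (\<omega> m) \<partial>?P)"
    by (intro Bochner_Integration.integral_cong)
      (auto simp: continuation_payoff_def split: prod.split)
  finally show ?thesis
    by (simp add: integral_play_coordinate integral_stage_law)
qed

lemma integrable_stage_mixture:
  fixes F :: "'k \<times> 'i \<times> 'j \<Rightarrow> real"
  shows "integrable (play_measure q k\<^sub>1 \<sigma> \<tau>) (\<lambda>\<omega>. \<integral>k. (\<Sum>i\<in>UNIV. \<Sum>j\<in>UNIV.
    pmf (\<sigma> (map \<omega> [0..<m], k)) i * pmf (\<tau> (map \<omega> [0..<m], k)) j * F (k, i, j)) \<partial>state_law q k\<^sub>1 m \<omega>)"
proof -
  obtain B where B: "\<And>t. \<bar>F t\<bar> \<le> B"
    by (rule finite_type_bounded[of F]) blast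
  have "(\<lambda>\<omega>. \<integral>t. F t \<partial>stage_law q k\<^sub>1 \<sigma> \<tau> m \<omega>) \<in> borel_measurable (play_measure q k\<^sub>1 \<sigma> \<tau>)"
    by (rule measurable_play_past[of m], metis stage_law_cong)
  from integrable_play[OF this integral_pmf_bounded[OF B]] show ?thesis
    by (simp add: integral_stage_law)
qed

text \<open>\<open>x k\<close> secures \<open>f k\<close> against each pure action, hence against
  the mixed action that \<open>\<tau>\<close> prescribes after any past, as the two actions are
  independent given the history. A history before stage \<open>Suc m\<close> has \<open>m\<close>
  past triples, so \<open>\<sigma>\<close> is constrained at this stage alone.\<close>

lemma stage_lower_bound:
  assumes "\<And>k j. f k \<le> (\<Sum>i\<in>UNIV. pmf (x k) i * continuation_payoff g q \<mu> v k i j)"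
    and "\<And>h k. length h = m \<Longrightarrow> \<sigma> (h, k) = x k"
  shows "state_expectation q k\<^sub>1 \<sigma> \<tau> f m
    \<le> \<mu> * stage_payoff g q k\<^sub>1 \<sigma> \<tau> m + (1 - \<mu>) * state_expectation q k\<^sub>1 \<sigma> \<tau> v (Suc m)"
  unfolding continuation_payoff_expectation state_expectation_def[of q k\<^sub>1 \<sigma> \<tau> f]
proof (intro integral_mono integrable_state_law integrable_measure_pmf_finite
    integrable_stage_mixture[where F = "\<lambda>(k, i, j). continuation_payoff g q \<mu> v k i j", simplified])
  fix \<omega> k
  let ?y = "\<tau> (map \<omega> [0..<m], k)"
  have "f k = (\<Sum>j\<in>UNIV. pmf ?y j * f k)"
    by (simp add: sum_pmf_eq_1 flip: sum_distrib_right)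
  also have "\<dots> \<le> (\<Sum>j\<in>UNIV. pmf ?y j * (\<Sum>i\<in>UNIV. pmf (x k) i * continuation_payoff g q \<mu> v k i j))"
    by (intro sum_mono mult_left_mono assms) auto
  also have "\<dots> = (\<Sum>i\<in>UNIV. \<Sum>j\<in>UNIV. pmf (x k) i * pmf ?y j * continuation_payoff g q \<mu> v k i j)"
    unfolding sum_distrib_left by (subst sum.swap) (simp add: ac_simps)
  finally show "f k \<le> (\<Sum>i\<in>UNIV. \<Sum>j\<in>UNIV. pmf (\<sigma> (map \<omega> [0..<m], k)) i * pmf ?y j *
      continuation_payoff g q \<mu> v k i j)"
    by (simp add: assms(2))
qed auto

lemma stage_upper_bound:
  assumes "\<And>k i. (\<Sum>j\<in>UNIV. pmf (y k) j * continuation_payoff g q \<mu> v k i j) \<le> f k"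
    and "\<And>h k. length h = m \<Longrightarrow> \<tau> (h, k) = y k"
  shows "\<mu> * stage_payoff g q k\<^sub>1 \<sigma> \<tau> m + (1 - \<mu>) * state_expectation q k\<^sub>1 \<sigma> \<tau> v (Suc m)
    \<le> state_expectation q k\<^sub>1 \<sigma> \<tau> f m"
  unfolding continuation_payoff_expectation state_expectation_def[of q k\<^sub>1 \<sigma> \<tau> f]
proof (intro integral_mono integrable_state_law integrable_measure_pmf_finite
    integrable_stage_mixture[where F = "\<lambda>(k, i, j). continuation_payoff g q \<mu> v k i j", simplified])
  fix \<omega> k
  let ?x = "\<sigma> (map \<omega> [0..<m], k)"
  have "(\<Sum>i\<in>UNIV. \<Sum>j\<in>UNIV. pmf ?x i * pmf (y k) j * continuation_payoff g q \<mu> v k i j)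
    = (\<Sum>i\<in>UNIV. pmf ?x i * (\<Sum>j\<in>UNIV. pmf (y k) j * continuation_payoff g q \<mu> v k i j))"
    unfolding sum_distrib_left by (simp add: ac_simps)
  also have "\<dots> \<le> (\<Sum>i\<in>UNIV. pmf ?x i * f k)"
    by (intro sum_mono mult_left_mono assms) auto
  also have "\<dots> = f k"
    by (simp add: sum_pmf_eq_1 flip: sum_distrib_right)
  finally show "(\<Sum>i\<in>UNIV. \<Sum>j\<in>UNIV. pmf ?x i * pmf (\<tau> (map \<omega> [0..<m], k)) j *
      continuation_payoff g q \<mu> v k i j) \<le> f k"
    by (simp add: assms(2))
qed auto

lemma stage_payoff_bounded:
  assumes "\<And>k i j. g k i j \<in> {0..1}"
  shows "stage_payoff g q k\<^sub>1 \<sigma> \<tau> m \<in> {0..1}"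
proof -
  interpret prob_space "play_measure q k\<^sub>1 \<sigma> \<tau>"
    by (rule prob_space_play_measure)
  have "integrable (play_measure q k\<^sub>1 \<sigma> \<tau>) (\<lambda>\<omega>. case \<omega> m of (k, i, j) \<Rightarrow> g k i j)"
    using integrable_coordinate[where F = "\<lambda>(k, i, j). g k i j"] .
  then show ?thesis
    unfolding stage_payoff_def using assms
    by (auto intro!: integral_ge_const integral_le_const split: prod.split)
qed

text \<open>The weights dominate the series, so it may be integrated term by term; the estimates
  below see a pair of strategies only through \<open>stage_payoff\<close> and
  \<open>state_expectation\<close>.\<close>

lemma expected_payoff_sums:
  assumes "\<pi> \<in> stage_weights" and g: "\<And>k i j. g k i j \<in> {0..1}"
  shows "(\<lambda>m. \<pi> (Suc m) * stage_payoff g q k\<^sub>1 \<sigma> \<tau> m) sums expected_payoff g q \<pi> k\<^sub>1 \<sigma> \<tau>"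
proof -
  let ?P = "play_measure q k\<^sub>1 \<sigma> \<tau>"
  let ?f = "\<lambda>m \<omega>. \<pi> (Suc m) * (case \<omega> m of (k, i, j) \<Rightarrow> g k i j)"
  interpret prob_space ?P
    by (rule prob_space_play_measure)
  have \<pi>: "0 \<le> \<pi> (Suc m)" "summable (\<lambda>m. \<pi> (Suc m))" for m
    using assms(1) by (auto simp: stage_weights_def sums_iff)
  have int: "integrable ?P (?f m)" for m
    using integrable_coordinate[where F = "\<lambda>(k, i, j). g k i j"] by simp
  have bound: "\<bar>?f m \<omega>\<bar> \<le> \<pi> (Suc m)" "0 \<le> ?f m \<omega>" for m \<omega>
    using \<pi>(1)[of m] g by (auto simp: abs_mult mult_left_le split: prod.split)
  have "(\<lambda>m. \<integral>\<omega>. ?f m \<omega> \<partial>?P) sums (\<integral>\<omega>. (\<Sum>m. ?f m \<omega>) \<partial>?P)"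
  proof (rule sums_integral[OF int])
    show "AE \<omega> in ?P. summable (\<lambda>m. norm (?f m \<omega>))"
      using bound(1) by (intro AE_I2 summable_comparison_test'[OF \<pi>(2)]) auto
    have "(\<integral>\<omega>. norm (?f m \<omega>) \<partial>?P) \<le> \<pi> (Suc m)" for m
      by (intro integral_le_const integrable_norm int) (use bound(1) in auto)
    then show "summable (\<lambda>m. \<integral>\<omega>. norm (?f m \<omega>) \<partial>?P)"
      by (intro summable_comparison_test'[OF \<pi>(2)]) (auto intro!: Bochner_Integration.integral_nonneg)
  qed
  then show ?thesis
    by (simp add: expected_payoff_def stage_payoff_def)
qed

end

lemma expected_payoff_bounded:
  assumes "\<pi> \<in> stage_weights" and "\<And>k i j. g k i j \<in> {0..1}"
  shows "expected_payoff g q \<pi> k\<^sub>1 \<sigma> \<tau> \<in> {0..1}"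
proof -
  have \<pi>: "\<And>m. 0 \<le> \<pi> (Suc m)" "(\<lambda>m. \<pi> (Suc m)) sums 1"
    using assms(1) by (auto simp: stage_weights_def)
  have "0 \<le> \<pi> (Suc m) * stage_payoff g q k\<^sub>1 \<sigma> \<tau> m"
    "\<pi> (Suc m) * stage_payoff g q k\<^sub>1 \<sigma> \<tau> m \<le> \<pi> (Suc m)" for m
    using stage_payoff_bounded[where g = g and q = q and k\<^sub>1 = k\<^sub>1 and \<sigma> = \<sigma> and \<tau> = \<tau> and m = m, OF assms(2)] \<pi>(1)[of m] by (auto simp: mult_left_le)
  moreover note sums = expected_payoff_sums[where g = g, OF assms]
  ultimately show ?thesis
    using sums_le[OF _ sums_zero sums] sums_le[OF _ sums \<pi>(2)] by auto
qed

lemma uniform_weights_stage_weights: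
  assumes "n \<ge> 1"
  shows "uniform_weights n \<in> stage_weights"
proof -
  have "(\<lambda>m. uniform_weights n (Suc m)) sums (\<Sum>m<n. uniform_weights n (Suc m))"
    by (rule sums_finite) (auto simp: uniform_weights_def)
  then show ?thesis
    using assms by (simp add: stage_weights_def uniform_weights_def cong: sum.cong_simp)
qed

lemma expected_payoff_uniform:
  assumes "n \<ge> 1" and g: "\<And>k i j. g k i j \<in> {0..1}"
  shows "expected_payoff g q (uniform_weights n) k\<^sub>1 \<sigma> \<tau> = (\<Sum>m<n. stage_payoff g q k\<^sub>1 \<sigma> \<tau> m) / n"
proof -
  have "(\<lambda>m. uniform_weights n (Suc m) * stage_payoff g q k\<^sub>1 \<sigma> \<tau> m) sums
      (\<Sum>m<n. uniform_weights n (Suc m) * stage_payoff g q k\<^sub>1 \<sigma> \<tau> m)"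
    by (rule sums_finite) (auto simp: uniform_weights_def)
  with expected_payoff_sums[OF uniform_weights_stage_weights[OF assms(1)] g]
  have "expected_payoff g q (uniform_weights n) k\<^sub>1 \<sigma> \<tau> =
      (\<Sum>m<n. uniform_weights n (Suc m) * stage_payoff g q k\<^sub>1 \<sigma> \<tau> m)"
    by (rule sums_unique2)
  also have "\<dots> = (\<Sum>m<n. stage_payoff g q k\<^sub>1 \<sigma> \<tau> m / n)"
    by (intro sum.cong) (auto simp: uniform_weights_def)
  finally show ?thesis
    by (simp add: sum_divide_distrib)
qed

section \<open>Matrix games\<close>

text \<open>Mixed actions as vectors, so that compactness, separation and extreme points are at
  hand; \<open>prob_simplex_pmf\<close> leads back to \<open>pmf\<close>.\<close>

definition prob_simplex :: "(real^'n) set" where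
  "prob_simplex = {x. (\<forall>i. 0 \<le> x $ i) \<and> (\<Sum>i\<in>UNIV. x $ i) = 1}"

lemma prob_simplex_le_1: "x \<in> prob_simplex \<Longrightarrow> x $ i \<le> 1"
  using member_le_sum[of i UNIV "\<lambda>i. x $ i"] by (auto simp: prob_simplex_def)

lemma axis_in_prob_simplex: "axis i 1 \<in> prob_simplex"
  by (auto simp: prob_simplex_def axis_def)

lemma convex_prob_simplex: "convex prob_simplex"
proof (rule convexI)
  fix x y :: "real^'n" and u v :: real
  assume "x \<in> prob_simplex" "y \<in> prob_simplex" "0 \<le> u" "0 \<le> v" "u + v = 1"
  then show "u *\<^sub>R x + v *\<^sub>R y \<in> prob_simplex"
    by (auto simp: prob_simplex_def sum.distrib simp flip: sum_distrib_left)
qed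

lemma compact_prob_simplex: "compact (prob_simplex :: (real^'n) set)"
proof -
  have "closed (prob_simplex :: (real^'n) set)"
    unfolding prob_simplex_def
    by (intro closed_Collect_conj closed_Collect_all closed_Collect_le closed_Collect_eq continuous_intros)
  moreover have "prob_simplex \<subseteq> cbox (0 :: real^'n) 1"
    by (auto simp: mem_box_cart prob_simplex_le_1) (simp add: prob_simplex_def)
  then have "bounded (prob_simplex :: (real^'n) set)"
    using bounded_cbox bounded_subset by blast
  ultimately show ?thesis
    by (simp add: compact_eq_bounded_closed)
qed

lemma prob_simplex_avg_ge:
  assumes "x \<in> prob_simplex" "\<And>i. c \<le> f i"
  shows "c \<le> (\<Sum>i\<in>UNIV. x $ i * f i)"
proof -
  have "c = (\<Sum>i\<in>UNIV. x $ i * c)"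
    using assms(1) by (simp add: prob_simplex_def flip: sum_distrib_right)
  also have "\<dots> \<le> (\<Sum>i\<in>UNIV. x $ i * f i)"
    using assms by (intro sum_mono mult_left_mono) (auto simp: prob_simplex_def)
  finally show ?thesis .
qed

lemma prob_simplex_avg_le:
  assumes "x \<in> prob_simplex" "\<And>i. f i \<le> c"
  shows "(\<Sum>i\<in>UNIV. x $ i * f i) \<le> c"
  using prob_simplex_avg_ge[OF assms(1), of "-c" "\<lambda>i. - f i"] assms(2) by (simp add: sum_negf)

lemma bilinear_swap:
  fixes x :: "real^'i" and y :: "real^'j" and A :: "'i \<Rightarrow> 'j \<Rightarrow> real"
  shows "(\<Sum>j\<in>UNIV. y $ j * (\<Sum>i\<in>UNIV. x $ i * A i j)) = (\<Sum>i\<in>UNIV. x $ i * (\<Sum>j\<in>UNIV. y $ j * A i j))"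
  unfolding sum_distrib_left by (subst sum.swap) (simp add: ac_simps)

text \<open>\<open>S\<close> consists of the vectors that dominate some payoff vector
  \<open>L y\<close>. If it contains \<open>0\<close>, that \<open>y\<close> secures payoffs at most
  \<open>0\<close>. Otherwise a hyperplane separates it from \<open>0\<close>, and the normal, which
  must be nonnegative, normalizes to the required \<open>x\<close>.\<close>

lemma matrix_game_alternative:
  fixes A :: "'i::finite \<Rightarrow> 'j::finite \<Rightarrow> real"
  shows "(\<exists>x\<in>prob_simplex. \<forall>j. (\<Sum>i\<in>UNIV. x $ i * A i j) > 0) \<or>
    (\<exists>y\<in>prob_simplex. \<forall>i. (\<Sum>j\<in>UNIV. y $ j * A i j) \<le> 0)"
proof -
  define L where "L y = (\<chi> i. \<Sum>j\<in>UNIV. y $ j * A i j)" for y :: "real^'j"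
  define S where "S = (\<Union>u\<in>L ` prob_simplex. \<Union>p\<in>{p. \<forall>i. 0 \<le> p $ i}. {u + p})"
  have L: "linear L"
    by (rule linearI) (auto simp: L_def vec_eq_iff algebra_simps sum.distrib sum_distrib_left)
  have "convex S" unfolding S_def
    by (intro convex_sums convex_linear_image L convex_prob_simplex)
      (auto simp: convex_def)
  moreover have "closed S"
    unfolding S_def
  proof (rule compact_closed_sums)
    show "compact (L ` prob_simplex)"
      using L by (intro compact_continuous_image compact_prob_simplex linear_continuous_on)
        (simp add: linear_conv_bounded_linear)
    show "closed {p::real^'i. \<forall>i. 0 \<le> p $ i}"
      by (intro closed_Collect_all closed_Collect_le continuous_intros)
  qed
  ultimately consider "0 \<in> S" | a b where "a \<noteq> 0" "0 < b" "\<And>u. u \<in> S \<Longrightarrow> a \<bullet> u > b"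
    using separating_hyperplane_closed_0[of S] by blast
  then show ?thesis
  proof cases
    case 1
    then obtain y p where y: "y \<in> prob_simplex" "\<forall>i. 0 \<le> p $ i" "L y + p = 0"
      unfolding S_def by force
    then have "L y $ i + p $ i = 0" for i
      by (metis vector_add_component zero_index)
    then have "(\<Sum>j\<in>UNIV. y $ j * A i j) \<le> 0" for i
      using y(2) by (simp add: L_def) (metis add_le_same_cancel1 add.commute)
    with y(1) show ?thesis by blast
  next
    case 2
    have S: "b < a \<bullet> (L y + p)" if "y \<in> prob_simplex" "\<And>i. 0 \<le> p $ i" for y p
      using that by (intro 2) (auto simp: S_def)
    have nonneg: "0 \<le> a $ i" for i
    proof (rule ccontr)
      assume "\<not> 0 \<le> a $ i"
      obtain y :: "real^'j" where y: "y \<in> prob_simplex"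
        using axis_in_prob_simplex by blast
      \<comment> \<open>With this length the negative coordinate of \<open>a\<close> cancels
        \<open>a \<bullet> L y\<close> and contradicts the separation.\<close>
      define t where "t = \<bar>a \<bullet> L y\<bar> / (- a $ i)"
      have "b < a \<bullet> (L y + axis i t)"
        using \<open>\<not> 0 \<le> a $ i\<close> by (intro S y) (auto simp: axis_def t_def divide_le_0_iff)
      also have "\<dots> = a \<bullet> L y - \<bar>a \<bullet> L y\<bar>"
        using \<open>\<not> 0 \<le> a $ i\<close> by (simp add: inner_add_right inner_axis t_def)
      also have "\<dots> \<le> 0" by linarith
      finally show False using 2(2) by simp
    qed
    define c where "c = (\<Sum>i\<in>UNIV. a $ i)"
    have "c \<noteq> 0"
      using 2(1) nonneg by (auto simp: c_def sum_nonneg_eq_0_iff vec_eq_iff)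
    then have c: "c > 0"
      using nonneg by (auto simp: c_def less_le sum_nonneg)
    have "(\<Sum>i\<in>UNIV. a $ i / c * A i j) > 0" for j
    proof -
      have "0 < a \<bullet> L (axis j 1)"
        using S[of "axis j 1" 0] 2(2) by (simp add: axis_in_prob_simplex)
      also have "a \<bullet> L (axis j 1) = (\<Sum>i\<in>UNIV. a $ i * A i j)"
        by (simp add: inner_vec_def L_def axis_def if_distrib[where f = "\<lambda>u. u * _"] cong: if_cong)
      finally show ?thesis
        using c by (simp flip: sum_divide_distrib)
    qed
    moreover have "(\<chi> i. a $ i / c) \<in> prob_simplex"
      using nonneg c by (simp add: prob_simplex_def c_def flip: sum_divide_distrib)
    ultimately show ?thesis
      by (intro disjI1 bexI[of _ "\<chi> i. a $ i / c"]) auto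
  qed
qed

lemma matrix_game_optimum:
  fixes A :: "'i::finite \<Rightarrow> 'j::finite \<Rightarrow> real"
  obtains w x where "x \<in> prob_simplex" "\<And>j. w \<le> (\<Sum>i\<in>UNIV. x $ i * A i j)"
    "\<And>x'. x' \<in> prob_simplex \<Longrightarrow> \<exists>j. (\<Sum>i\<in>UNIV. x' $ i * A i j) \<le> w"
proof -
  let ?m = "\<lambda>x::real^'i. Min (range (\<lambda>j. \<Sum>i\<in>UNIV. x $ i * A i j))"
  have cont: "continuous_on S (\<lambda>x. Min ((\<lambda>j. \<Sum>i\<in>UNIV. x $ i * A i j) ` J))"
    if "finite J" "J \<noteq> {}" for S and J :: "'j set"
    using that
  proof (induction J rule: finite_ne_induct)
    case (insert j J)
    then show ?case
      by (simp, intro continuous_on_min continuous_intros)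
  qed (auto intro!: continuous_intros)
  have "prob_simplex \<noteq> ({} :: (real^'i) set)"
    using axis_in_prob_simplex by blast
  then obtain x where x: "x \<in> prob_simplex" "\<And>x'. x' \<in> prob_simplex \<Longrightarrow> ?m x' \<le> ?m x"
    using continuous_attains_sup[OF compact_prob_simplex _ cont[OF finite UNIV_not_empty]] by blast
  show ?thesis
  proof (rule that[OF x(1)])
    show "?m x \<le> (\<Sum>i\<in>UNIV. x $ i * A i j)" for j
      by (rule Min_le) auto
    fix x' :: "real^'i"
    assume "x' \<in> prob_simplex"
    have "?m x' \<in> range (\<lambda>j. \<Sum>i\<in>UNIV. x' $ i * A i j)"
      by (rule Min_in) auto
    then obtain j where "?m x' = (\<Sum>i\<in>UNIV. x' $ i * A i j)"
      by blast
    with x(2)[OF \<open>x' \<in> prob_simplex\<close>] show "\<exists>j. (\<Sum>i\<in>UNIV. x' $ i * A i j) \<le> ?m x"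
      by (intro exI[of _ j]) simp
  qed
qed

text \<open>The alternative is applied to \<open>A\<close> with the optimum \<open>w\<close>
  subtracted from every entry: its first case would be a strategy securing more than
  \<open>w\<close>.\<close>

theorem matrix_game_minimax:
  fixes A :: "'i::finite \<Rightarrow> 'j::finite \<Rightarrow> real"
  obtains w x y where "x \<in> prob_simplex" "y \<in> prob_simplex"
    "\<And>j. w \<le> (\<Sum>i\<in>UNIV. x $ i * A i j)" "\<And>i. (\<Sum>j\<in>UNIV. y $ j * A i j) \<le> w"
proof -
  obtain w x where x: "x \<in> prob_simplex" "\<And>j. w \<le> (\<Sum>i\<in>UNIV. x $ i * A i j)"
    "\<And>x'. x' \<in> prob_simplex \<Longrightarrow> \<exists>j. (\<Sum>i\<in>UNIV. x' $ i * A i j) \<le> w"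
    by (rule matrix_game_optimum[of A]) blast
  have shift: "(\<Sum>i\<in>UNIV. z $ i * (f i - w)) = (\<Sum>i\<in>UNIV. z $ i * f i) - w"
    if "z \<in> prob_simplex" for z :: "real^'n" and f
    using that by (simp add: algebra_simps sum_subtractf prob_simplex_def flip: sum_distrib_left)
  have "\<not> (\<exists>x\<in>prob_simplex. \<forall>j. (\<Sum>i\<in>UNIV. x $ i * (A i j - w)) > 0)"
    by (auto simp: shift dest!: x(3)) (meson not_le)
  then obtain y where y: "y \<in> prob_simplex" "\<forall>i. (\<Sum>j\<in>UNIV. y $ j * (A i j - w)) \<le> 0"
    using matrix_game_alternative[of "\<lambda>i j. A i j - w"] by blast
  then show ?thesis
    by (intro that[OF x(1) y(1) x(2)]) (simp add: shift)
qed

text \<open>The linear system of a basic solution. Column \<open>None\<close> belongs to the value,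
  column \<open>Some f\<close> to the weight of action \<open>f\<close>; row \<open>None\<close>
  normalizes the weights, row \<open>Some r'\<close> is the active constraint \<open>s r'\<close>.
  The entries lie in a ring so that they may be polynomials.\<close>

definition basis_matrix ::
  "('f::finite \<Rightarrow> 'h \<Rightarrow> 'a::comm_ring_1) \<Rightarrow> ('f \<Rightarrow> 'f + 'h) \<Rightarrow> 'a^('f option)^('f option)" where
  "basis_matrix A s = (\<chi> r c. case r of
      None \<Rightarrow> (case c of None \<Rightarrow> 0 | Some f \<Rightarrow> 1)
    | Some r' \<Rightarrow> (case s r' of
        Inl f' \<Rightarrow> (if c = Some f' then 1 else 0)
      | Inr h \<Rightarrow> (case c of None \<Rightarrow> -1 | Some f \<Rightarrow> A f h)))"

text \<open>The numerator in Cramer's rule for the value: the right-hand side replaces column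
  \<open>None\<close>.\<close>

definition value_matrix ::
  "('f::finite \<Rightarrow> 'h \<Rightarrow> 'a::comm_ring_1) \<Rightarrow> ('f \<Rightarrow> 'f + 'h) \<Rightarrow> 'a^('f option)^('f option)" where
  "value_matrix A s = (\<chi> r c. if c = None then (if r = None then 1 else 0) else basis_matrix A s $ r $ c)"

text \<open>A ratio test: where the slack \<open>a\<close> vanishes the direction \<open>b\<close>
  does too, so the least of the remaining finitely many ratios is positive. The extra element
  \<open>1\<close> covers \<open>b = 0\<close>.\<close>

lemma uniform_step:
  fixes a b :: "'c::finite \<Rightarrow> real"
  assumes "\<And>c. 0 \<le> a c" "\<And>c. a c = 0 \<Longrightarrow> b c = 0"
  obtains t where "t > 0" "\<And>c. t * \<bar>b c\<bar> \<le> a c"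
proof
  let ?T = "insert 1 ((\<lambda>c. a c / \<bar>b c\<bar>) ` {c. b c \<noteq> 0})"
  have "a c > 0" if "b c \<noteq> 0" for c
    using assms that by (metis less_eq_real_def)
  then show "0 < Min ?T"
    by (subst Min_gr_iff) auto
  fix c
  show "Min ?T * \<bar>b c\<bar> \<le> a c"
  proof (cases "b c = 0")
    case False
    then have "Min ?T \<le> a c / \<bar>b c\<bar>"
      by (intro Min_le) auto
    with False show ?thesis
      by (simp add: field_simps)
  qed (simp add: assms)
qed

lemma UNIV_option_sum:
  fixes f :: "'a::finite option \<Rightarrow> 'b::comm_monoid_add"
  shows "(\<Sum>c\<in>UNIV. f c) = f None + (\<Sum>a\<in>UNIV. f (Some a))"
  by (simp add: UNIV_option_conv sum.reindex inj_on_def)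

text \<open>Rows with trivial common kernel span the space, so a basis through \<open>r0\<close> can
  be drawn from them; its other \<open>CARD('f)\<close> members are indexed by
  \<open>'f\<close>.\<close>

lemma spanning_rows_nonsingular:
  fixes r0 :: "real^('f::finite option)" and row_of :: "'c \<Rightarrow> real^('f option)"
  assumes "r0 \<noteq> 0"
    and ker: "\<And>d. r0 \<bullet> d = 0 \<Longrightarrow> (\<And>c. c \<in> T \<Longrightarrow> row_of c \<bullet> d = 0) \<Longrightarrow> d = 0"
  obtains s where "range s \<subseteq> T"
    "det (\<chi> r. case r of None \<Rightarrow> r0 | Some f \<Rightarrow> row_of (s f)) \<noteq> 0"
proof -
  have "independent {r0}"
    using assms(1) by simp
  then obtain B where B: "{r0} \<subseteq> B" "B \<subseteq> insert r0 (row_of ` T)" "independent B"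
      "insert r0 (row_of ` T) \<subseteq> span B"
    using maximal_independent_subset_extend[of "{r0}" "insert r0 (row_of ` T)"] by blast
  have zero: "d = 0" if "\<And>b. b \<in> B \<Longrightarrow> b \<bullet> d = 0" for d
  proof (rule ker)
    have "b \<bullet> d = 0" if "b \<in> span B" for b
      using that \<open>\<And>b. b \<in> B \<Longrightarrow> b \<bullet> d = 0\<close>
      by (metis inner_commute orthogonal_def orthogonal_to_span)
    then show "r0 \<bullet> d = 0" "\<And>c. c \<in> T \<Longrightarrow> row_of c \<bullet> d = 0"
      using B(4) by auto
  qed
  have "span B = UNIV"
  proof (rule ccontr)
    assume "span B \<noteq> UNIV"
    then obtain a where "a \<noteq> 0" "\<forall>x\<in>span B. a \<bullet> x = 0"
      using span_not_UNIV_orthogonal by blast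
    with zero[of a] show False
      by (metis inner_commute span_base)
  qed
  then have "card B = CARD('f option)"
    using dim_span_eq_card_independent[OF B(3)] by simp
  moreover have "finite B"
    using B(3) by (rule independent_imp_finite)
  ultimately have "card (B - {r0}) = CARD('f)" "finite (B - {r0})"
    using B(1) by (simp_all add: card_UNIV_option)
  then obtain \<beta> :: "'f \<Rightarrow> _" where \<beta>: "bij_betw \<beta> UNIV (B - {r0})"
    using finite_same_card_bij[of "UNIV :: 'f set" "B - {r0}"] by auto
  define s where "s f = (SOME c. c \<in> T \<and> row_of c = \<beta> f)" for f
  have "\<beta> f \<in> B - {r0}" for f
    using bij_betwE[OF \<beta>] by blast
  then have "\<exists>c. c \<in> T \<and> row_of c = \<beta> f" for f
    using B(2) by (metis Diff_iff imageE insertE insertI1 subset_iff)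
  then have "s f \<in> T \<and> row_of (s f) = \<beta> f" for f
    unfolding s_def by (rule someI_ex)
  then have s: "s f \<in> T" "row_of (s f) = \<beta> f" for f
    by blast+
  let ?N = "\<chi> r. case r of None \<Rightarrow> r0 | Some f \<Rightarrow> row_of (s f)"
  have "d = 0" if "?N *v d = 0" for d
  proof (rule zero)
    fix b assume "b \<in> B"
    have row: "?N $ r \<bullet> d = 0" for r
      using arg_cong[OF that, of "\<lambda>v. v $ r"] by (simp add: matrix_vector_mul_component)
    show "b \<bullet> d = 0"
    proof (cases "b = r0")
      case True
      with row[of None] show ?thesis by simp
    next
      case False
      then obtain f where "b = \<beta> f"
        using \<open>b \<in> B\<close> \<beta> unfolding bij_betw_def by blast
      with row[of "Some f"] show ?thesis by (simp add: s)
    qed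
  qed
  then have "det ?N \<noteq> 0"
    by (metis invertible_det_nz invertible_left_inverse matrix_left_invertible_ker)
  with s(1) that show ?thesis by blast
qed

text \<open>
  The optimum is a basic solution of the linear program maximizing \<open>w\<close> subject to \<open>x\<close> being a
  probability vector and \<open>w \<le> x\<^sup>T A h\<close> for all columns \<open>h\<close>; the choice function \<open>s\<close> selects the
  active constraints, \<open>Inl f\<close> standing for \<open>x f = 0\<close> and \<open>Inr h\<close> for \<open>x\<^sup>T A h = w\<close>.
\<close>

theorem matrix_game_basic_solution:
  fixes A :: "'f::finite \<Rightarrow> 'h::finite \<Rightarrow> real"
  obtains w x s where "x \<in> prob_simplex" "\<And>h. w \<le> (\<Sum>f\<in>UNIV. x $ f * A f h)"
    "\<And>x'. x' \<in> prob_simplex \<Longrightarrow> \<exists>h. (\<Sum>f\<in>UNIV. x' $ f * A f h) \<le> w"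
    "det (basis_matrix A s) \<noteq> 0" "w * det (basis_matrix A s) = det (value_matrix A s)"
proof -
  define \<phi> where "\<phi> x h = (\<Sum>f\<in>UNIV. x $ f * A f h)" for x :: "real^'f" and h
  obtain w x0 where x0: "x0 \<in> prob_simplex" "\<And>h. w \<le> \<phi> x0 h"
    and opt: "\<And>x'. x' \<in> prob_simplex \<Longrightarrow> \<exists>h. \<phi> x' h \<le> w"
    unfolding \<phi>_def by (rule matrix_game_optimum[of A]) blast
  have \<phi>: "\<phi> (u *\<^sub>R x + v *\<^sub>R y) h = u * \<phi> x h + v * \<phi> y h" for u v x y h
    by (simp add: \<phi>_def algebra_simps sum.distrib sum_distrib_left)
  define Opt where "Opt = prob_simplex \<inter> {x. \<forall>h. w \<le> \<phi> x h}"
  have "convex Opt" unfolding Opt_def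
  proof (intro convex_Int convex_prob_simplex convexI CollectI allI)
    fix x y h and u v :: real
    assume xy: "x \<in> {x. \<forall>h. w \<le> \<phi> x h}" "y \<in> {x. \<forall>h. w \<le> \<phi> x h}" "0 \<le> u" "0 \<le> v" "u + v = 1"
    have "w = u * w + v * w"
      using xy(5) by (metis distrib_right mult_1)
    also have "\<dots> \<le> u * \<phi> x h + v * \<phi> y h"
      using xy by (intro add_mono mult_left_mono) auto
    finally show "w \<le> \<phi> (u *\<^sub>R x + v *\<^sub>R y) h"
      by (simp add: \<phi>)
  qed
  moreover have "compact Opt"
    unfolding Opt_def \<phi>_def
    by (intro compact_Int_closed compact_prob_simplex closed_Collect_all closed_Collect_le continuous_intros)
  moreover have "Opt \<noteq> {}"
    using x0 by (auto simp: Opt_def)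
  \<comment> \<open>Extremality is what lets the active constraints determine the solution.\<close>
  ultimately obtain x where ext: "x extreme_point_of Opt"
    using extreme_point_exists_convex by metis
  then have x: "x \<in> prob_simplex" "\<And>h. w \<le> \<phi> x h"
    by (auto simp: extreme_point_of_def Opt_def)
  define r0 :: "real^('f option)" where "r0 = (\<chi> c. case c of None \<Rightarrow> 0 | Some f \<Rightarrow> 1)"
  define row_of :: "'f + 'h \<Rightarrow> real^('f option)" where
    "row_of k = (case k of Inl f' \<Rightarrow> (\<chi> c. if c = Some f' then 1 else 0)
      | Inr h \<Rightarrow> (\<chi> c. case c of None \<Rightarrow> -1 | Some f \<Rightarrow> A f h))" for k
  define T where "T = {Inl f |f. x $ f = 0} \<union> {Inr h |h. \<phi> x h = w}"
  have inner: "r0 \<bullet> d = (\<Sum>f\<in>UNIV. d $ Some f)" "row_of (Inl f) \<bullet> d = d $ Some f"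
    "row_of (Inr h) \<bullet> d = \<phi> (\<chi> f. d $ Some f) h - d $ None" for d f h
    by (auto simp: inner_vec_def UNIV_option_sum r0_def row_of_def \<phi>_def mult.commute
        if_distrib[where f = "\<lambda>u. _ * u"] cong: if_cong)
  \<comment> \<open>A kernel vector is a direction along which all active constraints persist, so a
    small step is feasible both ways. Optimality of \<open>w\<close> then excludes a change
    \<open>\<delta>\<close> of the value, and extremality of \<open>x\<close> a change
    \<open>e\<close> of the strategy.\<close>
  have ker: "d = 0" if d: "r0 \<bullet> d = 0" "\<And>c. c \<in> T \<Longrightarrow> row_of c \<bullet> d = 0" for d
  proof -
    define \<delta> e where "\<delta> = d $ None" and "e = (\<chi> f. d $ Some f)"
    have e: "(\<Sum>f\<in>UNIV. e $ f) = 0" "\<And>f. x $ f = 0 \<Longrightarrow> e $ f = 0" "\<And>h. \<phi> x h = w \<Longrightarrow> \<phi> e h = \<delta>"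
      using d(1) d(2)[of "Inl _"] d(2)[of "Inr _"] by (auto simp: inner T_def e_def \<delta>_def)
    have "\<exists>t>0. (\<forall>f. t * \<bar>e $ f\<bar> \<le> x $ f)"
      by (rule uniform_step[of "\<lambda>f. x $ f" "\<lambda>f. e $ f"]) (use x(1) e(2) in \<open>auto simp: prob_simplex_def\<close>)
    then obtain t1 where t1: "t1 > 0" "\<And>f. t1 * \<bar>e $ f\<bar> \<le> x $ f"
      by blast
    have "\<exists>t>0. (\<forall>h. t * \<bar>\<phi> e h - \<delta>\<bar> \<le> \<phi> x h - w)"
      by (rule uniform_step[of "\<lambda>h. \<phi> x h - w" "\<lambda>h. \<phi> e h - \<delta>"]) (use x(2) e(3) in auto)
    then obtain t2 where t2: "t2 > 0" "\<And>h. t2 * \<bar>\<phi> e h - \<delta>\<bar> \<le> \<phi> x h - w"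
      by blast
    define t where "t = min t1 t2"
    have t: "t > 0" "t * \<bar>e $ f\<bar> \<le> x $ f" "t * \<bar>\<phi> e h - \<delta>\<bar> \<le> \<phi> x h - w" for f h
      using t1(1) t2(1) order_trans[OF mult_right_mono t1(2), of t f]
        order_trans[OF mult_right_mono t2(2), of t h] by (auto simp: t_def)
    have move: "x + u *\<^sub>R e \<in> prob_simplex" "w + u * \<delta> \<le> \<phi> (x + u *\<^sub>R e) h" if "\<bar>u\<bar> = t" for u h
    proof -
      have "0 \<le> x $ f + u * e $ f" for f
        using t(2)[of f] that abs_ge_minus_self[of "u * e $ f"] by (simp add: abs_mult)
      moreover have "- (u * (\<phi> e h - \<delta>)) \<le> t * \<bar>\<phi> e h - \<delta>\<bar>"
        using abs_ge_minus_self[of "u * (\<phi> e h - \<delta>)"] that by (simp add: abs_mult)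
      then have "- (u * (\<phi> e h - \<delta>)) \<le> \<phi> x h - w"
        using t(3)[of h] by linarith
      then have "w + u * \<delta> \<le> \<phi> x h + u * \<phi> e h"
        by (simp add: right_diff_distrib)
      ultimately show "x + u *\<^sub>R e \<in> prob_simplex" "w + u * \<delta> \<le> \<phi> (x + u *\<^sub>R e) h"
        using x(1) e(1) \<phi>[of 1 x u e h] by (auto simp: prob_simplex_def sum.distrib simp flip: sum_distrib_left)
    qed
    have "u * \<delta> \<le> 0" if "\<bar>u\<bar> = t" for u
      using opt[OF move(1)[OF that]] move(2)[OF that] by (smt (verit))
    from this[of t] this[of "-t"] have \<delta>: "\<delta> = 0"
      using t(1) by (simp add: mult_le_0_iff zero_le_mult_iff)
    have "x + t *\<^sub>R e \<in> Opt" "x - t *\<^sub>R e \<in> Opt"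
      using move[of t] move[of "-t"] t(1) \<delta> by (auto simp: Opt_def)
    moreover have "x = midpoint (x + t *\<^sub>R e) (x - t *\<^sub>R e)"
      by (simp add: midpoint_def scaleR_add_right[symmetric] scaleR_2[symmetric])
    ultimately have "x + t *\<^sub>R e = x - t *\<^sub>R e"
      using ext unfolding extreme_point_of_def by (metis midpoint_in_open_segment)
    then have "e = 0"
      using t(1) by (simp add: eq_neg_iff_add_eq_0 scaleR_2[symmetric] flip: diff_eq_eq)
    then have "d $ c = 0" for c
      using \<delta> by (cases c) (auto simp: e_def \<delta>_def vec_eq_iff)
    then show "d = 0"
      by (simp add: vec_eq_iff)
  qed
  have "r0 $ Some undefined \<noteq> 0"
    by (simp add: r0_def)
  then have "r0 \<noteq> 0" by force
  from spanning_rows_nonsingular[OF this ker] obtain s where s: "range s \<subseteq> T"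
    "det (\<chi> r. case r of None \<Rightarrow> r0 | Some f \<Rightarrow> row_of (s f)) \<noteq> 0"
    by metis
  have N: "(\<chi> r. case r of None \<Rightarrow> r0 | Some f \<Rightarrow> row_of (s f)) = basis_matrix A s"
    by (auto simp: vec_eq_iff basis_matrix_def r0_def row_of_def split: option.split sum.split)
  define z :: "real^('f option)" where "z = (\<chi> c. case c of None \<Rightarrow> w | Some f \<Rightarrow> x $ f)"
  have z: "z $ None = w" "z $ Some f = x $ f" "(\<chi> f. z $ Some f) = x" for f
    by (auto simp: z_def vec_eq_iff)
  have "(basis_matrix A s *v z) $ r = (if r = None then 1 else 0)" for r
  proof (cases r)
    case None
    with x(1) show ?thesis
      by (simp add: matrix_vector_mul_component inner z prob_simplex_def flip: N)
  next
    case (Some f)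
    moreover have "s f \<in> T"
      using s(1) by blast
    then have "row_of (s f) \<bullet> z = 0"
      by (auto simp: T_def inner z)
    ultimately show ?thesis
      by (simp add: matrix_vector_mul_component flip: N)
  qed
  then have "value_matrix A s = (\<chi> i j. if j = None then (basis_matrix A s *v z) $ i else basis_matrix A s $ i $ j)"
    by (simp add: value_matrix_def vec_eq_iff)
  then have "det (value_matrix A s) = w * det (basis_matrix A s)"
    by (simp add: cramer_lemma z)
  then have "w * det (basis_matrix A s) = det (value_matrix A s)"
    by simp
  moreover have "det (basis_matrix A s) \<noteq> 0"
    using s(2) by (simp add: N)
  ultimately show ?thesis
    using that[OF x(1) x(2)[unfolded \<phi>_def] opt[unfolded \<phi>_def]] by blast
qed

section \<open>Discounted values\<close>

lemma pmf_in_prob_simplex: "(\<chi> i. pmf (p :: 'i::finite pmf) i) \<in> prob_simplex"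
  by (simp add: prob_simplex_def sum_pmf_eq_1)

lemma prob_simplex_pmf:
  assumes "x \<in> prob_simplex"
  obtains p :: "'i::finite pmf" where "\<And>i. pmf p i = x $ i"
proof
  show "pmf (embed_pmf (\<lambda>i. x $ i)) i = x $ i" for i
  proof (rule pmf_embed_pmf)
    have "(\<integral>\<^sup>+i. ennreal (x $ i) \<partial>count_space UNIV) = (\<Sum>i\<in>UNIV. ennreal (x $ i))"
      by (simp add: nn_integral_count_space_finite)
    also have "\<dots> = 1"
      using assms by (subst sum_ennreal) (auto simp: prob_simplex_def)
    finally show "(\<integral>\<^sup>+i. ennreal (x $ i) \<partial>count_space UNIV) = 1" .
  qed (use assms in \<open>auto simp: prob_simplex_def\<close>)
qed

lemma matrix_game_minimax_pmf:
  fixes A :: "'i::finite \<Rightarrow> 'j::finite \<Rightarrow> real"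
  shows "\<exists>w x y. (\<forall>j. w \<le> (\<Sum>i\<in>UNIV. pmf x i * A i j)) \<and> (\<forall>i. (\<Sum>j\<in>UNIV. pmf y j * A i j) \<le> w)"
proof -
  obtain w x y where *: "x \<in> prob_simplex" "y \<in> prob_simplex"
    "\<And>j. w \<le> (\<Sum>i\<in>UNIV. x $ i * A i j)" "\<And>i. (\<Sum>j\<in>UNIV. y $ j * A i j) \<le> w"
    by (rule matrix_game_minimax[of A]) blast
  obtain p where p: "\<And>i. pmf p i = x $ i"
    by (rule prob_simplex_pmf[OF *(1)]) blast
  obtain p' where p': "\<And>i. pmf p' i = y $ i"
    by (rule prob_simplex_pmf[OF *(2)]) blast
  have "(\<forall>j. w \<le> (\<Sum>i\<in>UNIV. pmf p i * A i j)) \<and> (\<forall>i. (\<Sum>j\<in>UNIV. pmf p' j * A i j) \<le> w)"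
    using * by (simp add: p p')
  then show ?thesis
    by blast
qed

lemma pmf_avg_ge:
  fixes p :: "'i::finite pmf"
  assumes "\<And>i. c \<le> f i"
  shows "c \<le> (\<Sum>i\<in>UNIV. pmf p i * f i)"
  using prob_simplex_avg_ge[OF pmf_in_prob_simplex[of p], of c f] assms by simp

lemma pmf_avg_le:
  fixes p :: "'i::finite pmf"
  assumes "\<And>i. f i \<le> c"
  shows "(\<Sum>i\<in>UNIV. pmf p i * f i) \<le> c"
  using prob_simplex_avg_le[OF pmf_in_prob_simplex[of p], of f c] assms by simp

lemma matrix_game_value_mono:
  fixes A B :: "'i::finite \<Rightarrow> 'j::finite \<Rightarrow> real"
  assumes "\<And>i j. A i j \<le> B i j" "\<And>j. w \<le> (\<Sum>i\<in>UNIV. pmf x i * A i j)"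
    "\<And>i. (\<Sum>j\<in>UNIV. pmf y j * B i j) \<le> w'"
  shows "w \<le> w'"
proof -
  have "w \<le> (\<Sum>j\<in>UNIV. pmf y j * (\<Sum>i\<in>UNIV. pmf x i * A i j))"
    by (rule pmf_avg_ge) (rule assms)
  also have "\<dots> \<le> (\<Sum>j\<in>UNIV. pmf y j * (\<Sum>i\<in>UNIV. pmf x i * B i j))"
    by (intro sum_mono mult_left_mono assms) auto
  also have "\<dots> = (\<Sum>i\<in>UNIV. pmf x i * (\<Sum>j\<in>UNIV. pmf y j * B i j))"
    using bilinear_swap[of "\<chi> j. pmf y j" "\<chi> i. pmf x i" B] by simp
  also have "\<dots> \<le> w'"
    by (rule pmf_avg_le) (rule assms)
  finally show ?thesis .
qed

text \<open>A certificate: \<open>x k\<close> and \<open>y k\<close> each secure \<open>v k\<close>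
  in the one-stage game at \<open>k\<close>, so \<open>v\<close> solves Shapley's equation, with
  \<open>x\<close> and \<open>y\<close> as optimal stationary strategies.\<close>

definition discounted_solution ::
  "('k::finite \<Rightarrow> 'i::finite \<Rightarrow> 'j::finite \<Rightarrow> real) \<Rightarrow> ('k \<Rightarrow> 'i \<Rightarrow> 'j \<Rightarrow> 'k pmf) \<Rightarrow> real \<Rightarrow>
    ('k \<Rightarrow> real) \<Rightarrow> ('k \<Rightarrow> 'i pmf) \<Rightarrow> ('k \<Rightarrow> 'j pmf) \<Rightarrow> bool"
where
  "discounted_solution g q \<mu> v x y \<longleftrightarrow> (\<forall>k. v k \<in> {0..1}) \<and>
    (\<forall>k j. v k \<le> (\<Sum>i\<in>UNIV. pmf (x k) i * continuation_payoff g q \<mu> v k i j)) \<and>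
    (\<forall>k i. (\<Sum>j\<in>UNIV. pmf (y k) j * continuation_payoff g q \<mu> v k i j) \<le> v k)"

lemma continuation_payoff_mono:
  assumes "\<mu> \<le> 1" "\<And>k. u k \<le> v k"
  shows "continuation_payoff g q \<mu> u k i j \<le> continuation_payoff g q \<mu> v k i j"
  unfolding continuation_payoff_def
  by (intro add_left_mono mult_left_mono sum_mono) (use assms in auto)

lemma continuation_payoff_bounded:
  assumes "0 \<le> \<mu>" "\<mu> \<le> 1" "\<And>k. v k \<in> {0..1}" "\<And>k i j. g k i j \<in> {0..1}"
  shows "continuation_payoff g q \<mu> v k i j \<in> {0..1}"
proof -
  let ?S = "\<Sum>k'\<in>UNIV. pmf (q k i j) k' * v k'"
  have "0 \<le> ?S" "?S \<le> 1"
    using assms(3) by (auto intro!: pmf_avg_ge pmf_avg_le)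
  then have "0 \<le> \<mu> * g k i j" "\<mu> * g k i j \<le> \<mu> * 1" "0 \<le> (1 - \<mu>) * ?S" "(1 - \<mu>) * ?S \<le> (1 - \<mu>) * 1"
    using assms by (auto intro!: mult_nonneg_nonneg mult_left_mono simp del: mult_1_right)
  then show ?thesis
    by (auto simp: continuation_payoff_def)
qed

text \<open>Knaster-Tarski: the value is the supremum of the subsolutions of the Shapley equation.\<close>

theorem discounted_solution_exists:
  fixes g :: "'k::finite \<Rightarrow> 'i::finite \<Rightarrow> 'j::finite \<Rightarrow> real"
  assumes "0 \<le> \<mu>" "\<mu> \<le> 1" "\<And>k i j. g k i j \<in> {0..1}"
  shows "\<exists>v x y. discounted_solution g q \<mu> v x y"
proof -
  have "\<forall>A :: 'i \<Rightarrow> 'j \<Rightarrow> real. \<exists>w x y.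
      (\<forall>j. w \<le> (\<Sum>i\<in>UNIV. pmf x i * A i j)) \<and> (\<forall>i. (\<Sum>j\<in>UNIV. pmf y j * A i j) \<le> w)"
    using matrix_game_minimax_pmf by blast
  then obtain val :: "('i \<Rightarrow> 'j \<Rightarrow> real) \<Rightarrow> real" and X Y where XY: "\<forall>A.
      (\<forall>j. val A \<le> (\<Sum>i\<in>UNIV. pmf (X A) i * A i j)) \<and> (\<forall>i. (\<Sum>j\<in>UNIV. pmf (Y A) j * A i j) \<le> val A)"
    unfolding choice_iff by blast
  have X: "val A \<le> (\<Sum>i\<in>UNIV. pmf (X A) i * A i j)" for A j
    using XY by blast
  have Y: "(\<Sum>j\<in>UNIV. pmf (Y A) j * A i j) \<le> val A" for A i
    using XY by blast
  define T where "T v k = val (continuation_payoff g q \<mu> v k)" for v k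
  have T_mono: "T u k \<le> T v k" if "\<And>k. u k \<le> v k" for u v k
    unfolding T_def
    by (rule matrix_game_value_mono[where A = "continuation_payoff g q \<mu> u k"
          and B = "continuation_payoff g q \<mu> v k", OF _ X Y]) (intro continuation_payoff_mono assms that)
  have T_bounded: "T v k \<in> {0..1}" if "\<And>k. v k \<in> {0..1}" for v k
  proof -
    note bnd = continuation_payoff_bounded[where g = g and q = q and k = k, OF assms(1,2) that assms(3), simplified]
    have "T v k \<le> 1" unfolding T_def
      by (rule order_trans[OF X[of _ undefined]], rule pmf_avg_le) (use bnd in auto)
    moreover have "0 \<le> T v k" unfolding T_def
      by (rule order_trans[OF _ Y[of _ undefined]], rule pmf_avg_ge) (use bnd in auto)
    ultimately show ?thesis by simp
  qed
  define U where "U = {u. \<forall>k. u k \<in> {0..1} \<and> u k \<le> T u k}"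
  define v where "v k = (SUP u\<in>U. u k)" for k
  have bdd: "bdd_above ((\<lambda>u. u k) ` U)" for k
    by (rule bdd_aboveI2[of _ _ 1]) (auto simp: U_def)
  have zero: "(\<lambda>_. 0) \<in> U"
    using T_bounded[of "\<lambda>_. 0"] by (auto simp: U_def)
  have upper: "u k \<le> v k" if "u \<in> U" for u k
    unfolding v_def using that bdd by (rule cSUP_upper)
  have least: "v k \<le> c" if "\<And>u. u \<in> U \<Longrightarrow> u k \<le> c" for k c
    unfolding v_def using zero that by (intro cSUP_least) auto
  have v01: "v k \<in> {0..1}" for k
    using upper[OF zero, of k] least[of k 1] by (auto simp: U_def)
  have "v k \<le> T v k" for k
  proof (rule least)
    fix u assume u: "u \<in> U"
    then have "u k \<le> T u k" by (auto simp: U_def)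
    also have "\<dots> \<le> T v k" by (intro T_mono upper u)
    finally show "u k \<le> T v k" .
  qed
  moreover from this have "T v \<in> U"
    unfolding U_def using T_mono T_bounded v01 by blast
  then have "T v k \<le> v k" for k
    by (rule upper)
  ultimately have fp: "T v k = v k" for k
    by (rule antisym[rotated])
  have "discounted_solution g q \<mu> v (\<lambda>k. X (continuation_payoff g q \<mu> v k))
      (\<lambda>k. Y (continuation_payoff g q \<mu> v k))"
    unfolding discounted_solution_def
    using v01 X[of "continuation_payoff g q \<mu> v _"] Y[of "continuation_payoff g q \<mu> v _"]
    by (simp add: fp[symmetric] T_def)
  then show ?thesis by blast
qed

section \<open>The auxiliary matrix game\<close>

text \<open>At a minimizer of \<open>u\<close> the average on the left is at least the minimum, so
  the minimum is at least \<open>t\<close> times itself.\<close>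

lemma markov_minimum_principle:
  fixes Q :: "'k::finite \<Rightarrow> 'k \<Rightarrow> real"
  assumes Q: "\<And>k k'. 0 \<le> Q k k'" "\<And>k. (\<Sum>k'\<in>UNIV. Q k k') = 1" and t: "0 \<le> t" "t < 1"
    and u: "\<And>k. t * (\<Sum>k'\<in>UNIV. Q k k' * u k') \<le> u k"
  shows "0 \<le> u k"
proof -
  obtain m where m: "\<And>k. u m \<le> u k"
  proof -
    have "Min (range u) \<in> range u" by (rule Min_in) auto
    then obtain m where "Min (range u) = u m" by (rule imageE)
    moreover have "Min (range u) \<le> u k" for k by simp
    ultimately show ?thesis by (intro that) simp
  qed
  have "u m = (\<Sum>k'\<in>UNIV. Q m k' * u m)"
    by (simp add: Q flip: sum_distrib_right)
  also have "\<dots> \<le> (\<Sum>k'\<in>UNIV. Q m k' * u k')"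
    by (intro sum_mono mult_left_mono m Q)
  finally have "t * u m \<le> u m"
    using u[of m] t(1) by (meson mult_left_mono order_trans)
  then have "0 \<le> (1 - t) * u m"
    by (simp add: algebra_simps)
  then have "0 \<le> u m"
    using t by (simp add: zero_le_mult_iff)
  with m[of k] show ?thesis by linarith
qed

definition resolvent_matrix :: "real \<Rightarrow> ('k::finite \<Rightarrow> 'k \<Rightarrow> real) \<Rightarrow> real^'k^'k" where
  "resolvent_matrix t Q = (\<chi> k k'. (if k = k' then 1 else 0) - t * Q k k')"

lemma resolvent_matrix_mult:
  "(resolvent_matrix t Q *v u) $ k = u $ k - t * (\<Sum>k'\<in>UNIV. Q k k' * u $ k')"
  by (simp add: matrix_vector_mult_def resolvent_matrix_def left_diff_distrib sum_subtractf
      sum_distrib_left mult.assoc if_distrib[where f = "\<lambda>c. c * _"] cong: if_cong)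

text \<open>The minimum principle, applied to a kernel vector and its negative, excludes a zero of
  the determinant for all factors in \<open>[0, 1)\<close>. The sign is then that at
  \<open>0\<close>, where the matrix is the identity.\<close>

lemma det_resolvent_matrix_pos:
  fixes Q :: "'k::finite \<Rightarrow> 'k \<Rightarrow> real"
  assumes Q: "\<And>k k'. 0 \<le> Q k k'" "\<And>k. (\<Sum>k'\<in>UNIV. Q k k') = 1" and t: "0 \<le> t" "t < 1"
  shows "0 < det (resolvent_matrix t Q)"
proof -
  have nz: "det (resolvent_matrix s Q) \<noteq> 0" if s: "0 \<le> s" "s < 1" for s
  proof -
    have "u = 0" if "resolvent_matrix s Q *v u = 0" for u
    proof -
      have *: "s * (\<Sum>k'\<in>UNIV. Q k k' * u $ k') = u $ k" for k
        using arg_cong[OF that, of "\<lambda>v. v $ k"] by (simp add: resolvent_matrix_mult)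
      have "0 \<le> u $ k" for k
        using markov_minimum_principle[where u = "\<lambda>k. u $ k" and Q = Q, OF Q s] * by simp
      moreover have "0 \<le> - u $ k" for k
        using markov_minimum_principle[where u = "\<lambda>k. - u $ k" and Q = Q, OF Q s] * by (simp add: sum_negf)
      ultimately show ?thesis
        by (simp add: vec_eq_iff order_antisym)
    qed
    then show ?thesis
      by (metis invertible_det_nz invertible_left_inverse matrix_left_invertible_ker)
  qed
  have cont: "continuous_on {0..t} (\<lambda>s. det (resolvent_matrix s Q))"
    unfolding det_def resolvent_matrix_def by (simp, intro continuous_intros)
  have "resolvent_matrix 0 Q = mat 1"
    by (simp add: resolvent_matrix_def mat_def)
  then have "det (resolvent_matrix 0 Q) = 1"
    by (metis det_I)
  show ?thesis
  proof (rule ccontr)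
    assume "\<not> ?thesis"
    then have "\<exists>s\<ge>0. s \<le> t \<and> det (resolvent_matrix s Q) = 0"
      using t \<open>det (resolvent_matrix 0 Q) = 1\<close> by (intro IVT2' cont) auto
    with nz t show False by force
  qed
qed

text \<open>The minimum principle compares \<open>v\<close> with the exact solution \<open>w\<close>
  of the linear system; Cramer's rule gives \<open>w\<close> at \<open>m\<close>, and clearing the
  denominator keeps the inequality because the determinant is positive.\<close>

lemma cramer_resolvent_le:
  fixes Q :: "'k::finite \<Rightarrow> 'k \<Rightarrow> real"
  assumes Q: "\<And>k k'. 0 \<le> Q k k'" "\<And>k. (\<Sum>k'\<in>UNIV. Q k k') = 1" and t: "0 \<le> t" "t < 1"
  shows "(\<And>k. v k \<le> b k + t * (\<Sum>k'\<in>UNIV. Q k k' * v k')) \<Longrightarrow>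
      v m * det (resolvent_matrix t Q) \<le> det (\<chi> k k'. if k' = m then b k else resolvent_matrix t Q $ k $ k')"
    and "(\<And>k. b k + t * (\<Sum>k'\<in>UNIV. Q k k' * v k') \<le> v k) \<Longrightarrow>
      det (\<chi> k k'. if k' = m then b k else resolvent_matrix t Q $ k $ k') \<le> v m * det (resolvent_matrix t Q)"
proof -
  let ?T = "resolvent_matrix t Q"
  have pos: "0 < det ?T"
    by (rule det_resolvent_matrix_pos[OF Q t])
  then obtain w where w: "?T *v w = (\<chi> k. b k)"
    by (metis invertible_det_nz less_irrefl invertible_right_inverse matrix_vector_mul_assoc matrix_vector_mul_lid)
  have b: "b k = w $ k - t * (\<Sum>k'\<in>UNIV. Q k k' * w $ k')" for k
    using arg_cong[OF w, of "\<lambda>v. v $ k"] by (simp add: resolvent_matrix_mult)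
  have D: "det (\<chi> k k'. if k' = m then b k else ?T $ k $ k') = w $ m * det ?T"
    using cramer_lemma[of m ?T w] unfolding w vec_lambda_beta .
  show "v m * det ?T \<le> det (\<chi> k k'. if k' = m then b k else ?T $ k $ k')"
    if "\<And>k. v k \<le> b k + t * (\<Sum>k'\<in>UNIV. Q k k' * v k')"
  proof -
    have "0 \<le> w $ m - v m"
      by (rule markov_minimum_principle[where u = "\<lambda>k. w $ k - v k" and Q = Q, OF Q t])
        (use that in \<open>simp add: b right_diff_distrib sum_subtractf algebra_simps\<close>)
    then show ?thesis
      using pos by (simp add: D mult_right_mono)
  qed
  show "det (\<chi> k k'. if k' = m then b k else ?T $ k $ k') \<le> v m * det ?T"
    if "\<And>k. b k + t * (\<Sum>k'\<in>UNIV. Q k k' * v k') \<le> v k"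
  proof -
    have "0 \<le> v m - w $ m"
      by (rule markov_minimum_principle[where u = "\<lambda>k. v k - w $ k" and Q = Q, OF Q t])
        (use that in \<open>simp add: b right_diff_distrib sum_subtractf algebra_simps\<close>)
    then show ?thesis
      using pos by (simp add: D mult_right_mono)
  qed
qed

text \<open>
  Row \<open>k\<close> of either determinant depends only on the action used in state \<open>k\<close>, so averaging over
  independent choices of these actions amounts to averaging the rows.
\<close>

lemma det_mixture:
  fixes R :: "'k::finite \<Rightarrow> 'a::finite \<Rightarrow> 'k \<Rightarrow> real"
  shows "(\<Sum>a\<in>UNIV. (\<Prod>k\<in>UNIV. pmf (p k) (a k)) * det (\<chi> k k'. R k (a k) k'))
    = det (\<chi> k k'. \<Sum>c\<in>UNIV. pmf (p k) c * R k c k')"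
proof -
  have "det (\<chi> k k'. \<Sum>c\<in>UNIV. pmf (p k) c * R k c k') =
      (\<Sum>\<sigma> | \<sigma> permutes UNIV. of_int (sign \<sigma>) * (\<Sum>a\<in>UNIV. \<Prod>k\<in>UNIV. pmf (p k) (a k) * R k (a k) (\<sigma> k)))"
    by (simp add: det_def prod_sum_PiE)
  also have "\<dots> = (\<Sum>a\<in>UNIV. \<Sum>\<sigma> | \<sigma> permutes UNIV.
      of_int (sign \<sigma>) * (\<Prod>k\<in>UNIV. pmf (p k) (a k) * R k (a k) (\<sigma> k)))"
    unfolding sum_distrib_left by (rule sum.swap)
  finally show ?thesis
    by (simp add: det_def prod.distrib sum_distrib_left mult.left_commute)
qed

text \<open>The mixed counterpart of the stationary strategy \<open>p\<close>: a random pure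
  stationary strategy whose actions are independent across the states.\<close>

definition product_mixture :: "('k::finite \<Rightarrow> 'a::finite pmf) \<Rightarrow> real^('k \<Rightarrow> 'a)" where
  "product_mixture p = (\<chi> a. \<Prod>k\<in>UNIV. pmf (p k) (a k))"

lemma product_mixture_in_simplex: "product_mixture p \<in> prob_simplex"
proof -
  have "(\<Sum>a\<in>UNIV. \<Prod>k\<in>UNIV. pmf (p k) (a k)) = (\<Prod>k\<in>UNIV. \<Sum>c\<in>UNIV. pmf (p k) c)"
    by (simp add: prod_sum_PiE)
  then show ?thesis
    by (simp add: prob_simplex_def product_mixture_def sum_pmf_eq_1 prod_nonneg)
qed

text \<open>
  For a pair of pure stationary strategies, Cramer's rule gives the discounted payoff from state
  \<open>m\<close> as a quotient of these two determinants.  They are defined over any commutative ring, so that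
  the discount factor can also be an indeterminate.
\<close>

definition transition_matrix ::
  "(real \<Rightarrow> 'a::comm_ring_1) \<Rightarrow> 'a \<Rightarrow> ('k::finite \<Rightarrow> 'i \<Rightarrow> 'j \<Rightarrow> 'k pmf) \<Rightarrow> ('k \<Rightarrow> 'i) \<Rightarrow> ('k \<Rightarrow> 'j) \<Rightarrow> 'a^'k^'k"
where
  "transition_matrix c l q a b = (\<chi> k k'. (if k = k' then 1 else 0) - (1 - l) * c (pmf (q k (a k) (b k)) k'))"

definition payoff_matrix ::
  "(real \<Rightarrow> 'a::comm_ring_1) \<Rightarrow> 'a \<Rightarrow> ('k::finite \<Rightarrow> 'i \<Rightarrow> 'j \<Rightarrow> real) \<Rightarrow> ('k \<Rightarrow> 'i \<Rightarrow> 'j \<Rightarrow> 'k pmf) \<Rightarrow> 'k \<Rightarrow>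
    ('k \<Rightarrow> 'i) \<Rightarrow> ('k \<Rightarrow> 'j) \<Rightarrow> 'a^'k^'k"
where
  "payoff_matrix c l g q m a b =
    (\<chi> k k'. if k' = m then l * c (g k (a k) (b k)) else transition_matrix c l q a b $ k $ k')"

text \<open>Payoff minus \<open>z\<close>, with the denominator cleared. Averaging the quotients
  over pure strategies would not give the payoff of a mixed stationary strategy, whereas the two
  determinants average correctly; moreover the entries stay polynomial in \<open>l\<close> and
  \<open>z\<close>.\<close>

definition auxiliary_game ::
  "(real \<Rightarrow> 'a::comm_ring_1) \<Rightarrow> 'a \<Rightarrow> 'a \<Rightarrow> ('k::finite \<Rightarrow> 'i \<Rightarrow> 'j \<Rightarrow> real) \<Rightarrow> ('k \<Rightarrow> 'i \<Rightarrow> 'j \<Rightarrow> 'k pmf) \<Rightarrow> 'k \<Rightarrow>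
    ('k \<Rightarrow> 'i) \<Rightarrow> ('k \<Rightarrow> 'j) \<Rightarrow> 'a"
where
  "auxiliary_game c l z g q m a b =
    det (payoff_matrix c l g q m a b) - z * det (transition_matrix c l q a b)"

text \<open>Averaging over a product mixture yields the determinants of the Markov chain in which
  that player uses the mixed stationary strategy and the opponent a pure one.\<close>

lemma transition_mixture:
  fixes q :: "'k::finite \<Rightarrow> 'i::finite \<Rightarrow> 'j::finite \<Rightarrow> 'k pmf" and x :: "'k \<Rightarrow> 'i pmf" and y :: "'k \<Rightarrow> 'j pmf"
  shows "(\<Sum>a\<in>UNIV. product_mixture x $ a * det (transition_matrix (\<lambda>r. r) l q a b))
      = det (resolvent_matrix (1 - l) (\<lambda>k k'. \<Sum>i\<in>UNIV. pmf (x k) i * pmf (q k i (b k)) k'))"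
    and "(\<Sum>a\<in>UNIV. product_mixture x $ a * det (payoff_matrix (\<lambda>r. r) l g q m a b))
      = det (\<chi> k k'. if k' = m then l * (\<Sum>i\<in>UNIV. pmf (x k) i * g k i (b k)) else
          resolvent_matrix (1 - l) (\<lambda>k k'. \<Sum>i\<in>UNIV. pmf (x k) i * pmf (q k i (b k)) k') $ k $ k')"
    and "(\<Sum>b\<in>UNIV. product_mixture y $ b * det (transition_matrix (\<lambda>r. r) l q a b))
      = det (resolvent_matrix (1 - l) (\<lambda>k k'. \<Sum>j\<in>UNIV. pmf (y k) j * pmf (q k (a k) j) k'))"
    and "(\<Sum>b\<in>UNIV. product_mixture y $ b * det (payoff_matrix (\<lambda>r. r) l g q m a b))
      = det (\<chi> k k'. if k' = m then l * (\<Sum>j\<in>UNIV. pmf (y k) j * g k (a k) j) else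
          resolvent_matrix (1 - l) (\<lambda>k k'. \<Sum>j\<in>UNIV. pmf (y k) j * pmf (q k (a k) j) k') $ k $ k')"
  unfolding product_mixture_def transition_matrix_def payoff_matrix_def vec_lambda_beta
  by (subst det_mixture[where R = "\<lambda>k i k'. (if k = k' then 1 else 0) - (1 - l) * pmf (q k i (b k)) k'"]
        det_mixture[where R = "\<lambda>k i k'. if k' = m then l * g k i (b k) else
          (if k = k' then 1 else 0) - (1 - l) * pmf (q k i (b k)) k'"]
        det_mixture[where R = "\<lambda>k j k'. (if k = k' then 1 else 0) - (1 - l) * pmf (q k (a k) j) k'"]
        det_mixture[where R = "\<lambda>k j k'. if k' = m then l * g k (a k) j else
          (if k = k' then 1 else 0) - (1 - l) * pmf (q k (a k) j) k'"],
      rule arg_cong[where f = det],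
      simp add: vec_eq_iff resolvent_matrix_def right_diff_distrib sum_subtractf sum_distrib_left
        sum_pmf_eq_1 ac_simps flip: sum_distrib_right)+

context
  fixes g :: "'k::finite \<Rightarrow> 'i::finite \<Rightarrow> 'j::finite \<Rightarrow> real" and q :: "'k \<Rightarrow> 'i \<Rightarrow> 'j \<Rightarrow> 'k pmf"
    and l :: real and v x y
  assumes l: "0 < l" "l \<le> 1" and sol: "discounted_solution g q l v x y"
begin

lemma continuation_avg:
  fixes p :: "'a::finite pmf"
  shows "(\<Sum>c\<in>UNIV. pmf p c * (l * G c + (1 - l) * (\<Sum>k'\<in>UNIV. Q c k' * v k')))
    = l * (\<Sum>c\<in>UNIV. pmf p c * G c) + (1 - l) * (\<Sum>k'\<in>UNIV. (\<Sum>c\<in>UNIV. pmf p c * Q c k') * v k')"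
proof -
  have "(\<Sum>c\<in>UNIV. \<Sum>k'\<in>UNIV. pmf p c * (Q c k' * v k')) = (\<Sum>k'\<in>UNIV. (\<Sum>c\<in>UNIV. pmf p c * Q c k') * v k')"
    by (subst sum.swap) (simp add: sum_distrib_right mult.assoc)
  then show ?thesis
    by (simp add: distrib_left sum.distrib sum_distrib_left mult.left_commute) (simp flip: sum_distrib_left)
qed

lemma transition_avg_stochastic:
  fixes p :: "'a::finite pmf" and r :: "'a \<Rightarrow> 'k pmf"
  shows "0 \<le> (\<Sum>c\<in>UNIV. pmf p c * pmf (r c) k')" "(\<Sum>k'\<in>UNIV. \<Sum>c\<in>UNIV. pmf p c * pmf (r c) k') = 1"
proof -
  show "(\<Sum>k'\<in>UNIV. \<Sum>c\<in>UNIV. pmf p c * pmf (r c) k') = 1"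
    by (subst sum.swap) (simp add: sum_pmf_eq_1 flip: sum_distrib_left)
qed (simp add: sum_nonneg)

text \<open>Against a pure \<open>b\<close>, Shapley's inequalities make \<open>v\<close> a
  subsolution of the linear system of the chain driven by \<open>x\<close> and \<open>b\<close>.
  Together the two parts give the auxiliary game a positive value for
  \<open>z < v m\<close>.\<close>

lemma auxiliary_game_guarantee1:
  "(v m - z) * (\<Sum>a\<in>UNIV. product_mixture x $ a * det (transition_matrix (\<lambda>r. r) l q a b))
    \<le> (\<Sum>a\<in>UNIV. product_mixture x $ a * auxiliary_game (\<lambda>r. r) l z g q m a b)"
  "0 < (\<Sum>a\<in>UNIV. product_mixture x $ a * det (transition_matrix (\<lambda>r. r) l q a b))"
proof -
  have t: "0 \<le> 1 - l" "1 - l < 1"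
    using l by auto
  note Q = transition_avg_stochastic
  have "v k \<le> l * (\<Sum>i\<in>UNIV. pmf (x k) i * g k i (b k)) +
      (1 - l) * (\<Sum>k'\<in>UNIV. (\<Sum>i\<in>UNIV. pmf (x k) i * pmf (q k i (b k)) k') * v k')" for k
    using sol unfolding discounted_solution_def continuation_payoff_def continuation_avg by blast
  from cramer_resolvent_le(1)[OF Q t this, of m]
  have "v m * (\<Sum>a\<in>UNIV. product_mixture x $ a * det (transition_matrix (\<lambda>r. r) l q a b))
      \<le> (\<Sum>a\<in>UNIV. product_mixture x $ a * det (payoff_matrix (\<lambda>r. r) l g q m a b))"
    unfolding transition_mixture .
  then show "(v m - z) * (\<Sum>a\<in>UNIV. product_mixture x $ a * det (transition_matrix (\<lambda>r. r) l q a b))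
    \<le> (\<Sum>a\<in>UNIV. product_mixture x $ a * auxiliary_game (\<lambda>r. r) l z g q m a b)"
    by (simp add: auxiliary_game_def algebra_simps sum_subtractf sum_distrib_left)
  show "0 < (\<Sum>a\<in>UNIV. product_mixture x $ a * det (transition_matrix (\<lambda>r. r) l q a b))"
    unfolding transition_mixture by (rule det_resolvent_matrix_pos[OF Q t])
qed

text \<open>The mirror image, with \<open>v\<close> a supersolution; for \<open>z < v m\<close> it
  bounds the value of the auxiliary game by a multiple of \<open>v m - z\<close>.\<close>

lemma auxiliary_game_guarantee2:
  "(\<Sum>b\<in>UNIV. product_mixture y $ b * auxiliary_game (\<lambda>r. r) l z g q m a b)
    \<le> (v m - z) * (\<Sum>b\<in>UNIV. product_mixture y $ b * det (transition_matrix (\<lambda>r. r) l q a b))"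
proof -
  have t: "0 \<le> 1 - l" "1 - l < 1"
    using l by auto
  note Q = transition_avg_stochastic
  have "l * (\<Sum>j\<in>UNIV. pmf (y k) j * g k (a k) j) +
      (1 - l) * (\<Sum>k'\<in>UNIV. (\<Sum>j\<in>UNIV. pmf (y k) j * pmf (q k (a k) j) k') * v k') \<le> v k" for k
    using sol unfolding discounted_solution_def continuation_payoff_def continuation_avg by blast
  from cramer_resolvent_le(2)[OF Q t this, of m]
  have "(\<Sum>b\<in>UNIV. product_mixture y $ b * det (payoff_matrix (\<lambda>r. r) l g q m a b))
      \<le> v m * (\<Sum>b\<in>UNIV. product_mixture y $ b * det (transition_matrix (\<lambda>r. r) l q a b))"
    unfolding transition_mixture .
  then show ?thesis
    by (simp add: auxiliary_game_def algebra_simps sum_subtractf sum_distrib_left)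
qed

end

section \<open>Rate of convergence of the discounted values\<close>

text \<open>The outer indeterminate is the discount rate \<open>l\<close>, the inner one
  \<open>z\<close>. With this nesting \<open>pCons a P\<close> splits off the part \<open>a\<close>
  free of \<open>l\<close>, which suits the induction for roots near \<open>l = 0\<close>.\<close>

definition eval2 :: "real poly poly \<Rightarrow> real \<Rightarrow> real \<Rightarrow> real" where
  "eval2 P l z = poly (poly P [:l:]) z"

lemma eval2_simps:
  "eval2 (P + Q) l z = eval2 P l z + eval2 Q l z" "eval2 (P - Q) l z = eval2 P l z - eval2 Q l z"
  "eval2 (P * Q) l z = eval2 P l z * eval2 Q l z" "eval2 (- P) l z = - eval2 P l z"
  "eval2 1 l z = 1" "eval2 0 l z = 0"
  "eval2 [:0, 1:] l z = l" "eval2 [:[:0, 1:]:] l z = z" "eval2 [:[:a:]:] l z = a"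
  by (simp_all add: eval2_def)

lemma eval2_prod: "eval2 (prod P A) l z = (\<Prod>i\<in>A. eval2 (P i) l z)"
  by (simp add: eval2_def poly_prod)

lemma eval2_sum: "eval2 (sum P A) l z = (\<Sum>i\<in>A. eval2 (P i) l z)"
  by (simp add: eval2_def poly_sum)

lemma eval2_of_int: "eval2 (of_int n) l z = of_int n"
  by (simp add: eval2_def of_int_poly)

lemma eval2_det: "eval2 (det A) l z = det (\<chi> i j. eval2 (A $ i $ j) l z)"
  by (simp add: det_def eval2_sum eval2_prod eval2_simps eval2_of_int)

text \<open>With indeterminates for \<open>l\<close> and \<open>z\<close>, one determinant per
  choice function serves all rates at once.\<close>

definition poly_game ::
  "('k::finite \<Rightarrow> 'i \<Rightarrow> 'j \<Rightarrow> real) \<Rightarrow> ('k \<Rightarrow> 'i \<Rightarrow> 'j \<Rightarrow> 'k pmf) \<Rightarrow> 'k \<Rightarrow>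
    ('k \<Rightarrow> 'i) \<Rightarrow> ('k \<Rightarrow> 'j) \<Rightarrow> real poly poly"
where
  "poly_game = auxiliary_game (\<lambda>r. [:[:r:]:]) [:0, 1:] [:[:0, 1:]:]"

lemma eval2_poly_game: "eval2 (poly_game g q m a b) l z = auxiliary_game (\<lambda>r. r) l z g q m a b"
proof -
  have *: "eval2 (transition_matrix (\<lambda>r. [:[:r:]:]) [:0, 1:] q a b $ k $ k') l z
      = transition_matrix (\<lambda>r. r) l q a b $ k $ k'" for k k'
    by (simp add: transition_matrix_def eval2_simps del: mult_pCons_left mult_pCons_right)
  have "eval2 (payoff_matrix (\<lambda>r. [:[:r:]:]) [:0, 1:] g q m a b $ k $ k') l z
      = payoff_matrix (\<lambda>r. r) l g q m a b $ k $ k'" for k k'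
    by (simp add: payoff_matrix_def * eval2_simps del: mult_pCons_left mult_pCons_right)
  with * show ?thesis
    by (simp add: poly_game_def auxiliary_game_def eval2_simps eval2_det
        del: mult_pCons_left mult_pCons_right)
qed

lemma eval2_basis_matrix:
  "eval2 (basis_matrix A s $ r $ c) l z = basis_matrix (\<lambda>a b. eval2 (A a b) l z) s $ r $ c"
  by (auto simp: basis_matrix_def eval2_simps split: option.split sum.split)

lemma eval2_det_basis_matrix:
  "eval2 (det (basis_matrix A s)) l z = det (basis_matrix (\<lambda>a b. eval2 (A a b) l z) s)"
  by (simp add: eval2_det eval2_basis_matrix)

lemma eval2_det_value_matrix:
  "eval2 (det (value_matrix A s)) l z = det (value_matrix (\<lambda>a b. eval2 (A a b) l z) s)"
  by (simp add: eval2_det value_matrix_def eval2_basis_matrix eval2_simps if_distrib[where f = "\<lambda>P. eval2 P l z"]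
      cong: if_cong)

lemma tendsto_eval2: "(\<lambda>n. f n) \<longlonglongrightarrow> z \<Longrightarrow> (\<lambda>n. eval2 P l (f n)) \<longlonglongrightarrow> eval2 P l z"
  unfolding eval2_def by (intro tendsto_intros)

text \<open>
  For \<open>z < v m\<close> the auxiliary game has a positive value, which tends to \<open>0\<close> as \<open>z\<close> tends to \<open>v m\<close>.
  By pigeonhole a single basis is optimal for infinitely many such \<open>z\<close>, so the numerator of
  the corresponding formula for the value vanishes at \<open>v m\<close> without vanishing identically.
\<close>

lemma discounted_value_root:
  fixes g :: "'k::finite \<Rightarrow> 'i::finite \<Rightarrow> 'j::finite \<Rightarrow> real"
  assumes l: "0 < l" "l \<le> 1" and sol: "discounted_solution g q l v x y"
  shows "\<exists>s. det (value_matrix (poly_game g q m) s) \<noteq> 0 \<and>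
    eval2 (det (value_matrix (poly_game g q m) s)) l (v m) = 0"
proof -
  define z where "z n = v m - 1 / real (Suc n)" for n
  define W where "W n = (\<lambda>a b. eval2 (poly_game g q m a b) l (z n))" for n
  have "z \<longlonglongrightarrow> v m - 0"
    unfolding z_def by (intro tendsto_intros LIMSEQ_Suc lim_1_over_n)
  then have z: "z \<longlonglongrightarrow> v m" by simp
  obtain D where D: "\<And>a. (\<Sum>b\<in>UNIV. product_mixture y $ b * det (transition_matrix (\<lambda>r. r) l q a b)) \<le> D"
  proof -
    obtain D where "\<And>a. \<bar>\<Sum>b\<in>UNIV. product_mixture y $ b * det (transition_matrix (\<lambda>r. r) l q a b)\<bar> \<le> D"
      by (rule finite_type_bounded[of "\<lambda>a. \<Sum>b\<in>UNIV. product_mixture y $ b *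
        det (transition_matrix (\<lambda>r. r) l q a b)"]) blast
    with that show ?thesis by (meson abs_le_D1)
  qed
  have "\<forall>n. \<exists>s w. 0 < w \<and> w \<le> D / real (Suc n) \<and> det (basis_matrix (W n) s) \<noteq> 0 \<and>
      w * det (basis_matrix (W n) s) = det (value_matrix (W n) s)" (is "\<forall>n. ?P n")
  proof
    fix n
    obtain w p s where p: "p \<in> prob_simplex" "\<And>b. w \<le> (\<Sum>a\<in>UNIV. p $ a * W n a b)"
      and opt: "\<And>p'. p' \<in> prob_simplex \<Longrightarrow> \<exists>b. (\<Sum>a\<in>UNIV. p' $ a * W n a b) \<le> w"
      and s: "det (basis_matrix (W n) s) \<noteq> 0" "w * det (basis_matrix (W n) s) = det (value_matrix (W n) s)"
      by (rule matrix_game_basic_solution[of "W n"]) blast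
    have Wn: "W n a b = auxiliary_game (\<lambda>r. r) l (z n) g q m a b" for a b
      by (simp add: W_def eval2_poly_game)
    have vz: "v m - z n = 1 / real (Suc n)"
      by (simp add: z_def)
    obtain b where "(\<Sum>a\<in>UNIV. product_mixture x $ a * W n a b) \<le> w"
      using opt[OF product_mixture_in_simplex] by blast
    moreover have "0 < (v m - z n) * (\<Sum>a\<in>UNIV. product_mixture x $ a * det (transition_matrix (\<lambda>r. r) l q a b))"
      using auxiliary_game_guarantee1(2)[OF l sol] vz by (intro mult_pos_pos) auto
    ultimately have "0 < w"
      using auxiliary_game_guarantee1(1)[OF l sol, of m "z n" b] unfolding Wn by linarith
    have "w \<le> (\<Sum>b\<in>UNIV. product_mixture y $ b * (\<Sum>a\<in>UNIV. p $ a * W n a b))"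
      by (rule prob_simplex_avg_ge[OF product_mixture_in_simplex p(2)])
    also have "\<dots> = (\<Sum>a\<in>UNIV. p $ a * (\<Sum>b\<in>UNIV. product_mixture y $ b * W n a b))"
      by (rule bilinear_swap)
    also have "\<dots> \<le> D / real (Suc n)"
    proof (rule prob_simplex_avg_le[OF p(1)])
      fix a
      have "(\<Sum>b\<in>UNIV. product_mixture y $ b * W n a b)
        \<le> (v m - z n) * (\<Sum>b\<in>UNIV. product_mixture y $ b * det (transition_matrix (\<lambda>r. r) l q a b))"
        unfolding Wn by (rule auxiliary_game_guarantee2[OF l sol])
      also have "\<dots> \<le> 1 / real (Suc n) * D"
        unfolding vz by (intro mult_left_mono D) auto
      finally show "(\<Sum>b\<in>UNIV. product_mixture y $ b * W n a b) \<le> D / real (Suc n)"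
        by simp
    qed
    finally show "?P n"
      using \<open>0 < w\<close> s by blast
  qed
  then obtain S w where Sw: "\<And>n. 0 < w n" "\<And>n. w n \<le> D / real (Suc n)"
      "\<And>n. det (basis_matrix (W n) (S n)) \<noteq> 0"
      "\<And>n. w n * det (basis_matrix (W n) (S n)) = det (value_matrix (W n) (S n))"
    unfolding choice_iff by blast
  obtain n0 where n0: "infinite {n \<in> UNIV. S n = S n0}"
    using pigeonhole_infinite[of "UNIV :: nat set" S] by auto
  define s where "s = S n0"
  define M where "M = det (value_matrix (poly_game g q m) s)"
  define B where "B = det (basis_matrix (poly_game g q m) s)"
  have eval: "eval2 M l (z n) = det (value_matrix (W n) s)" "eval2 B l (z n) = det (basis_matrix (W n) s)" for n
    by (simp_all add: M_def B_def W_def eval2_det_value_matrix eval2_det_basis_matrix)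
  have "w \<longlonglongrightarrow> 0"
  proof (rule tendsto_sandwich[of "\<lambda>_. 0" w _ "\<lambda>n. D / real (Suc n)"])
    show "(\<lambda>n. D / real (Suc n)) \<longlonglongrightarrow> 0"
      using tendsto_mult[OF tendsto_const[of D] LIMSEQ_Suc[OF lim_1_over_n]] by simp
    show "\<forall>\<^sub>F n in sequentially. 0 \<le> w n"
      using Sw(1) by (simp add: less_imp_le)
    show "\<forall>\<^sub>F n in sequentially. w n \<le> D / real (Suc n)"
      using Sw(2) by (simp del: of_nat_Suc)
  qed auto
  \<comment> \<open>The relation is passed to the limit without dividing, since the denominator
    \<open>B\<close> may vanish at \<open>v m\<close>.\<close>
  then have "(\<lambda>n. eval2 M l (z n) - w n * eval2 B l (z n)) \<longlonglongrightarrow> eval2 M l (v m) - 0 * eval2 B l (v m)"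
    by (intro tendsto_intros tendsto_eval2 z)
  then have lim: "(\<lambda>n. eval2 M l (z n) - w n * eval2 B l (z n)) \<longlonglongrightarrow> eval2 M l (v m)"
    by simp
  have zero: "eval2 M l (z n) - w n * eval2 B l (z n) = 0" if "S n = s" for n
    using Sw(4)[of n] that by (simp add: eval)
  have "eval2 M l (v m) = 0"
  proof (rule ccontr)
    assume "eval2 M l (v m) \<noteq> 0"
    then have "\<forall>\<^sub>F n in sequentially. eval2 M l (z n) - w n * eval2 B l (z n) \<noteq> 0"
      by (rule tendsto_imp_eventually_ne[OF lim])
    then obtain N where "\<And>n. n \<ge> N \<Longrightarrow> eval2 M l (z n) - w n * eval2 B l (z n) \<noteq> 0"
      by (auto simp: eventually_sequentially)
    moreover obtain n where "n \<ge> N" "S n = s"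
      using n0 unfolding s_def by (auto simp: infinite_nat_iff_unbounded_le)
    ultimately show False
      using zero by blast
  qed
  \<comment> \<open>Here the strict positivity of the value below \<open>v m\<close> enters: value
    and denominator are nonzero at \<open>z n0\<close>, hence so is the numerator.\<close>
  moreover have "eval2 M l (z n0) \<noteq> 0"
    using Sw(1)[of n0] Sw(3)[of n0] Sw(4)[of n0] by (auto simp: eval s_def)
  then have "M \<noteq> 0"
    by (auto simp: eval2_simps)
  ultimately show ?thesis
    unfolding M_def by blast
qed

text \<open>The choice function of \<open>discounted_value_root\<close> varies with
  \<open>l\<close>, but there are finitely many of them, so the product of all nonzero numerators
  serves every \<open>l\<close>.\<close>

theorem discounted_value_algebraic:
  fixes g :: "'k::finite \<Rightarrow> 'i::finite \<Rightarrow> 'j::finite \<Rightarrow> real"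
  obtains P where "P \<noteq> 0"
    "\<And>l v x y. 0 < l \<Longrightarrow> l \<le> 1 \<Longrightarrow> discounted_solution g q l v x y \<Longrightarrow> eval2 P l (v m) = 0"
proof -
  define M where "M s = det (value_matrix (poly_game g q m) s)" for s
  show ?thesis
  proof (rule that[of "\<Prod>s\<in>{s. M s \<noteq> 0}. M s"])
    show "(\<Prod>s\<in>{s. M s \<noteq> 0}. M s) \<noteq> 0"
      by (subst prod_zero_iff) auto
    fix l v x y
    assume "0 < l" "l \<le> 1" "discounted_solution g q l v x y"
    then obtain s where "M s \<noteq> 0" "eval2 (M s) l (v m) = 0"
      unfolding M_def using discounted_value_root by blast
    then show "eval2 (\<Prod>s\<in>{s. M s \<noteq> 0}. M s) l (v m) = 0"
      by (auto simp: eval2_prod)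
  qed
qed

section \<open>Roots of a bivariate polynomial for small discount rates\<close>

lemma poly_bounded_01:
  fixes p :: "real poly"
  obtains C where "\<And>z. z \<in> {0..1} \<Longrightarrow> \<bar>poly p z\<bar> \<le> C"
proof -
  have "compact (poly p ` {0..1})"
    by (intro compact_continuous_image continuous_intros) auto
  then obtain C where "\<And>u. u \<in> poly p ` {0..1} \<Longrightarrow> norm u \<le> C"
    using compact_imp_bounded bounded_iff by metis
  with that[of C] show ?thesis by force
qed

lemma eval2_pCons: "eval2 (pCons a P) l z = poly a z + l * eval2 P l z"
  by (simp add: eval2_def)

lemma eval2_bounded:
  obtains C where "\<And>l z. l \<in> {0..1} \<Longrightarrow> z \<in> {0..1} \<Longrightarrow> \<bar>eval2 P l z\<bar> \<le> C"
proof -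
  have "\<exists>C. \<forall>l\<in>{0..1}. \<forall>z\<in>{0..1}. \<bar>eval2 P l z\<bar> \<le> C"
  proof (induction P)
    case (pCons a P)
    then obtain C where C: "\<And>l z. l \<in> {0..1} \<Longrightarrow> z \<in> {0..1} \<Longrightarrow> \<bar>eval2 P l z\<bar> \<le> C"
      by blast
    obtain C' where C': "\<And>z. z \<in> {0..1} \<Longrightarrow> \<bar>poly a z\<bar> \<le> C'"
      by (rule poly_bounded_01[of a]) blast
    have "\<bar>eval2 (pCons a P) l z\<bar> \<le> C' + C" if "l \<in> {0..1}" "z \<in> {0..1}" for l z
    proof -
      have "\<bar>l * eval2 P l z\<bar> \<le> 1 * C"
        unfolding abs_mult using that C[OF that] by (intro mult_mono) auto
      then show ?thesis
        using C'[OF that(2)] by (simp add: eval2_pCons)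
    qed
    then show ?case by blast
  qed (auto simp: eval2_simps intro!: exI[of _ 0])
  with that show ?thesis by blast
qed

text \<open>At a root a common power of \<open>l\<close> cancels, as \<open>l > 0\<close>. In what
  remains the part \<open>Q\<close> free of \<open>l\<close> is nonzero, and the rest is
  \<open>l\<close> times a bounded quantity.\<close>

lemma eval2_root_near_poly_root:
  assumes "P \<noteq> 0"
  shows "\<exists>Q C. Q \<noteq> 0 \<and> (\<forall>l z. 0 < l \<longrightarrow> l \<le> 1 \<longrightarrow> z \<in> {0..1} \<longrightarrow> eval2 P l z = 0 \<longrightarrow> \<bar>poly Q z\<bar> \<le> C * l)"
  using assms
proof (induction P)
  case (pCons a P)
  show ?case
  proof (cases "a = 0")
    case True
    then have "P \<noteq> 0" using pCons.hyps by auto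
    from pCons.IH[OF this] show ?thesis
      using True by (auto simp: eval2_pCons)
  next
    case False
    obtain C where C: "\<And>l z. l \<in> {0..1} \<Longrightarrow> z \<in> {0..1} \<Longrightarrow> \<bar>eval2 P l z\<bar> \<le> C"
      by (rule eval2_bounded[of P]) blast
    have "\<bar>poly a z\<bar> \<le> C * l" if "0 < l" "l \<le> 1" "z \<in> {0..1}" "eval2 (pCons a P) l z = 0" for l z
    proof -
      have "poly a z = - (l * eval2 P l z)"
        using that(4) by (simp add: eval2_pCons)
      then have "\<bar>poly a z\<bar> = l * \<bar>eval2 P l z\<bar>"
        using that(1) by (simp add: abs_mult)
      also have "\<dots> \<le> l * C"
        using that C[of l z] by (intro mult_left_mono) auto
      finally show ?thesis by (simp add: mult.commute)
    qed
    with False show ?thesis by blast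
  qed
qed simp

text \<open>\<open>Q\<close> has finite order at \<open>c\<close>. One more than this order is
  taken, so that the exponent is positive even if \<open>c\<close> is not a root: its reciprocal
  becomes the rate.\<close>

lemma poly_lower_bound_near:
  fixes Q :: "real poly"
  assumes "Q \<noteq> 0"
  obtains d r \<delta> where "r > 0" "\<delta> > 0" "\<And>z. \<bar>z - c\<bar> < \<delta> \<Longrightarrow> r * \<bar>z - c\<bar> ^ Suc d \<le> \<bar>poly Q z\<bar>"
proof -
  obtain R where R: "Q = [:- c, 1:] ^ order c Q * R" "\<not> [:- c, 1:] dvd R"
    using order_decomp[OF assms] by blast
  have Rc: "poly R c \<noteq> 0"
    using R(2) by (simp add: poly_eq_0_iff_dvd)
  define r where "r = \<bar>poly R c\<bar> / 2"
  have "r > 0"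
    using Rc by (simp add: r_def)
  moreover have "isCont (poly R) c"
    by simp
  ultimately obtain \<delta> where \<delta>: "\<delta> > 0" "\<And>z. \<bar>z - c\<bar> < \<delta> \<Longrightarrow> \<bar>poly R z - poly R c\<bar> < r"
    unfolding continuous_at_eps_delta dist_real_def by blast
  show ?thesis
  proof (rule that[of r "min \<delta> 1" "order c Q"])
    fix z assume z: "\<bar>z - c\<bar> < min \<delta> 1"
    then have "r \<le> \<bar>poly R z\<bar>"
      using \<delta>(2)[of z] unfolding r_def by (auto simp: abs_if split: if_splits)
    then have "\<bar>z - c\<bar> ^ order c Q * r \<le> \<bar>z - c\<bar> ^ order c Q * \<bar>poly R z\<bar>"
      by (intro mult_left_mono) auto
    also have "\<dots> = \<bar>poly Q z\<bar>"
      by (subst R(1)) (simp add: abs_mult power_abs)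
    finally have "r * \<bar>z - c\<bar> ^ order c Q \<le> \<bar>poly Q z\<bar>"
      by (simp add: mult.commute)
    moreover have "r * \<bar>z - c\<bar> ^ Suc (order c Q) \<le> r * \<bar>z - c\<bar> ^ order c Q"
      using z by (intro mult_left_mono power_decreasing) (auto simp: r_def)
    ultimately show "r * \<bar>z - c\<bar> ^ Suc (order c Q) \<le> \<bar>poly Q z\<bar>"
      by linarith
  qed (use Rc \<delta> in \<open>auto simp: r_def\<close>)
qed

text \<open>At \<open>V l\<close> the polynomial \<open>Q\<close> is of size \<open>O(l)\<close>,
  and near \<open>c\<close> it is at least a multiple of a power of the distance to
  \<open>c\<close>; extracting the root gives the rate.\<close>

lemma algebraic_convergence_rate:
  fixes V :: "real \<Rightarrow> real"
  assumes "P \<noteq> 0" and V01: "\<And>l. 0 < l \<Longrightarrow> l \<le> 1 \<Longrightarrow> V l \<in> {0..1}"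
    and root: "\<And>l. 0 < l \<Longrightarrow> l \<le> 1 \<Longrightarrow> eval2 P l (V l) = 0"
    and lim: "(V \<longlongrightarrow> c) (at_right 0)"
  shows "\<exists>a C. a > 0 \<and> (\<forall>\<^sub>F l in at_right 0. \<bar>V l - c\<bar> \<le> C * l powr a)"
proof -
  obtain Q C where Q: "Q \<noteq> 0"
    "\<And>l z. 0 < l \<Longrightarrow> l \<le> 1 \<Longrightarrow> z \<in> {0..1} \<Longrightarrow> eval2 P l z = 0 \<Longrightarrow> \<bar>poly Q z\<bar> \<le> C * l"
    using eval2_root_near_poly_root[OF assms(1)] by blast
  obtain d r \<delta> where d: "r > 0" "\<delta> > 0" "\<And>z. \<bar>z - c\<bar> < \<delta> \<Longrightarrow> r * \<bar>z - c\<bar> ^ Suc d \<le> \<bar>poly Q z\<bar>"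
    using poly_lower_bound_near[OF Q(1)] by metis
  define a where "a = 1 / real (Suc d)"
  have "\<forall>\<^sub>F l in at_right 0. \<bar>V l - c\<bar> < \<delta>"
    using tendstoD[OF lim d(2)] by (simp add: dist_real_def)
  moreover have "\<forall>\<^sub>F l in at_right (0::real). 0 < l \<and> l \<le> 1"
    by (auto simp: eventually_at_right_field intro!: exI[of _ 1])
  ultimately have "\<forall>\<^sub>F l in at_right 0. \<bar>V l - c\<bar> \<le> (\<bar>C\<bar> / r) powr a * l powr a"
  proof eventually_elim
    case (elim l)
    have "r * \<bar>V l - c\<bar> ^ Suc d \<le> C * l"
      using d(3)[OF elim(1)] Q(2)[of l "V l"] V01[of l] root[of l] elim(2) by linarith
    also have "\<dots> \<le> \<bar>C\<bar> * l"
      using elim by (intro mult_right_mono) auto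
    finally have le: "\<bar>V l - c\<bar> ^ Suc d \<le> \<bar>C\<bar> / r * l"
      using d(1) by (simp add: field_simps)
    have "\<bar>V l - c\<bar> = (\<bar>V l - c\<bar> ^ Suc d) powr a"
      by (cases "V l = c") (simp_all add: a_def powr_powr del: power_Suc of_nat_Suc flip: powr_realpow)
    also have "\<dots> \<le> (\<bar>C\<bar> / r * l) powr a"
      using le by (intro powr_mono2) (auto simp: a_def)
    also have "\<dots> = (\<bar>C\<bar> / r) powr a * l powr a"
      using elim d(1) by (intro powr_mult) 
    finally show ?case .
  qed
  moreover have "a > 0" by (simp add: a_def)
  ultimately show ?thesis by blast
qed

lemma uniform_convergence_rate:
  fixes V :: "real \<Rightarrow> 'k::finite \<Rightarrow> real"
  assumes "\<And>k. \<exists>a C. a > 0 \<and> (\<forall>\<^sub>F l in at_right 0. \<bar>V l k - c k\<bar> \<le> C * l powr a)"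
  obtains a C where "a > 0" "C > 0" "\<forall>\<^sub>F l in at_right 0. \<forall>k. \<bar>V l k - c k\<bar> \<le> C * l powr a"
proof -
  have "\<forall>k. \<exists>a C. a > 0 \<and> (\<forall>\<^sub>F l in at_right 0. \<bar>V l k - c k\<bar> \<le> C * l powr a)"
    using assms by blast
  then obtain a C where aC: "\<And>k. a k > 0" "\<And>k. \<forall>\<^sub>F l in at_right 0. \<bar>V l k - c k\<bar> \<le> C k * l powr a k"
    unfolding choice_iff by blast
  obtain B where B: "\<And>k. \<bar>C k\<bar> \<le> B"
    by (rule finite_type_bounded[of C]) blast
  have "\<forall>\<^sub>F l in at_right (0::real). 0 < l \<and> l \<le> 1"
    by (auto simp: eventually_at_right_field intro!: exI[of _ 1])
  moreover have "\<forall>\<^sub>F l in at_right 0. \<forall>k. \<bar>V l k - c k\<bar> \<le> C k * l powr a k"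
    using aC(2) by (simp add: eventually_all_finite)
  ultimately have "\<forall>\<^sub>F l in at_right 0. \<forall>k. \<bar>V l k - c k\<bar> \<le> max 1 B * l powr Min (range a)"
  proof eventually_elim
    case (elim l)
    show ?case
    proof
      fix k
      have "\<bar>V l k - c k\<bar> \<le> C k * l powr a k"
        using elim by blast
      also have "\<dots> \<le> max 1 B * l powr Min (range a)"
        using elim B[of k] by (intro mult_mono powr_mono') auto
      finally show "\<bar>V l k - c k\<bar> \<le> max 1 B * l powr Min (range a)" .
    qed
  qed
  moreover have "Min (range a) > 0"
    using aC(1) by (subst Min_gr_iff) auto
  ultimately show ?thesis
    by (intro that[of "Min (range a)" "max 1 B"]) auto
qed

section \<open>Weights as varying discount rates\<close>

text \<open>Summation by parts gives a combination of the partial sums of \<open>d\<close> with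
  nonnegative coefficients that add up to \<open>w 0\<close>.\<close>

lemma abel_lower_bound:
  fixes w d :: "nat \<Rightarrow> real"
  assumes "\<And>n. - K \<le> (\<Sum>m<n. d m)" "decseq w" "\<And>n. 0 \<le> w n"
  shows "- (K * w 0) \<le> (\<Sum>m<n. w m * d m)"
proof -
  have eq: "(\<Sum>m<n. w m * d m) = w n * (\<Sum>m<n. d m) + (\<Sum>m<n. (w m - w (Suc m)) * (\<Sum>l<Suc m. d l))"
    by (induction n) (simp_all add: algebra_simps)
  have "- (K * w 0) = w n * - K + (\<Sum>m<n. (w m - w (Suc m)) * - K)"
    by (subst sum_distrib_right[symmetric], subst sum_lessThan_telescope') (simp add: algebra_simps)
  also have "\<dots> \<le> (\<Sum>m<n. w m * d m)"
    unfolding eq using assms by (intro add_mono sum_mono mult_left_mono) (auto simp: decseq_Suc_iff simp del: sum.lessThan_Suc)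
  finally show ?thesis .
qed

text \<open>In use, \<open>A\<close> is the expected discounted value (or \<open>1\<close> minus it)
  along a play in which the opponent is optimal in the discounted game, so \<open>A 0\<close> is at
  least the discounted sum of \<open>G\<close>. As \<open>c \<le> 1\<close> and
  \<open>G \<ge> 0\<close>, the partial sums of \<open>G - c\<close> never fall below
  \<open>- N\<close>, and Abel summation costs \<open>l * N\<close>.\<close>

lemma discounted_ge_of_uniform:
  fixes G A :: "nat \<Rightarrow> real" and N :: nat and l c :: real
  assumes l: "0 < l" "l \<le> 1" and G: "\<And>m. 0 \<le> G m" and A: "\<And>m. 0 \<le> A m"
    and step: "\<And>m. l * G m + (1 - l) * A (Suc m) \<le> A m"
    and c: "c \<le> 1" "\<And>n. N \<le> n \<Longrightarrow> n * c \<le> (\<Sum>m<n. G m)"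
  shows "c - l * N \<le> A 0"
proof -
  have partial: "- real N \<le> (\<Sum>m<n. G m - c)" for n
  proof (cases "N \<le> n")
    case True
    then show ?thesis using c(2)[OF True] by (simp add: sum_subtractf)
  next
    case False
    have "real n * c \<le> real n * 1"
      using c(1) by (intro mult_left_mono) auto
    moreover have "0 \<le> (\<Sum>m<n. G m)"
      by (intro sum_nonneg G)
    ultimately show ?thesis
      using False by (simp add: sum_subtractf)
  qed
  have ge: "c * (1 - (1 - l) ^ n) - l * N \<le> A 0" for n
  proof -
    have "l * (\<Sum>m<n. (1 - l) ^ m * G m) + (1 - l) ^ n * A n \<le> A 0"
    proof (induction n)
      case (Suc n)
      have "(1 - l) ^ n * (l * G n + (1 - l) * A (Suc n)) \<le> (1 - l) ^ n * A n"
        using l by (intro mult_left_mono step) auto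
      with Suc show ?case by (simp add: algebra_simps)
    qed simp
    moreover have "0 \<le> (1 - l) ^ n * A n"
      using l A by simp
    ultimately have "l * (\<Sum>m<n. (1 - l) ^ m * G m) \<le> A 0"
      by linarith
    moreover have "- (real N * (1 - l) ^ 0) \<le> (\<Sum>m<n. (1 - l) ^ m * (G m - c))"
      using l by (intro abel_lower_bound partial decseq_SucI) (auto simp: mult_left_le_one_le)
    then have "l * - real N \<le> l * (\<Sum>m<n. (1 - l) ^ m * (G m - c))"
      using l by (intro mult_left_mono) auto
    moreover have geom: "l * (\<Sum>m<n. (1 - l) ^ m) = 1 - (1 - l) ^ n"
      by (simp add: one_diff_power_eq[of "1 - l"])
    have "(\<Sum>m<n. (1 - l) ^ m * (G m - c)) = (\<Sum>m<n. (1 - l) ^ m * G m) - c * (\<Sum>m<n. (1 - l) ^ m)"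
      by (simp add: algebra_simps sum_subtractf sum_distrib_left)
    then have "l * (\<Sum>m<n. (1 - l) ^ m * (G m - c))
        = l * (\<Sum>m<n. (1 - l) ^ m * G m) - c * (1 - (1 - l) ^ n)"
      unfolding geom[symmetric] by (simp add: right_diff_distrib mult.left_commute)
    ultimately show ?thesis
      by linarith
  qed
  have "(\<lambda>n. c * (1 - (1 - l) ^ n) - l * N) \<longlonglongrightarrow> c * (1 - 0) - l * N"
    using l by (intro tendsto_intros LIMSEQ_power_zero) auto
  then show ?thesis
    using ge by (intro LIMSEQ_le_const2[where X = "\<lambda>n. c * (1 - (1 - l) ^ n) - l * N"]) auto
qed

text \<open>A relative gap puts the smaller number below the larger one times a factor bounded away
  from \<open>1\<close>. The powers then differ by at least a fixed fraction of the larger power,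
  hence of their sum.\<close>

lemma powr_relative_gap:
  fixes a \<eta> :: real
  assumes "0 < a" "0 < \<eta>" "\<eta> < 1"
  obtains \<kappa> where "\<kappa> > 0"
    "\<forall>x y. 0 < x \<longrightarrow> 0 < y \<longrightarrow> \<eta> * x < \<bar>x - y\<bar> \<longrightarrow> \<kappa> * (x powr a + y powr a) \<le> \<bar>x powr a - y powr a\<bar>"
proof -
  define \<theta> where "\<theta> = max ((1 / (1 + \<eta>)) powr a) ((1 - \<eta>) powr a)"
  have "(1 / (1 + \<eta>)) powr a < 1 powr a" "(1 - \<eta>) powr a < 1 powr a"
    using assms by (intro powr_less_mono2; simp)+
  then have \<theta>: "\<theta> < 1"
    by (simp add: \<theta>_def)
  have main: "(1 - \<theta>) / 2 * (u powr a + v powr a) \<le> u powr a - v powr a"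
    if "0 < u" "0 < v" "v \<le> u * r" "r powr a \<le> \<theta>" "0 < r" for u v r
  proof -
    have "v powr a \<le> (u * r) powr a"
      using that assms by (intro powr_mono2) auto
    also have "\<dots> = u powr a * r powr a"
      using that by (intro powr_mult)
    also have "\<dots> \<le> u powr a * \<theta>"
      using that by (intro mult_left_mono) auto
    finally have v: "v powr a \<le> u powr a * \<theta>" .
    also have "\<dots> \<le> u powr a * 1"
      using \<theta> by (intro mult_left_mono) auto
    finally have "(1 - \<theta>) / 2 * (u powr a + v powr a) \<le> (1 - \<theta>) / 2 * (2 * u powr a)"
      using \<theta> by (intro mult_left_mono) auto
    also have "\<dots> = u powr a - u powr a * \<theta>"
      by (simp add: field_simps)
    also have "\<dots> \<le> u powr a - v powr a"
      using v by simp
    finally show ?thesis .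
  qed
  show ?thesis
  proof (rule that[of "(1 - \<theta>) / 2"], safe)
    fix x y :: real
    assume xy: "0 < x" "0 < y" "\<eta> * x < \<bar>x - y\<bar>"
    then consider "x * (1 + \<eta>) \<le> y" | "y \<le> x * (1 - \<eta>)"
      by (fastforce simp: abs_if algebra_simps split: if_splits)
    then show "(1 - \<theta>) / 2 * (x powr a + y powr a) \<le> \<bar>x powr a - y powr a\<bar>"
    proof cases
      case 1
      then have "x \<le> y * (1 / (1 + \<eta>))"
        using assms by (simp add: field_simps)
      then have "(1 - \<theta>) / 2 * (y powr a + x powr a) \<le> y powr a - x powr a"
        by (rule main[OF xy(2,1)]) (use assms in \<open>auto simp: \<theta>_def\<close>)
      then show ?thesis
        unfolding add.commute[of "x powr a"] by linarith
    next
      case 2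
      then have "(1 - \<theta>) / 2 * (x powr a + y powr a) \<le> x powr a - y powr a"
        by (rule main[OF xy(1,2)]) (use assms in \<open>auto simp: \<theta>_def\<close>)
      then show ?thesis by linarith
    qed
  qed (use \<theta> in auto)
qed

text \<open>
  A piecewise constant approximation of \<open>\<mu>\<close>: it jumps to the current value as soon as its relative
  error exceeds \<open>\<eta>\<close>, and each jump is paid for by the variation of \<open>\<mu>\<close> since the previous one.
\<close>

fun hysteresis :: "real \<Rightarrow> (nat \<Rightarrow> real) \<Rightarrow> nat \<Rightarrow> real" where
  "hysteresis \<eta> \<mu> 0 = \<mu> 0"
| "hysteresis \<eta> \<mu> (Suc m) =
    (if \<bar>\<mu> (Suc m) - hysteresis \<eta> \<mu> m\<bar> \<le> \<eta> * \<mu> (Suc m) then hysteresis \<eta> \<mu> m else \<mu> (Suc m))"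

lemma hysteresis_in_range: "hysteresis \<eta> \<mu> m \<in> range \<mu>"
  by (induction m) auto

lemma hysteresis_close:
  assumes "0 \<le> \<eta>" "\<And>m. 0 \<le> \<mu> m"
  shows "\<bar>hysteresis \<eta> \<mu> m - \<mu> m\<bar> \<le> \<eta> * \<mu> m"
  using assms by (cases m) (auto simp: abs_minus_commute)

lemma hysteresis_cost:
  fixes \<kappa> \<eta> :: real and \<mu> :: "nat \<Rightarrow> real"
  defines "\<rho> \<equiv> hysteresis \<eta> \<mu>"
  assumes \<mu>: "\<And>m. 0 < \<mu> m" and C: "0 \<le> C"
    and \<kappa>: "\<kappa> > 0" "\<forall>x y. 0 < x \<longrightarrow> 0 < y \<longrightarrow> \<eta> * x < \<bar>x - y\<bar> \<longrightarrow>
      \<kappa> * (x powr a + y powr a) \<le> \<bar>x powr a - y powr a\<bar>"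
    and cost: "\<And>m. D m \<le> (if \<rho> (Suc m) = \<rho> m then 0 else C * (\<rho> (Suc m) powr a + \<rho> m powr a))"
  shows "(\<Sum>m<n. D m) \<le> C / \<kappa> * (\<Sum>m<n. \<bar>\<mu> (Suc m) powr a - \<mu> m powr a\<bar>)"
proof -
  have \<rho>: "0 < \<rho> m" for m
    using hysteresis_in_range[of \<eta> \<mu> m] \<mu> by (auto simp: \<rho>_def)
  \<comment> \<open>The second summand is a potential. It is fed by the variation of
    \<open>\<mu> powr a\<close>, and a jump resets it to \<open>0\<close>, releasing enough to pay
    for \<open>D\<close>.\<close>
  have "(\<Sum>m<n. D m) + C / \<kappa> * \<bar>\<mu> n powr a - \<rho> n powr a\<bar>
      \<le> C / \<kappa> * (\<Sum>m<n. \<bar>\<mu> (Suc m) powr a - \<mu> m powr a\<bar>)"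
  proof (induction n)
    case (Suc n)
    let ?v = "\<bar>\<mu> (Suc n) powr a - \<mu> n powr a\<bar>"
    have "D n + C / \<kappa> * \<bar>\<mu> (Suc n) powr a - \<rho> (Suc n) powr a\<bar>
        \<le> C / \<kappa> * \<bar>\<mu> (Suc n) powr a - \<rho> n powr a\<bar>"
    proof (cases "\<bar>\<mu> (Suc n) - \<rho> n\<bar> \<le> \<eta> * \<mu> (Suc n)")
      case True
      then have "\<rho> (Suc n) = \<rho> n" by (simp add: \<rho>_def)
      with cost[of n] show ?thesis by simp
    next
      case False
      then have eq: "\<rho> (Suc n) = \<mu> (Suc n)" by (simp add: \<rho>_def)
      have "0 \<le> C * (\<rho> (Suc n) powr a + \<rho> n powr a)"
        using C by simp
      then have "D n \<le> C * (\<mu> (Suc n) powr a + \<rho> n powr a)"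
        using cost[of n] eq by (auto split: if_splits)
      also have "\<dots> = C / \<kappa> * (\<kappa> * (\<mu> (Suc n) powr a + \<rho> n powr a))"
        using \<kappa>(1) by simp
      also have "\<dots> \<le> C / \<kappa> * \<bar>\<mu> (Suc n) powr a - \<rho> n powr a\<bar>"
        using False C \<kappa> \<mu> \<rho> by (intro mult_left_mono) (auto simp: not_le)
      finally show ?thesis by (simp add: eq)
    qed
    also have "\<dots> \<le> C / \<kappa> * (?v + \<bar>\<mu> n powr a - \<rho> n powr a\<bar>)"
      using C \<kappa>(1) by (intro mult_left_mono) auto
    finally show ?case
      using Suc by (simp add: distrib_left)
  qed (simp add: \<rho>_def)
  moreover have "0 \<le> C / \<kappa> * \<bar>\<mu> n powr a - \<rho> n powr a\<bar>"
    using C \<kappa>(1) by simp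
  ultimately show ?thesis by linarith
qed

text \<open>Varying rates give index \<open>m\<close> the weight \<open>c m * \<rho> m\<close>.
  Iterating the one-stage inequality leaves at each stage the value for the old rate where that for
  the new one is wanted; the correction carries a factor \<open>c (Suc m) \<le> 1\<close>.\<close>

lemma telescoping_lower_bound:
  fixes \<rho> G :: "nat \<Rightarrow> real" and A :: "real \<Rightarrow> nat \<Rightarrow> real"
  defines "c \<equiv> \<lambda>m. \<Prod>l<m. 1 - \<rho> l"
  assumes \<rho>: "\<And>m. 0 \<le> \<rho> m" "\<And>m. \<rho> m \<le> 1"
    and step: "\<And>m. A (\<rho> m) m \<le> \<rho> m * G m + (1 - \<rho> m) * A (\<rho> m) (Suc m)"
  shows "A (\<rho> 0) 0 - (\<Sum>m<n. \<bar>A (\<rho> (Suc m)) (Suc m) - A (\<rho> m) (Suc m)\<bar>)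
    \<le> (\<Sum>m<n. c m * \<rho> m * G m) + c n * A (\<rho> n) n"
proof (induction n)
  case (Suc n)
  let ?d = "\<bar>A (\<rho> (Suc n)) (Suc n) - A (\<rho> n) (Suc n)\<bar>"
  have c: "0 \<le> c m" "c m \<le> 1" for m
    using \<rho> unfolding c_def by (auto intro!: prod_nonneg prod_le_1)
  have "c n * A (\<rho> n) n \<le> c n * (\<rho> n * G n + (1 - \<rho> n) * A (\<rho> n) (Suc n))"
    by (intro mult_left_mono step c)
  also have "\<dots> = c n * \<rho> n * G n + c (Suc n) * A (\<rho> n) (Suc n)"
    by (simp add: c_def algebra_simps)
  also have "c (Suc n) * A (\<rho> n) (Suc n) \<le> c (Suc n) * A (\<rho> (Suc n)) (Suc n) + ?d"
  proof -
    have "c (Suc n) * (A (\<rho> n) (Suc n) - A (\<rho> (Suc n)) (Suc n)) \<le> c (Suc n) * ?d"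
      by (intro mult_left_mono c) auto
    also have "\<dots> \<le> 1 * ?d"
      by (intro mult_right_mono c) auto
    finally show ?thesis by (simp add: algebra_simps)
  qed
  finally show ?case
    using Suc by simp
qed (simp add: c_def)

text \<open>For the exact rates \<open>w m / R m\<close> the product \<open>c m\<close> is
  \<open>R m\<close>, and index \<open>m\<close> gets the weight \<open>w m\<close>. In general each
  step multiplies the error of \<open>c\<close> by \<open>1 - \<rho> m\<close> and adds at most the
  error of the rate, so it stays within the sum \<open>E\<close> of these errors.\<close>

lemma discounting_approximates_weights:
  fixes w \<rho> :: "nat \<Rightarrow> real"
  defines "c \<equiv> \<lambda>m. \<Prod>l<m. 1 - \<rho> l" and "R \<equiv> \<lambda>m. 1 - (\<Sum>l<m. w l)"
  assumes w: "\<And>m. 0 \<le> w m" and \<rho>: "\<And>m. 0 \<le> \<rho> m" "\<And>m. \<rho> m \<le> 1"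
    and d: "0 < d" "\<And>m. m < n \<Longrightarrow> d \<le> R m" and Rn: "0 \<le> R n"
    and E: "(\<Sum>m<n. \<bar>\<rho> m - w m / R m\<bar>) \<le> E"
  shows "c n \<le> R n + E" "(\<Sum>m<n. \<bar>c m * \<rho> m - w m\<bar>) \<le> E / d + E"
proof -
  have c: "0 \<le> c m" "c m \<le> 1" for m
    using \<rho> unfolding c_def by (auto intro!: prod_nonneg prod_le_1)
  have R1: "R m \<le> 1" for m
    using w by (simp add: R_def sum_nonneg)
  have close: "\<bar>c m - R m\<bar> \<le> (\<Sum>l<m. \<bar>\<rho> l - w l / R l\<bar>)" if "m \<le> n" for m
    using that
  proof (induction m)
    case (Suc m)
    have Rm: "0 < R m" using d(1) d(2)[of m] Suc.prems by simp
    have "c (Suc m) - R (Suc m) = (c m - R m) * (1 - \<rho> m) + R m * (w m / R m - \<rho> m)"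
    proof -
      have "R (Suc m) = R m - w m" "c (Suc m) = c m * (1 - \<rho> m)"
        by (simp_all add: R_def c_def)
      then show ?thesis
        using Rm by (simp add: algebra_simps)
    qed
    also have "\<bar>\<dots>\<bar> \<le> \<bar>c m - R m\<bar> * \<bar>1 - \<rho> m\<bar> + R m * \<bar>\<rho> m - w m / R m\<bar>"
      using Rm abs_triangle_ineq[of "(c m - R m) * (1 - \<rho> m)" "R m * (w m / R m - \<rho> m)"]
      by (simp add: abs_mult abs_minus_commute)
    also have "\<dots> \<le> \<bar>c m - R m\<bar> * 1 + 1 * \<bar>\<rho> m - w m / R m\<bar>"
      using \<rho>[of m] R1[of m] by (intro add_mono mult_left_mono mult_right_mono) auto
    finally show ?case
      using Suc by simp
  qed (simp add: c_def R_def)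
  have E': "\<bar>c m - R m\<bar> \<le> E" if "m \<le> n" for m
  proof -
    have "(\<Sum>l<m. \<bar>\<rho> l - w l / R l\<bar>) \<le> (\<Sum>l<n. \<bar>\<rho> l - w l / R l\<bar>)"
      using that by (intro sum_mono2) auto
    with close[OF that] E show ?thesis by linarith
  qed
  show "c n \<le> R n + E"
    using E'[of n] by linarith
  have "0 \<le> E"
    using E'[of n] by linarith
  have "(\<Sum>m<n. \<bar>c m * \<rho> m - w m\<bar>) \<le> (\<Sum>m<n. E * (w m / d) + \<bar>\<rho> m - w m / R m\<bar>)"
  proof (rule sum_mono)
    fix m assume "m \<in> {..<n}"
    then have m: "m < n" by simp
    have Rm: "d \<le> R m" "0 < R m" using d(1) d(2)[OF m] by auto
    have "c m * \<rho> m - w m = (c m - R m) * (w m / R m) + c m * (\<rho> m - w m / R m)"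
      using Rm by (simp add: field_simps)
    also have "\<bar>\<dots>\<bar> \<le> \<bar>c m - R m\<bar> * (w m / R m) + c m * \<bar>\<rho> m - w m / R m\<bar>"
      using Rm w[of m] c(1)[of m] abs_triangle_ineq[of "(c m - R m) * (w m / R m)" "c m * (\<rho> m - w m / R m)"]
      by (simp add: abs_mult)
    also have "\<dots> \<le> E * (w m / d) + 1 * \<bar>\<rho> m - w m / R m\<bar>"
      using Rm w[of m] c[of m] E'[of m] m d(1) \<open>0 \<le> E\<close>
      by (intro add_mono mult_mono frac_le) auto
    finally show "\<bar>c m * \<rho> m - w m\<bar> \<le> E * (w m / d) + \<bar>\<rho> m - w m / R m\<bar>"
      by simp
  qed
  also have "\<dots> = E / d * (\<Sum>m<n. w m) + (\<Sum>m<n. \<bar>\<rho> m - w m / R m\<bar>)"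
    by (simp add: sum.distrib sum_distrib_left)
  also have "\<dots> \<le> E / d * 1 + E"
    using \<open>0 \<le> E\<close> d(1) Rn E by (intro add_mono mult_left_mono) (auto simp: R_def)
  finally show "(\<Sum>m<n. \<bar>c m * \<rho> m - w m\<bar>) \<le> E / d + E" by simp
qed

text \<open>The product rule for variations; the monotone factor \<open>T\<close> has variation at
  most \<open>L\<close>.\<close>

lemma product_variation_bound:
  fixes W T :: "nat \<Rightarrow> real"
  assumes W: "\<And>m. 0 \<le> W m" "\<And>m. W m \<le> e" and V: "(\<Sum>m<n. \<bar>W (Suc m) - W m\<bar>) \<le> e"
    and T: "\<And>m. 0 \<le> T m" "\<And>m. T m \<le> L" "incseq T"
  shows "(\<Sum>m<n. \<bar>W (Suc m) * T (Suc m) - W m * T m\<bar>) \<le> 2 * e * L"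
proof -
  have L: "0 \<le> L" using T(1,2)[of 0] by linarith
  have e: "0 \<le> e" using W[of 0] by linarith
  have "(\<Sum>m<n. \<bar>W (Suc m) * T (Suc m) - W m * T m\<bar>)
      \<le> (\<Sum>m<n. L * \<bar>W (Suc m) - W m\<bar> + e * (T (Suc m) - T m))"
  proof (rule sum_mono)
    fix m
    have inc: "0 \<le> T (Suc m) - T m"
      using T(3) by (simp add: incseq_Suc_iff)
    have "W (Suc m) * T (Suc m) - W m * T m = T (Suc m) * (W (Suc m) - W m) + W m * (T (Suc m) - T m)"
      by (simp add: algebra_simps)
    also have "\<bar>\<dots>\<bar> \<le> T (Suc m) * \<bar>W (Suc m) - W m\<bar> + W m * (T (Suc m) - T m)"
      using T(1)[of "Suc m"] W(1)[of m] inc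
        abs_triangle_ineq[of "T (Suc m) * (W (Suc m) - W m)" "W m * (T (Suc m) - T m)"]
      by (simp add: abs_mult)
    also have "\<dots> \<le> L * \<bar>W (Suc m) - W m\<bar> + e * (T (Suc m) - T m)"
      using T W inc by (intro add_mono mult_right_mono) auto
    finally show "\<bar>W (Suc m) * T (Suc m) - W m * T m\<bar> \<le> L * \<bar>W (Suc m) - W m\<bar> + e * (T (Suc m) - T m)" .
  qed
  also have "\<dots> = L * (\<Sum>m<n. \<bar>W (Suc m) - W m\<bar>) + e * (T n - T 0)"
    by (simp add: sum.distrib sum_lessThan_telescope flip: sum_distrib_left)
  also have "\<dots> \<le> L * e + e * L"
    using V T(1)[of 0] T(2)[of n] L e by (intro add_mono mult_left_mono) auto
  finally show ?thesis by (simp add: algebra_simps)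
qed

text \<open>The increments from \<open>m\<close> on sum to \<open>- u m\<close>. Applied to
  \<open>w powr a\<close>, this makes every single weight small.\<close>

lemma variation_bounds_sup:
  fixes u :: "nat \<Rightarrow> real"
  assumes "u \<longlonglongrightarrow> 0" "\<And>n. (\<Sum>m<n. \<bar>u (Suc m) - u m\<bar>) \<le> e"
  shows "u m \<le> e"
proof -
  have "u m - u n \<le> e" if "m \<le> n" for n
  proof -
    have "u m - u n \<le> (\<Sum>l=m..<n. \<bar>u (Suc l) - u l\<bar>)"
      using that sum_abs[of "\<lambda>l. u (Suc l) - u l" "{m..<n}"] by (simp add: sum_Suc_diff')
    also have "\<dots> \<le> (\<Sum>l<n. \<bar>u (Suc l) - u l\<bar>)"
      by (intro sum_mono2) auto
    also have "\<dots> \<le> e" by (rule assms)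
    finally show ?thesis .
  qed
  then have "u m - 0 \<le> e"
    using assms(1) by (intro tendsto_upperbound[OF tendsto_diff[OF tendsto_const[of "u m"] assms(1)]])
      (auto simp: eventually_sequentially)
  then show ?thesis by simp
qed

text \<open>\<open>d\<close> is the tail weight at which the comparison stops, \<open>n\<close> the
  stopping index, and \<open>t\<close> the floor under the weights. The tolerance
  \<open>d ^ 3\<close> leads to total rate errors \<open>3 * d ^ 2\<close>; these cost
  \<open>6 * d\<close> in the payoffs, partly after a division by \<open>d\<close>, and what remains
  after \<open>n\<close> costs \<open>4 * d\<close>: hence \<open>10 * d\<close>. In the last term
  \<open>e * d powr - a\<close> bounds the \<open>a\<close>-th powers of the rates,
  \<open>2 / \<kappa>\<close> stems from the jumps and \<open>1\<close> from the start. The rates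
  are treated apart from the estimate because the strategies are built from them.\<close>

lemma
  fixes w G :: "nat \<Rightarrow> real" and A :: "real \<Rightarrow> nat \<Rightarrow> real" and B :: "nat \<Rightarrow> real"
    and a C d e l\<^sub>0 t :: real and n :: nat
  defines "R \<equiv> \<lambda>m. 1 - (\<Sum>l<m. w l)"
  defines "\<mu> \<equiv> \<lambda>m. max (w m) t / max (R m) d"
  defines "\<rho> \<equiv> hysteresis (d ^ 3) \<mu>"
  assumes w: "\<And>m. 0 \<le> w m" "w sums 1"
    and a: "0 < a" and C: "0 \<le> C" and d: "0 < d" "d < 1" and l\<^sub>0: "0 < l\<^sub>0" "l\<^sub>0 \<le> 1" and t: "0 < t"
    and n: "\<forall>m<n. d \<le> R m" "R n \<le> d"
    and small: "real n * t \<le> d ^ 3" "t powr a \<le> e" "e \<le> (l\<^sub>0 * d) powr a"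
    and \<kappa>: "\<kappa> > 0" "\<forall>x y. 0 < x \<longrightarrow> 0 < y \<longrightarrow> d ^ 3 * x < \<bar>x - y\<bar> \<longrightarrow>
        \<kappa> * (x powr a + y powr a) \<le> \<bar>x powr a - y powr a\<bar>"
    and V: "\<And>n. (\<Sum>m<n. \<bar>w (Suc m) powr a - w m powr a\<bar>) \<le> e"
  shows weighted_sum_rates: "0 < \<rho> m" "\<rho> m \<le> l\<^sub>0"
    and weighted_sum_estimate: "\<lbrakk>\<forall>m. G m \<in> {0..1}; \<forall>l m. 0 < l \<longrightarrow> l \<le> l\<^sub>0 \<longrightarrow> A l m \<in> {0..1};
        \<forall>l m. 0 < l \<longrightarrow> l \<le> l\<^sub>0 \<longrightarrow> \<bar>A l m - B m\<bar> \<le> C * l powr a;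
        \<forall>m. A (\<rho> m) m \<le> \<rho> m * G m + (1 - \<rho> m) * A (\<rho> m) (Suc m)\<rbrakk> \<Longrightarrow>
      B 0 - 10 * d - C * (2 / \<kappa> + 1) * (e * d powr - a) \<le> (\<Sum>m. w m * G m)"
proof -
  have sum_le: "(\<Sum>l<m. w l) \<le> 1" for m
    using sum_le_suminf[OF sums_summable[OF w(2)], of "{..<m}"] w sums_unique[OF w(2)] by auto
  have R: "0 \<le> R m" "R m \<le> 1" "R (Suc m) \<le> R m" for m
    using sum_le[of m] w(1) by (auto simp: R_def sum_nonneg)
  have "(\<lambda>m. w m powr a) \<longlonglongrightarrow> 0"
    using summable_LIMSEQ_zero[OF sums_summable[OF w(2)]] w(1) a by (intro tendsto_zero_powrI[of _ _ _ a]) auto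
  then have w_le: "w m powr a \<le> e" for m
    by (rule variation_bounds_sup) (rule V)
  have max_powr: "max (w m) t powr a = max (w m powr a) (t powr a)" for m
    using w(1)[of m] t a by (auto simp: max_def powr_mono2 intro: antisym)
  then have max_le: "max (w m) t powr a \<le> e" for m
    using w_le small by simp
  have \<mu>_pos: "0 < \<mu> m" for m
    using t d by (simp add: \<mu>_def)
  have \<mu>_le: "\<mu> m \<le> l\<^sub>0" for m
  proof -
    have "max (w m) t \<le> l\<^sub>0 * d"
    proof (rule ccontr)
      assume "\<not> ?thesis"
      then have "(l\<^sub>0 * d) powr a < max (w m) t powr a"
        using l\<^sub>0 d a by (intro powr_less_mono2) auto
      then show False
        using max_le[of m] small by linarith
    qed
    also have "\<dots> \<le> l\<^sub>0 * max (R m) d"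
      using l\<^sub>0 by (intro mult_left_mono) auto
    finally show ?thesis
      using d by (simp add: \<mu>_def divide_le_eq)
  qed
  show \<rho>: "0 < \<rho> m" "\<rho> m \<le> l\<^sub>0" for m
    using hysteresis_in_range[of "d ^ 3" \<mu> m] \<mu>_pos \<mu>_le by (auto simp: \<rho>_def)
  have \<rho>1: "0 \<le> \<rho> m" "\<rho> m \<le> 1" for m
    using \<rho>[of m] l\<^sub>0 by auto
  assume *: "\<forall>m. G m \<in> {0..1}" "\<forall>l m. 0 < l \<longrightarrow> l \<le> l\<^sub>0 \<longrightarrow> A l m \<in> {0..1}"
    "\<forall>l m. 0 < l \<longrightarrow> l \<le> l\<^sub>0 \<longrightarrow> \<bar>A l m - B m\<bar> \<le> C * l powr a"
    "\<forall>m. A (\<rho> m) m \<le> \<rho> m * G m + (1 - \<rho> m) * A (\<rho> m) (Suc m)"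
  have G: "G m \<in> {0..1}" and step: "A (\<rho> m) m \<le> \<rho> m * G m + (1 - \<rho> m) * A (\<rho> m) (Suc m)" for m
    using * by blast+
  have A: "A l m \<in> {0..1}" and AB: "\<bar>A l m - B m\<bar> \<le> C * l powr a" if "0 < l" "l \<le> l\<^sub>0" for l m
    using * that by blast+
  have \<mu>_powr: "\<mu> m powr a = max (w m) t powr a * max (R m) d powr - a" for m
    using t d by (simp add: \<mu>_def powr_divide powr_minus_divide)
  have T: "max (R m) d powr - a \<le> d powr - a" for m
    using d a by (intro powr_mono2') auto
  have var: "(\<Sum>m<n. \<bar>\<mu> (Suc m) powr a - \<mu> m powr a\<bar>) \<le> 2 * e * d powr - a"
    unfolding \<mu>_powr
  proof (rule product_variation_bound[OF _ max_le])
    \<comment> \<open>Raising the weights to the floor \<open>t\<close> does not increase the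
      variation.\<close>
    have "(\<Sum>m<n. \<bar>max (w (Suc m)) t powr a - max (w m) t powr a\<bar>)
        \<le> (\<Sum>m<n. \<bar>w (Suc m) powr a - w m powr a\<bar>)"
      unfolding max_powr by (intro sum_mono) (auto simp: max_def)
    then show "(\<Sum>m<n. \<bar>max (w (Suc m)) t powr a - max (w m) t powr a\<bar>) \<le> e"
      using V[of n] by linarith
    show "incseq (\<lambda>m. max (R m) d powr - a)"
      using R(3) d a by (intro incseq_SucI powr_mono2' max.mono) auto
  qed (use T order_trans[OF powr_ge_zero small(2)] in auto)
  define D where "D m = \<bar>A (\<rho> (Suc m)) (Suc m) - A (\<rho> m) (Suc m)\<bar>" for m
  \<comment> \<open>All that is known about the values at two rates is their distance to the limit
    \<open>B\<close>; only at a jump is this bound used.\<close>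
  have D: "D m \<le> C * (\<rho> (Suc m) powr a + \<rho> m powr a)" for m
    using AB[OF \<rho>(1,2), of "Suc m" "Suc m"] AB[OF \<rho>(1,2), of m "Suc m"] unfolding D_def distrib_left by linarith
  have "D m \<le> (if \<rho> (Suc m) = \<rho> m then 0 else C * (\<rho> (Suc m) powr a + \<rho> m powr a))" for m
    using D[of m] by (simp add: D_def)
  then have "(\<Sum>m<n. D m) \<le> C / \<kappa> * (\<Sum>m<n. \<bar>\<mu> (Suc m) powr a - \<mu> m powr a\<bar>)"
    unfolding \<rho>_def by (rule hysteresis_cost[where \<mu> = \<mu> and D = D, OF \<mu>_pos C \<kappa>])
  also have "\<dots> \<le> C / \<kappa> * (2 * e * d powr - a)"
    using C \<kappa>(1) by (intro mult_left_mono var) auto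
  finally have cost: "(\<Sum>m<n. D m) \<le> C * (2 / \<kappa>) * (e * d powr - a)"
    by simp
  have "\<rho> 0 powr a \<le> e * d powr - a"
    unfolding \<rho>_def hysteresis.simps \<mu>_powr
    using T max_le order_trans[OF powr_ge_zero small(2)] by (intro mult_mono) auto
  then have "C * \<rho> 0 powr a \<le> C * (e * d powr - a)"
    using C by (rule mult_left_mono)
  then have start: "B 0 - C * (e * d powr - a) \<le> A (\<rho> 0) 0"
    using AB[OF \<rho>(1,2), of 0 0] by linarith
  have near: "\<bar>\<rho> m - w m / R m\<bar> \<le> (d ^ 3 * w m + 2 * t) / d" if "m < n" for m
  proof -
    have Rm: "d \<le> R m" "0 < R m" using n(1) that d by auto
    have wt: "max (w m) t \<le> w m + t" "\<bar>max (w m) t - w m\<bar> \<le> t"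
      using w(1)[of m] t by auto
    have \<mu>: "\<mu> m = max (w m) t / R m"
      using Rm by (simp add: \<mu>_def max_def)
    have "\<bar>\<rho> m - \<mu> m\<bar> \<le> d ^ 3 * \<mu> m"
      unfolding \<rho>_def by (rule hysteresis_close) (use d \<mu>_pos in \<open>auto intro: less_imp_le\<close>)
    also have "\<dots> \<le> d ^ 3 * ((w m + t) / d)"
      unfolding \<mu> using wt(1) Rm d t w(1)[of m] by (intro mult_left_mono frac_le) auto
    finally have "\<bar>\<rho> m - \<mu> m\<bar> \<le> d ^ 3 * ((w m + t) / d)" .
    moreover have "\<bar>\<mu> m - w m / R m\<bar> = \<bar>max (w m) t - w m\<bar> / R m"
      using Rm unfolding \<mu> by (simp flip: diff_divide_distrib)
    then have "\<bar>\<mu> m - w m / R m\<bar> \<le> t / d"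
      using wt(2) Rm d t by (simp add: frac_le)
    moreover have "\<bar>\<rho> m - w m / R m\<bar> \<le> \<bar>\<rho> m - \<mu> m\<bar> + \<bar>\<mu> m - w m / R m\<bar>"
      by (rule order_trans[OF _ abs_triangle_ineq]) simp
    ultimately have "\<bar>\<rho> m - w m / R m\<bar> \<le> d ^ 3 * ((w m + t) / d) + t / d"
      by (meson add_mono order_trans)
    also have "\<dots> \<le> (d ^ 3 * w m + 2 * t) / d"
    proof -
      have "d ^ 3 * t \<le> 1 * t"
        using d t by (intro mult_right_mono power_le_one) auto
      then show ?thesis
        using d by (simp add: field_simps)
    qed
    finally show ?thesis .
  qed
  have "(\<Sum>m<n. \<bar>\<rho> m - w m / R m\<bar>) \<le> (\<Sum>m<n. (d ^ 3 * w m + 2 * t) / d)"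
    by (intro sum_mono near) auto
  also have "\<dots> = (d ^ 3 * (\<Sum>m<n. w m) + 2 * (real n * t)) / d"
    by (simp add: sum.distrib sum_distrib_left sum_divide_distrib add_divide_distrib)
  also have "\<dots> \<le> (d ^ 3 * 1 + 2 * d ^ 3) / d"
    using d small sum_le[of n] by (intro divide_right_mono add_mono mult_left_mono) auto
  also have "\<dots> = 3 * d ^ 2"
    using d by (simp add: power3_eq_cube power2_eq_square)
  finally have E: "(\<Sum>m<n. \<bar>\<rho> m - w m / R m\<bar>) \<le> 3 * d ^ 2" .
  define c where "c m = (\<Prod>l<m. 1 - \<rho> l)" for m
  have approx: "c n \<le> R n + 3 * d ^ 2" "(\<Sum>m<n. \<bar>c m * \<rho> m - w m\<bar>) \<le> 3 * d ^ 2 / d + 3 * d ^ 2"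
    unfolding c_def R_def
    by (rule discounting_approximates_weights[OF w(1) \<rho>1 d(1)]; use n(1) R(1) E in \<open>simp add: R_def\<close>)+
  have d2: "d ^ 2 \<le> d" "3 * d ^ 2 / d = 3 * d"
    using d by (auto simp: power2_eq_square mult_left_le_one_le)
  have "c n * A (\<rho> n) n \<le> c n * 1"
    using A[OF \<rho>(1,2)] \<rho>1 unfolding c_def by (intro mult_left_mono prod_nonneg) auto
  then have "c n * A (\<rho> n) n \<le> 4 * d"
    using approx(1) n(2) d2 by linarith
  moreover have "A (\<rho> 0) 0 - (\<Sum>m<n. D m) \<le> (\<Sum>m<n. c m * \<rho> m * G m) + c n * A (\<rho> n) n"
    unfolding D_def c_def by (rule telescoping_lower_bound[where \<rho> = \<rho> and A = A and G = G, OF \<rho>1 step])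
  moreover have "(\<Sum>m<n. c m * \<rho> m * G m) \<le> (\<Sum>m<n. w m * G m) + 6 * d"
  proof -
    have "(\<Sum>m<n. c m * \<rho> m * G m) - (\<Sum>m<n. w m * G m) = (\<Sum>m<n. (c m * \<rho> m - w m) * G m)"
      by (simp add: left_diff_distrib sum_subtractf)
    also have "\<dots> \<le> (\<Sum>m<n. \<bar>c m * \<rho> m - w m\<bar>)"
    proof (rule sum_mono)
      fix m
      have "(c m * \<rho> m - w m) * G m \<le> \<bar>c m * \<rho> m - w m\<bar> * G m"
        using G[of m] by (intro mult_right_mono) auto
      also have "\<dots> \<le> \<bar>c m * \<rho> m - w m\<bar> * 1"
        using G[of m] by (intro mult_left_mono) auto
      finally show "(c m * \<rho> m - w m) * G m \<le> \<bar>c m * \<rho> m - w m\<bar>" by simp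
    qed
    finally show ?thesis
      using approx(2) d2 by linarith
  qed
  moreover have "(\<Sum>m<n. w m * G m) \<le> (\<Sum>m. w m * G m)"
  proof (rule sum_le_suminf)
    show "summable (\<lambda>m. w m * G m)"
      using w(1) G by (intro summable_comparison_test'[OF sums_summable[OF w(2)]])
        (auto simp: abs_mult mult_left_le)
  qed (use w(1) G in auto)
  ultimately show "B 0 - 10 * d - C * (2 / \<kappa> + 1) * (e * d powr - a) \<le> (\<Sum>m. w m * G m)"
    using start cost by (simp add: algebra_simps)
qed

text \<open>
  Here \<open>A l m\<close> stands for the expectation of the \<open>l\<close>-discounted value at stage \<open>m\<close>, \<open>B m\<close> for
  that of the limit value and \<open>G m\<close> for the expected payoff.
\<close>

theorem weighted_sum_lower_bound:
  fixes a C l\<^sub>0 \<epsilon> :: real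
  assumes a: "0 < a" and C: "0 \<le> C" and l\<^sub>0: "0 < l\<^sub>0" "l\<^sub>0 \<le> 1" and \<epsilon>: "0 < \<epsilon>"
  obtains e where "0 < e"
    "\<And>w. (\<And>m. 0 \<le> w m) \<Longrightarrow> w sums 1 \<Longrightarrow> (\<And>n. (\<Sum>m<n. \<bar>w (Suc m) powr a - w m powr a\<bar>) \<le> e) \<Longrightarrow>
      \<exists>\<rho>. (\<forall>m. 0 < \<rho> m \<and> \<rho> m \<le> l\<^sub>0) \<and>
        (\<forall>G A B. (\<forall>m. G m \<in> {0..1}) \<longrightarrow> (\<forall>l m. 0 < l \<longrightarrow> l \<le> l\<^sub>0 \<longrightarrow> A l m \<in> {0..1}) \<longrightarrow>
          (\<forall>l m. 0 < l \<longrightarrow> l \<le> l\<^sub>0 \<longrightarrow> \<bar>A l m - B m\<bar> \<le> C * l powr a) \<longrightarrow>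
          (\<forall>m. A (\<rho> m) m \<le> \<rho> m * G m + (1 - \<rho> m) * A (\<rho> m) (Suc m)) \<longrightarrow>
          B 0 - \<epsilon> \<le> (\<Sum>m. w m * G m))"
proof -
  \<comment> \<open>\<open>10 * d\<close> comes from \<open>weighted_sum_estimate\<close>, one more
    \<open>d\<close> from its variation term.\<close>
  define d where "d = min (1 / 2) (\<epsilon> / 11)"
  have d: "0 < d" "d < 1" "11 * d \<le> \<epsilon>"
    using \<epsilon> by (auto simp: d_def)
  have "0 < d ^ 3" "d ^ 3 < 1"
    using d by (auto simp: power_less_one_iff)
  from powr_relative_gap[OF a this] obtain \<kappa> where \<kappa>: "\<kappa> > 0"
    "\<forall>x y. 0 < x \<longrightarrow> 0 < y \<longrightarrow> d ^ 3 * x < \<bar>x - y\<bar> \<longrightarrow> \<kappa> * (x powr a + y powr a) \<le> \<bar>x powr a - y powr a\<bar>"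
    by blast
  define L where "L = C * (2 / \<kappa> + 1)"
  have L: "0 \<le> L" using C \<kappa> by (simp add: L_def)
  \<comment> \<open>The first entry keeps the rates below \<open>l\<^sub>0\<close>, the second makes
    the variation term at most \<open>d\<close>; \<open>L + 1\<close> is positive even for
    \<open>C = 0\<close>. Nothing here depends on \<open>w\<close>.\<close>
  define e where "e = min ((l\<^sub>0 * d) powr a) (d * d powr a / (L + 1))"
  have e: "0 < e" "e \<le> (l\<^sub>0 * d) powr a"
    using l\<^sub>0 d L by (auto simp: e_def)
  have "L * (e * d powr - a) \<le> (L + 1) * (d * d powr a / (L + 1) * d powr - a)"
    using L d e by (intro mult_mono) (auto simp: e_def)
  also have "\<dots> = d"
    using L d by (simp add: powr_minus field_simps)
  finally have Le: "L * (e * d powr - a) \<le> d" .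
  show ?thesis
  proof (rule that[OF e(1)])
    fix w :: "nat \<Rightarrow> real"
    assume w: "\<And>m. 0 \<le> w m" "w sums 1" and V: "\<And>n. (\<Sum>m<n. \<bar>w (Suc m) powr a - w m powr a\<bar>) \<le> e"
    define R where "R m = 1 - (\<Sum>l<m. w l)" for m
    have "R \<longlonglongrightarrow> 1 - 1"
      using w(2) unfolding R_def sums_def by (intro tendsto_intros)
    then have "\<forall>\<^sub>F m in sequentially. R m < d"
      using d by (intro order_tendstoD) auto
    then have ex: "\<exists>n. R n < d"
      by (auto simp: eventually_sequentially)
    define n where "n = (LEAST n. R n < d)"
    have "R n < d"
      unfolding n_def by (rule LeastI_ex[OF ex])
    moreover have "\<not> R m < d" if "m < n" for m
      using that unfolding n_def by (rule not_less_Least)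
    ultimately have n: "R n \<le> d" "\<forall>m<n. d \<le> R m"
      by (simp_all add: not_less)
    \<comment> \<open>The stopping index depends on \<open>w\<close>, and the floor is chosen after
      it, so that the \<open>n\<close> added amounts total at most \<open>d ^ 3\<close>.\<close>
    define t where "t = min (e powr (1 / a)) (d ^ 3 / (real n + 1))"
    have t: "0 < t" "real n * t \<le> d ^ 3" "t powr a \<le> e"
    proof -
      show "0 < t" using e d by (simp add: t_def)
      have "real n * t \<le> (real n + 1) * (d ^ 3 / (real n + 1))"
        using \<open>0 < t\<close> by (intro mult_mono) (auto simp: t_def)
      then show "real n * t \<le> d ^ 3" by simp
      have "t powr a \<le> (e powr (1 / a)) powr a"
        using \<open>0 < t\<close> a by (intro powr_mono2) (auto simp: t_def)
      then show "t powr a \<le> e" using a e by (simp add: powr_powr)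
    qed
    note aux = a C d(1,2) l\<^sub>0 t(1) n(2)[unfolded R_def] n(1)[unfolded R_def] t(2,3) e(2) \<kappa> V
    define \<rho> where "\<rho> = hysteresis (d ^ 3) (\<lambda>m. max (w m) t / max (1 - (\<Sum>l<m. w l)) d)"
    show "\<exists>\<rho>. (\<forall>m. 0 < \<rho> m \<and> \<rho> m \<le> l\<^sub>0) \<and>
        (\<forall>G A B. (\<forall>m. G m \<in> {0..1}) \<longrightarrow> (\<forall>l m. 0 < l \<longrightarrow> l \<le> l\<^sub>0 \<longrightarrow> A l m \<in> {0..1}) \<longrightarrow>
          (\<forall>l m. 0 < l \<longrightarrow> l \<le> l\<^sub>0 \<longrightarrow> \<bar>A l m - B m\<bar> \<le> C * l powr a) \<longrightarrow>
          (\<forall>m. A (\<rho> m) m \<le> \<rho> m * G m + (1 - \<rho> m) * A (\<rho> m) (Suc m)) \<longrightarrow>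
          B 0 - \<epsilon> \<le> (\<Sum>m. w m * G m))"
    proof (intro exI[of _ \<rho>] conjI allI impI)
      show "0 < \<rho> m" "\<rho> m \<le> l\<^sub>0" for m
        unfolding \<rho>_def by (rule weighted_sum_rates[OF w aux])+
      fix G A B
      assume asm: "\<forall>m. G m \<in> {0..1}" "\<forall>l m. 0 < l \<longrightarrow> l \<le> l\<^sub>0 \<longrightarrow> A l m \<in> {0..1}"
        "\<forall>l m. 0 < l \<longrightarrow> l \<le> l\<^sub>0 \<longrightarrow> \<bar>A l m - B m\<bar> \<le> C * l powr a"
        "\<forall>m. A (\<rho> m) m \<le> \<rho> m * G m + (1 - \<rho> m) * A (\<rho> m) (Suc m)"
      have "B 0 - 10 * d - L * (e * d powr - a) \<le> (\<Sum>m. w m * G m)"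
        unfolding L_def by (rule weighted_sum_estimate[OF w aux asm[unfolded \<rho>_def]])
      with Le d(3) show "B 0 - \<epsilon> \<le> (\<Sum>m. w m * G m)" by linarith
    qed
  qed
qed

section \<open>Convergence of the weighted values\<close>

text \<open>A nearly optimal strategy of the uniform game is played against the opponent's optimal
  stationary strategy for rate \<open>l\<close>: the discounted payoff is at most
  \<open>V l k\<^sub>1\<close> and, by Abel summation, hardly below the uniform guarantee.
  Exchanging the players gives the other bound.\<close>

lemma discounted_value_tendsto_uniform_value:
  fixes g :: "'k::finite \<Rightarrow> 'i::finite \<Rightarrow> 'j::finite \<Rightarrow> real" and V :: "real \<Rightarrow> 'k \<Rightarrow> real"
    and X :: "real \<Rightarrow> 'k \<Rightarrow> 'i pmf" and Y :: "real \<Rightarrow> 'k \<Rightarrow> 'j pmf"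
  assumes g: "\<And>k i j. g k i j \<in> {0..1}" and unif: "is_uniform_value g q v"
    and sol: "\<And>l. 0 < l \<Longrightarrow> l \<le> 1 \<Longrightarrow> discounted_solution g q l (V l) (X l) (Y l)"
  shows "((\<lambda>l. V l k\<^sub>1) \<longlongrightarrow> v k\<^sub>1) (at_right 0)"
proof (rule tendstoI)
  fix \<epsilon> :: real
  assume "0 < \<epsilon>"
  then have "0 < \<epsilon> / 2" by simp
  with unif obtain \<sigma>' \<tau>' N where N: "N \<ge> 1"
    and opt: "\<And>n \<tau>. n \<ge> N \<Longrightarrow> v k\<^sub>1 - \<epsilon> / 2 \<le> expected_payoff g q (uniform_weights n) k\<^sub>1 \<sigma>' \<tau>"
      "\<And>n \<sigma>. n \<ge> N \<Longrightarrow> expected_payoff g q (uniform_weights n) k\<^sub>1 \<sigma> \<tau>' \<le> v k\<^sub>1 + \<epsilon> / 2"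
    unfolding is_uniform_value_def by meson
  have payoff01: "expected_payoff g q (uniform_weights N) k\<^sub>1 \<sigma> \<tau> \<in> {0..1}" for \<sigma> \<tau>
    by (rule expected_payoff_bounded[where g = g, OF uniform_weights_stage_weights[OF N] g])
  have lower: "v k\<^sub>1 - \<epsilon> / 2 - l * N \<le> V l k\<^sub>1" if l: "0 < l" "l \<le> 1" for l :: real
  proof -
    let ?\<tau> = "\<lambda>(h, k). Y l k"
    let ?G = "stage_payoff g q k\<^sub>1 \<sigma>' ?\<tau>" and ?A = "state_expectation q k\<^sub>1 \<sigma>' ?\<tau> (V l)"
    have A01: "?A m \<in> {0..1}" for m
      by (rule state_expectation_bounded) (use sol[OF l] in \<open>simp add: discounted_solution_def\<close>)
    have "v k\<^sub>1 - \<epsilon> / 2 - l * N \<le> ?A 0"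
    proof (rule discounted_ge_of_uniform[OF l])
      show "0 \<le> ?G m" for m
        using stage_payoff_bounded[where g = g, OF g] by auto
      show "0 \<le> ?A m" for m
        using A01[of m] by simp
      show "l * ?G m + (1 - l) * ?A (Suc m) \<le> ?A m" for m
        using sol[OF l] by (intro stage_upper_bound[where y = "Y l"]) (auto simp: discounted_solution_def)
      show "v k\<^sub>1 - \<epsilon> / 2 \<le> 1"
        using opt(1)[of N ?\<tau>] payoff01[of \<sigma>' ?\<tau>] by auto
      show "n * (v k\<^sub>1 - \<epsilon> / 2) \<le> (\<Sum>m<n. ?G m)" if "N \<le> n" for n
        using opt(1)[OF that, of ?\<tau>] expected_payoff_uniform[where g = g and n = n, OF _ g] N that
        by (simp add: pos_le_divide_eq mult.commute)
    qed
    then show ?thesis by (simp add: state_expectation_0)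
  qed
  have upper: "V l k\<^sub>1 \<le> v k\<^sub>1 + \<epsilon> / 2 + l * N" if l: "0 < l" "l \<le> 1" for l :: real
  proof -
    let ?\<sigma> = "\<lambda>(h, k). X l k"
    let ?G = "stage_payoff g q k\<^sub>1 ?\<sigma> \<tau>'" and ?A = "state_expectation q k\<^sub>1 ?\<sigma> \<tau>' (V l)"
    have A01: "?A m \<in> {0..1}" for m
      by (rule state_expectation_bounded) (use sol[OF l] in \<open>simp add: discounted_solution_def\<close>)
    have "1 - (v k\<^sub>1 + \<epsilon> / 2) - l * N \<le> 1 - ?A 0"
    \<comment> \<open>For Player 2 the same estimate is applied to the payoffs and values subtracted
      from \<open>1\<close>.\<close>
    proof (rule discounted_ge_of_uniform[OF l, where G = "\<lambda>m. 1 - ?G m" and A = "\<lambda>m. 1 - ?A m"])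
      show "0 \<le> 1 - ?G m" for m
        using stage_payoff_bounded[where g = g, OF g] by auto
      show "0 \<le> 1 - ?A m" for m
        using A01[of m] by simp
      have "?A m \<le> l * ?G m + (1 - l) * ?A (Suc m)" for m
        using sol[OF l] by (intro stage_lower_bound[where x = "X l"]) (auto simp: discounted_solution_def)
      then show "l * (1 - ?G m) + (1 - l) * (1 - ?A (Suc m)) \<le> 1 - ?A m" for m
        by (simp add: algebra_simps)
      show "1 - (v k\<^sub>1 + \<epsilon> / 2) \<le> 1"
        using opt(2)[of N ?\<sigma>] payoff01[of ?\<sigma> \<tau>'] by auto
      show "n * (1 - (v k\<^sub>1 + \<epsilon> / 2)) \<le> (\<Sum>m<n. 1 - ?G m)" if "N \<le> n" for n
      proof -
        have "(\<Sum>m<n. ?G m) \<le> (v k\<^sub>1 + \<epsilon> / 2) * n"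
          using opt(2)[OF that, of ?\<sigma>] expected_payoff_uniform[where g = g and n = n, OF _ g] N that
          by (simp add: pos_divide_le_eq)
        then show ?thesis by (simp add: sum_subtractf algebra_simps)
      qed
    qed
    then show ?thesis by (simp add: state_expectation_0)
  qed
  have "0 < min 1 (\<epsilon> / 2 / N)"
    using N \<open>0 < \<epsilon>\<close> by simp
  from eventually_at_right_real[OF this]
  show "\<forall>\<^sub>F l in at_right 0. dist (V l k\<^sub>1) (v k\<^sub>1) < \<epsilon>"
  proof eventually_elim
    case (elim l)
    then have l: "0 < l" "l \<le> 1" and "l * N < \<epsilon> / 2"
      using N by (auto simp: pos_less_divide_eq)
    with lower[OF l] upper[OF l] show ?case
      unfolding dist_real_def by linarith
  qed
qed

text \<open>Guarantees of the two players sandwich both iterated optima, so one pair of strategies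
  yields both limits.\<close>

lemma values_between:
  assumes "\<pi> \<in> stage_weights" and g: "\<And>k i j. g k i j \<in> {0..1}"
    and lower: "\<And>\<tau>. c \<le> expected_payoff g q \<pi> k\<^sub>1 \<sigma>' \<tau>" and upper: "\<And>\<sigma>. expected_payoff g q \<pi> k\<^sub>1 \<sigma> \<tau>' \<le> d"
  shows "maxmin_value g q \<pi> k\<^sub>1 \<in> {c..d}" "minmax_value g q \<pi> k\<^sub>1 \<in> {c..d}"
proof -
  let ?E = "expected_payoff g q \<pi> k\<^sub>1"
  have E: "0 \<le> ?E \<sigma> \<tau>" "?E \<sigma> \<tau> \<le> 1" for \<sigma> \<tau>
    using expected_payoff_bounded[where g = g, OF assms(1,2)] by auto
  have bdd_E: "bdd_below (range (\<lambda>\<tau>. ?E \<sigma> \<tau>))" "bdd_above (range (\<lambda>\<sigma>. ?E \<sigma> \<tau>))" for \<sigma> \<tau>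
    using E by (auto intro: bdd_belowI2[where m = 0] bdd_aboveI2[where M = 1])
  have inf_le: "(INF \<tau>. ?E \<sigma> \<tau>) \<le> ?E \<sigma> \<tau>" and le_sup: "?E \<sigma> \<tau> \<le> (SUP \<sigma>. ?E \<sigma> \<tau>)" for \<sigma> \<tau>
    using bdd_E by (auto intro: cINF_lower cSUP_upper)
  have "bdd_above (range (\<lambda>\<sigma>. INF \<tau>. ?E \<sigma> \<tau>))"
    using order_trans[OF inf_le E(2)] by (intro bdd_aboveI2[where M = 1])
  then have "c \<le> maxmin_value g q \<pi> k\<^sub>1"
    unfolding maxmin_value_def by (intro cSUP_upper2[where x = \<sigma>'] cINF_greatest lower) auto
  moreover have "maxmin_value g q \<pi> k\<^sub>1 \<le> d"
    unfolding maxmin_value_def using order_trans[OF inf_le upper] by (intro cSUP_least) auto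
  ultimately show "maxmin_value g q \<pi> k\<^sub>1 \<in> {c..d}" by simp
  have "bdd_below (range (\<lambda>\<tau>. SUP \<sigma>. ?E \<sigma> \<tau>))"
    using order_trans[OF E(1) le_sup] by (intro bdd_belowI2[where m = 0])
  then have "minmax_value g q \<pi> k\<^sub>1 \<le> d"
    unfolding minmax_value_def by (intro cINF_lower2[where x = \<tau>'] cSUP_least upper) auto
  moreover have "c \<le> minmax_value g q \<pi> k\<^sub>1"
    unfolding minmax_value_def using order_trans[OF lower le_sup] by (intro cINF_greatest) auto
  ultimately show "minmax_value g q \<pi> k\<^sub>1 \<in> {c..d}" by simp
qed

lemma power_variation_partial_sum:
  assumes "power_variation p \<pi> \<le> ennreal e" "0 \<le> e"
  shows "(\<Sum>m<n. \<bar>\<pi> (Suc (Suc m)) powr p - \<pi> (Suc m) powr p\<bar>) \<le> e"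
proof -
  have "ennreal (\<Sum>m<n. \<bar>\<pi> (Suc (Suc m)) powr p - \<pi> (Suc m) powr p\<bar>)
      = (\<Sum>m<n. ennreal \<bar>\<pi> (Suc (Suc m)) powr p - \<pi> (Suc m) powr p\<bar>)"
    by (rule sum_ennreal[symmetric]) auto
  also have "\<dots> \<le> power_variation p \<pi>"
    unfolding power_variation_def by (rule sum_le_suminf) auto
  also note assms(1)
  finally show ?thesis
    using assms(2) by simp
qed

text \<open>\<open>a\<close> is chosen before \<open>\<epsilon>\<close>, as it comes from the rate
  of convergence in this game; \<open>e\<close> then serves all weights and all initial
  states.\<close>

lemma weighted_game_guarantees:
  fixes g :: "'k::finite \<Rightarrow> 'i::finite \<Rightarrow> 'j::finite \<Rightarrow> real"
  assumes g: "\<And>k i j. g k i j \<in> {0..1}" and unif: "is_uniform_value g q v"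
  obtains a where "0 < a"
    "\<And>\<epsilon>. 0 < \<epsilon> \<Longrightarrow> \<exists>e>0. \<forall>\<pi>\<in>stage_weights. power_variation a \<pi> \<le> ennreal e \<longrightarrow>
      (\<forall>k\<^sub>1. \<exists>\<sigma>' \<tau>'. (\<forall>\<tau>. v k\<^sub>1 - \<epsilon> \<le> expected_payoff g q \<pi> k\<^sub>1 \<sigma>' \<tau>) \<and>
        (\<forall>\<sigma>. expected_payoff g q \<pi> k\<^sub>1 \<sigma> \<tau>' \<le> v k\<^sub>1 + \<epsilon>))"
proof -
  have "\<forall>l. \<exists>u x y. 0 < l \<longrightarrow> l \<le> 1 \<longrightarrow> discounted_solution g q l u x y"
    using discounted_solution_exists[where g = g, OF _ _ g] less_imp_le by blast
  then obtain V :: "real \<Rightarrow> 'k \<Rightarrow> real" and X Y where sol': "\<forall>l. 0 < l \<longrightarrow> l \<le> 1 \<longrightarrow> discounted_solution g q l (V l) (X l) (Y l)"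
    unfolding choice_iff by blast
  then have sol: "discounted_solution g q l (V l) (X l) (Y l)" if "0 < l" "l \<le> 1" for l
    using that by blast
  have V01: "V l k \<in> {0..1}" if "0 < l" "l \<le> 1" for l k
    using sol[OF that] by (auto simp: discounted_solution_def)
  have "\<exists>a C. 0 < a \<and> (\<forall>\<^sub>F l in at_right 0. \<bar>V l k - v k\<bar> \<le> C * l powr a)" for k
  proof -
    obtain P where P: "P \<noteq> 0"
      "\<And>l u x y. 0 < l \<Longrightarrow> l \<le> 1 \<Longrightarrow> discounted_solution g q l u x y \<Longrightarrow> eval2 P l (u k) = 0"
      by (rule discounted_value_algebraic[where g = g and q = q and m = k]) blast
    show ?thesis
    proof (rule algebraic_convergence_rate[OF P(1) V01])
      show "eval2 P l (V l k) = 0" if "0 < l" "l \<le> 1" for l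
        by (rule P(2)[OF that sol[OF that]])
      show "((\<lambda>l. V l k) \<longlongrightarrow> v k) (at_right 0)"
        by (rule discounted_value_tendsto_uniform_value[where g = g, OF g unif sol])
    qed
  qed
  then obtain a C where a: "0 < a" "0 < C" and "\<forall>\<^sub>F l in at_right 0. \<forall>k. \<bar>V l k - v k\<bar> \<le> C * l powr a"
    by (rule uniform_convergence_rate)
  then obtain b where b: "0 < b" "\<And>l k. 0 < l \<Longrightarrow> l < b \<Longrightarrow> \<bar>V l k - v k\<bar> \<le> C * l powr a"
    by (auto simp: eventually_at_right_field)
  \<comment> \<open>Half of \<open>b\<close>, because the rate is known for \<open>l < b\<close>
    while \<open>l\<^sub>0\<close> itself must be admissible.\<close>
  define l\<^sub>0 where "l\<^sub>0 = min 1 (b / 2)"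
  have l\<^sub>0: "0 < l\<^sub>0" "l\<^sub>0 \<le> 1"
    using b by (auto simp: l\<^sub>0_def)
  have rate: "\<bar>V l k - v k\<bar> \<le> C * l powr a" if "0 < l" "l \<le> l\<^sub>0" for l k
    using b that by (auto simp: l\<^sub>0_def)
  show ?thesis
  proof (rule that[OF a(1)])
    fix \<epsilon> :: real
    assume "0 < \<epsilon>"
    from weighted_sum_lower_bound[OF a(1) less_imp_le[OF a(2)] l\<^sub>0 this]
    obtain e where e: "0 < e" and bound: "\<And>w. (\<And>m. 0 \<le> w m) \<Longrightarrow> w sums 1 \<Longrightarrow>
        (\<And>n. (\<Sum>m<n. \<bar>w (Suc m) powr a - w m powr a\<bar>) \<le> e) \<Longrightarrow>
      \<exists>\<rho>. (\<forall>m. 0 < \<rho> m \<and> \<rho> m \<le> l\<^sub>0) \<and>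
        (\<forall>G A B. (\<forall>m. G m \<in> {0..1}) \<longrightarrow> (\<forall>l m. 0 < l \<longrightarrow> l \<le> l\<^sub>0 \<longrightarrow> A l m \<in> {0..1}) \<longrightarrow>
          (\<forall>l m. 0 < l \<longrightarrow> l \<le> l\<^sub>0 \<longrightarrow> \<bar>A l m - B m\<bar> \<le> C * l powr a) \<longrightarrow>
          (\<forall>m. A (\<rho> m) m \<le> \<rho> m * G m + (1 - \<rho> m) * A (\<rho> m) (Suc m)) \<longrightarrow>
          B 0 - \<epsilon> \<le> (\<Sum>m. w m * G m))"
      by blast
    show "\<exists>e>0. \<forall>\<pi>\<in>stage_weights. power_variation a \<pi> \<le> ennreal e \<longrightarrow>
      (\<forall>k\<^sub>1. \<exists>\<sigma>' \<tau>'. (\<forall>\<tau>. v k\<^sub>1 - \<epsilon> \<le> expected_payoff g q \<pi> k\<^sub>1 \<sigma>' \<tau>) \<and>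
        (\<forall>\<sigma>. expected_payoff g q \<pi> k\<^sub>1 \<sigma> \<tau>' \<le> v k\<^sub>1 + \<epsilon>))"
    proof (intro exI[of _ e] conjI ballI impI allI e)
      fix \<pi> k\<^sub>1
      assume \<pi>: "\<pi> \<in> stage_weights" and var: "power_variation a \<pi> \<le> ennreal e"
      have w: "0 \<le> \<pi> (Suc m)" "(\<lambda>m. \<pi> (Suc m)) sums 1" for m
        using \<pi> by (auto simp: stage_weights_def)
      obtain \<rho> where \<rho>: "\<And>m. 0 < \<rho> m" "\<And>m. \<rho> m \<le> l\<^sub>0"
        and est: "\<And>G A B. (\<forall>m. G m \<in> {0..1}) \<Longrightarrow> (\<forall>l m. 0 < l \<longrightarrow> l \<le> l\<^sub>0 \<longrightarrow> A l m \<in> {0..1}) \<Longrightarrow>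
          (\<forall>l m. 0 < l \<longrightarrow> l \<le> l\<^sub>0 \<longrightarrow> \<bar>A l m - B m\<bar> \<le> C * l powr a) \<Longrightarrow>
          (\<forall>m. A (\<rho> m) m \<le> \<rho> m * G m + (1 - \<rho> m) * A (\<rho> m) (Suc m)) \<Longrightarrow>
          B 0 - \<epsilon> \<le> (\<Sum>m. \<pi> (Suc m) * G m)"
        using bound[of "\<lambda>m. \<pi> (Suc m)", OF w power_variation_partial_sum[OF var less_imp_le[OF e]]] by blast
      have \<rho>sol: "discounted_solution g q (\<rho> m) (V (\<rho> m)) (X (\<rho> m)) (Y (\<rho> m))" for m
        using sol \<rho> l\<^sub>0 order_trans by blast
      \<comment> \<open>After \<open>m\<close> past triples the play is at stage
        \<open>Suc m\<close>, whose weight \<open>\<pi> (Suc m)\<close> corresponds to the rate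
        \<open>\<rho> m\<close>. The rates are deterministic, so both strategies are
        Markovian.\<close>
      let ?\<sigma> = "\<lambda>(h, k). X (\<rho> (length h)) k" and ?\<tau> = "\<lambda>(h, k). Y (\<rho> (length h)) k"
      have A01: "state_expectation q k\<^sub>1 \<sigma> \<tau> (V l) m \<in> {0..1}" if "0 < l" "l \<le> l\<^sub>0" for l m \<sigma> \<tau>
        using V01[of l] that l\<^sub>0(2) by (intro state_expectation_bounded) auto
      have AB: "\<bar>state_expectation q k\<^sub>1 \<sigma> \<tau> (V l) m - state_expectation q k\<^sub>1 \<sigma> \<tau> v m\<bar> \<le> C * l powr a"
        if "0 < l" "l \<le> l\<^sub>0" for l m \<sigma> \<tau>
        by (intro state_expectation_dist rate that)
      have G: "stage_payoff g q k\<^sub>1 \<sigma> \<tau> m \<in> {0..1}" for \<sigma> \<tau> m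
        by (rule stage_payoff_bounded) (rule g)
      note sums = expected_payoff_sums[where g = g, OF \<pi> g]
      have "v k\<^sub>1 - \<epsilon> \<le> expected_payoff g q \<pi> k\<^sub>1 ?\<sigma> \<tau>" for \<tau>
      proof -
        let ?S = "state_expectation q k\<^sub>1 ?\<sigma> \<tau>" and ?G = "stage_payoff g q k\<^sub>1 ?\<sigma> \<tau>"
        have step: "?S (V (\<rho> m)) m \<le> \<rho> m * ?G m + (1 - \<rho> m) * ?S (V (\<rho> m)) (Suc m)" for m
          using \<rho>sol[of m] by (intro stage_lower_bound[where x = "X (\<rho> m)"]) (auto simp: discounted_solution_def)
        have "?S v 0 - \<epsilon> \<le> (\<Sum>m. \<pi> (Suc m) * ?G m)"
          by (rule est[of ?G "\<lambda>l. ?S (V l)" "?S v"]) (use A01 AB G step in blast)+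
        then show ?thesis
          by (simp add: state_expectation_0 sums_unique[OF sums])
      qed
      moreover have "expected_payoff g q \<pi> k\<^sub>1 \<sigma> ?\<tau> \<le> v k\<^sub>1 + \<epsilon>" for \<sigma>
      proof -
        let ?S = "state_expectation q k\<^sub>1 \<sigma> ?\<tau>" and ?G = "stage_payoff g q k\<^sub>1 \<sigma> ?\<tau>"
        have step: "\<rho> m * ?G m + (1 - \<rho> m) * ?S (V (\<rho> m)) (Suc m) \<le> ?S (V (\<rho> m)) m" for m
          using \<rho>sol[of m] by (intro stage_upper_bound[where y = "Y (\<rho> m)"]) (auto simp: discounted_solution_def)
        have "1 - ?S v 0 - \<epsilon> \<le> (\<Sum>m. \<pi> (Suc m) * (1 - ?G m))"
        proof (rule est[of "\<lambda>m. 1 - ?G m" "\<lambda>l m. 1 - ?S (V l) m" "\<lambda>m. 1 - ?S v m"]; intro allI impI)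
          show "1 - ?G m \<in> {0..1}" for m
            using G[of \<sigma> ?\<tau> m] by simp
          show "1 - ?S (V l) m \<in> {0..1}" if "0 < l" "l \<le> l\<^sub>0" for l m
            using A01[OF that, of \<sigma> ?\<tau> m] by simp
          show "\<bar>1 - ?S (V l) m - (1 - ?S v m)\<bar> \<le> C * l powr a" if "0 < l" "l \<le> l\<^sub>0" for l m
            using AB[OF that, of \<sigma> ?\<tau> m] by (simp add: abs_minus_commute)
          show "1 - ?S (V (\<rho> m)) m \<le> \<rho> m * (1 - ?G m) + (1 - \<rho> m) * (1 - ?S (V (\<rho> m)) (Suc m))" for m
            using step[of m] by (simp add: algebra_simps)
        qed
        also have "(\<Sum>m. \<pi> (Suc m) * (1 - ?G m)) = 1 - expected_payoff g q \<pi> k\<^sub>1 \<sigma> ?\<tau>"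
          using sums_diff[OF w(2) sums[of q k\<^sub>1 \<sigma> ?\<tau>]] by (simp add: right_diff_distrib sums_iff)
        finally show ?thesis
          by (simp add: state_expectation_0)
      qed
      ultimately show "\<exists>\<sigma>' \<tau>'. (\<forall>\<tau>. v k\<^sub>1 - \<epsilon> \<le> expected_payoff g q \<pi> k\<^sub>1 \<sigma>' \<tau>) \<and>
          (\<forall>\<sigma>. expected_payoff g q \<pi> k\<^sub>1 \<sigma> \<tau>' \<le> v k\<^sub>1 + \<epsilon>)"
        by blast
    qed
  qed
qed

theorem corollary2:
  fixes \<pi> :: "nat \<Rightarrow> nat \<Rightarrow> real"
    and g :: "'k::finite \<Rightarrow> 'i::finite \<Rightarrow> 'j::finite \<Rightarrow> real"
    and q :: "'k \<Rightarrow> 'i \<Rightarrow> 'j \<Rightarrow> 'k pmf"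
    and v_inf :: "'k \<Rightarrow> real"
  assumes "\<And>n. \<pi> n \<in> stage_weights"
    and "\<And>p. p > 0 \<Longrightarrow> (\<lambda>n. power_variation p (\<pi> n)) \<longlonglongrightarrow> 0"
    and "\<And>k i j. g k i j \<in> {0..1}"
    and "is_uniform_value g q v_inf"
  shows "(\<lambda>n. maxmin_value g q (\<pi> n) k\<^sub>1) \<longlonglongrightarrow> v_inf k\<^sub>1 \<and>
    (\<lambda>n. minmax_value g q (\<pi> n) k\<^sub>1) \<longlonglongrightarrow> v_inf k\<^sub>1"
proof -
  obtain a where a: "0 < a" and guarantee:
    "\<And>\<epsilon>. 0 < \<epsilon> \<Longrightarrow> \<exists>e>0. \<forall>\<pi>\<in>stage_weights. power_variation a \<pi> \<le> ennreal e \<longrightarrow>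
      (\<forall>k\<^sub>1. \<exists>\<sigma>' \<tau>'. (\<forall>\<tau>. v_inf k\<^sub>1 - \<epsilon> \<le> expected_payoff g q \<pi> k\<^sub>1 \<sigma>' \<tau>) \<and>
        (\<forall>\<sigma>. expected_payoff g q \<pi> k\<^sub>1 \<sigma> \<tau>' \<le> v_inf k\<^sub>1 + \<epsilon>))"
    by (rule weighted_game_guarantees[where g = g, OF assms(3,4)]) blast
  have near: "\<forall>\<^sub>F n in sequentially. dist (maxmin_value g q (\<pi> n) k\<^sub>1) (v_inf k\<^sub>1) < \<epsilon> \<and>
      dist (minmax_value g q (\<pi> n) k\<^sub>1) (v_inf k\<^sub>1) < \<epsilon>" if "0 < \<epsilon>" for \<epsilon>
  proof -
    obtain e where e: "0 < e" and guarantee_e: "\<forall>\<pi>\<in>stage_weights. power_variation a \<pi> \<le> ennreal e \<longrightarrow>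
      (\<forall>k\<^sub>1. \<exists>\<sigma>' \<tau>'. (\<forall>\<tau>. v_inf k\<^sub>1 - \<epsilon> / 2 \<le> expected_payoff g q \<pi> k\<^sub>1 \<sigma>' \<tau>) \<and>
        (\<forall>\<sigma>. expected_payoff g q \<pi> k\<^sub>1 \<sigma> \<tau>' \<le> v_inf k\<^sub>1 + \<epsilon> / 2))"
      using guarantee[of "\<epsilon> / 2"] \<open>0 < \<epsilon>\<close> by auto
    have "\<forall>\<^sub>F n in sequentially. power_variation a (\<pi> n) < ennreal e"
      using assms(2)[OF a] e by (intro order_tendstoD) auto
    then show ?thesis
    proof eventually_elim
      case (elim n)
      then obtain \<sigma>' \<tau>' where "\<And>\<tau>. v_inf k\<^sub>1 - \<epsilon> / 2 \<le> expected_payoff g q (\<pi> n) k\<^sub>1 \<sigma>' \<tau>"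
        "\<And>\<sigma>. expected_payoff g q (\<pi> n) k\<^sub>1 \<sigma> \<tau>' \<le> v_inf k\<^sub>1 + \<epsilon> / 2"
        using guarantee_e assms(1)[of n] by (meson less_imp_le)
      note values_between[where g = g, OF assms(1,3) this]
      then show ?case
        using \<open>0 < \<epsilon>\<close> by (auto simp: dist_real_def abs_less_iff)
    qed
  qed
  show ?thesis
    by (intro conjI tendstoI; rule eventually_mono[OF near]) auto
qed

end
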